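(* Let $s>-1/2$. The (bi-analytic) Birkhoff map $\Phi:H^s_{r,0}\to\mathfrak{h}^{\frac12+s}_{r,0}$ of the Benjamin-Ono equation cannot be extended to an analytic map $\Phi:H^{-1/2,\sqrt{\log}}_{r,0}\to\mathfrak{h}^{0,\sqrt{\log}}_{r,0}$.
   Context: Let $\mathbb{T}=\mathbb{R}/2\pi\mathbb{Z}$, $\langle n\rangle:=\max(1,|n|)$, and let $\widehat u(n)$, $n\in\mathbb{Z}$, be the Fourier coefficients of a periodic distribution $u$. Analytic means real-analytic between real Hilbert spaces. Spaces. For $\beta\in\mathbb{R}$: $H^\beta_c=H^\beta(\mathbb{T},\mathbb{C})$ with norm $\|u\|_\beta^2=\sum_{n}\langle n\rangle^{2\beta}|\widehat u(n)|^2$; $H^\beta_{r,0}=\{u\in H^\beta_c : u \text{ real-valued},\ \widehat u(0)=0\}$; $H^\beta_+=\{f\in H^\beta_c:\widehat f(n)=0\ \forall n<0\}$, $L^2_+=H^0_+$. $H^{\beta,\sqrt{\log}}_{r,0}$ is the Hilbert space of $u\in H^\beta_{r,0}$ with $\sum_{n}\langle n\rangle^{2\beta}\log(\langle n\rangle+1)|\widehat u(n)|^2<\infty$. $\mathfrak{h}^\beta_{r,0}$ is the real Hilbert space of complex sequences $(z_n)_{n\in\mathbb{Z}}$ with $z_0=0$, $z_{-n}=\overline{z_n}$ and $\sum_n\langle n\rangle^{2\beta}|z_n|^2<\infty$; $\mathfrak{h}^{\beta,\sqrt{\log}}_{r,0}$ is the subspace where $\sum_n\langle n\rangle^{2\beta}\log(\langle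 n\rangle+1)|z_n|^2<\infty$, with the corresponding norm. One has $H^s_{r,0}\subset H^{-1/2,\sqrt{\log}}_{r,0}$ for $s>-1/2$. Birkhoff map. Let $\langle f|g\rangle=\frac{1}{2\pi}\int_0^{2\pi}f\overline g\,dx$. For $u\in H^s_{r,0}$ with $-1/2<s\le 0$, let $L_u=D-T_u:H^{1+s}_+\to H^s_+$, with $D=-i\partial_x$, $T_uf=\Pi(uf)$, $\Pi$ the Szegő projector onto nonnegative Fourier modes. It is known that its spectrum consists of simple real eigenvalues $\lambda_0(u)<\lambda_1(u)<\cdots$ with $\lambda_{n+1}\ge\lambda_n+1$, and that there is a unique orthonormal basis $(f_n(u))_{n\ge0}$ of $L^2_+$ with $f_n\in H^{1+s}_+$, $L_uf_n=\lambda_nf_n$, $\langle f_0|1\rangle>0$, $\langle f_n|e^{ix}f_{n-1}\rangle>0$ for $n\ge1$. Put $\gamma_n=\lambda_n-\lambda_{n-1}-1$ and, for $n\ge1$, $\kappa_n=\frac{1}{\lambda_n-\lambda_0}\prod_{p\ge1,\,p\ne n}\big(1-\frac{\gamma_p}{\lambda_p-\lambda_n}\big)>0$. Then $\Phi(u)=(\Phi_n(u))_{n\in\mathbb{Z}}$ with $\Phi_n(u)=\langle 1|f_n(u)\rangle/\sqrt{\kappa_n(u)}$ for $n\ge1$, $\Phi_0(u)=0$, and $n$-th entry $\overline{\Phi_{-n}(u)}$ for $n\le-1$. For every $s>-1/2$, $\Phi:H^s_{r,0}\to\mathfrak{h}^{1/2+s}_{r,0}$ is known to be a bianalytic diffeomorphism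 (for $s>0$, $\Phi$ is the restriction of the map on $H^0_{r,0}$). *)

theory Defs
  imports "HOL-Analysis.Analysis"
begin

text \<open>
  Periodic distributions are represented by their Fourier coefficients: \<open>u :: int \<Rightarrow> complex\<close>
  stands for the distribution \<open>\<Sum>n. u n e\<^sup>i\<^sup>n\<^sup>x\<close>. Every space below consists of
  sequences of polynomial growth, for which this is a bijection. In this representation the
  Sobolev spaces \<open>H\<close> of distributions and the spaces \<open>h\<close> of sequences have the same form;
  reality of a distribution is the condition \<open>u (-n) = cnj (u n)\<close>.
\<close>

definition jap :: "int \<Rightarrow> real" where
  "jap n = max 1 \<bar>real_of_int n\<bar>"

definition Hc :: "real \<Rightarrow> (int \<Rightarrow> complex) set" where
  "Hc \<beta> = {u. (\<lambda>n. jap n powr (2 * \<beta>) * (cmod (u n))\<^sup>2) summable_on UNIV}"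

definition Hr0 :: "real \<Rightarrow> (int \<Rightarrow> complex) set" where
  "Hr0 \<beta> = {u \<in> Hc \<beta>. u 0 = 0 \<and> (\<forall>n. u (- n) = cnj (u n))}"

definition Hplus :: "real \<Rightarrow> (int \<Rightarrow> complex) set" where
  "Hplus \<beta> = {f \<in> Hc \<beta>. \<forall>n<0. f n = 0}"

definition log_weight :: "real \<Rightarrow> int \<Rightarrow> real" where
  "log_weight \<beta> n = jap n powr (2 * \<beta>) * ln (jap n + 1)"

definition Hr0_log :: "real \<Rightarrow> (int \<Rightarrow> complex) set" where
  "Hr0_log \<beta> = {u \<in> Hr0 \<beta>. (\<lambda>n. log_weight \<beta> n * (cmod (u n))\<^sup>2) summable_on UNIV}"

definition ip_log :: "real \<Rightarrow> (int \<Rightarrow> complex) \<Rightarrow> (int \<Rightarrow> complex) \<Rightarrow> real" where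
  "ip_log \<beta> u v = (\<Sum>\<^sub>\<infinity>n. log_weight \<beta> n * Re (u n * cnj (v n)))"


lemma log_weight_pos: "log_weight \<beta> n > 0"
  by (auto simp: log_weight_def jap_def intro!: mult_pos_pos ln_gt_zero)

lemma log_weight_mult_nonneg: "0 \<le> log_weight \<beta> n * (cmod z)\<^sup>2"
  using log_weight_pos[of \<beta> n] by (intro mult_nonneg_nonneg) auto

lemma Hr0_logI:
  assumes "u 0 = 0" "\<And>n. u (- n) = cnj (u n)"
    and s: "(\<lambda>n. log_weight \<beta> n * (cmod (u n))\<^sup>2) summable_on UNIV"
  shows "u \<in> Hr0_log \<beta>"
proof -
  have "(\<lambda>n. (1 / ln 2) * (log_weight \<beta> n * (cmod (u n))\<^sup>2)) summable_on UNIV"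
    using s by (rule summable_on_cmult_right)
  then have "(\<lambda>n. jap n powr (2 * \<beta>) * (cmod (u n))\<^sup>2) summable_on UNIV"
  proof (rule summable_on_comparison_test)
    fix n :: int
    have "ln 2 \<le> ln (jap n + 1)"
      by (auto simp: jap_def)
    then have "1 \<le> (1 / ln 2) * ln (jap n + 1)"
      by (simp add: field_simps)
    then have "(jap n powr (2 * \<beta>) * (cmod (u n))\<^sup>2) * 1
        \<le> (jap n powr (2 * \<beta>) * (cmod (u n))\<^sup>2) * ((1 / ln 2) * ln (jap n + 1))"
      by (rule mult_left_mono) auto
    then show "jap n powr (2 * \<beta>) * (cmod (u n))\<^sup>2
        \<le> (1 / ln 2) * (log_weight \<beta> n * (cmod (u n))\<^sup>2)"
      by (simp add: log_weight_def mult_ac)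
  qed auto
  then show ?thesis
    using assms by (auto simp: Hr0_log_def Hr0_def Hc_def)
qed

lemma Hr0_logD:
  assumes "u \<in> Hr0_log \<beta>"
  shows "u 0 = 0" "u (- n) = cnj (u n)"
    "(\<lambda>n. log_weight \<beta> n * (cmod (u n))\<^sup>2) summable_on UNIV"
  using assms by (auto simp: Hr0_log_def Hr0_def)

lemma zero_Hr0_log: "(\<lambda>n. 0) \<in> Hr0_log \<beta>"
  by (rule Hr0_logI) auto

lemma scale_Hr0_log:
  assumes "u \<in> Hr0_log \<beta>"
  shows "(\<lambda>n. complex_of_real c * u n) \<in> Hr0_log \<beta>"
proof (rule Hr0_logI)
  have "(\<lambda>n. c\<^sup>2 * (log_weight \<beta> n * (cmod (u n))\<^sup>2)) summable_on UNIV"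
    by (intro summable_on_cmult_right Hr0_logD[OF assms])
  then show "(\<lambda>n. log_weight \<beta> n * (cmod (complex_of_real c * u n))\<^sup>2) summable_on UNIV"
    by (simp add: norm_mult power_mult_distrib mult_ac)
qed (use Hr0_logD[OF assms] in auto)

lemma add_Hr0_log:
  assumes "u \<in> Hr0_log \<beta>" "v \<in> Hr0_log \<beta>"
  shows "(\<lambda>n. u n + v n) \<in> Hr0_log \<beta>"
proof (rule Hr0_logI)
  have "(\<lambda>n. 2 * (log_weight \<beta> n * (cmod (u n))\<^sup>2 + log_weight \<beta> n * (cmod (v n))\<^sup>2)) summable_on UNIV"
    by (intro summable_on_cmult_right summable_on_add Hr0_logD[OF assms(1)] Hr0_logD[OF assms(2)])
  then show "(\<lambda>n. log_weight \<beta> n * (cmod (u n + v n))\<^sup>2) summable_on UNIV"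
  proof (rule summable_on_comparison_test)
    fix n :: int
    have "(cmod (u n + v n))\<^sup>2 \<le> (cmod (u n) + cmod (v n))\<^sup>2"
      by (intro power_mono norm_triangle_ineq) auto
    also have "\<dots> \<le> 2 * ((cmod (u n))\<^sup>2 + (cmod (v n))\<^sup>2)"
      using sum_squares_bound[of "cmod (u n)" "cmod (v n)"] by (simp add: power2_sum)
    finally have "log_weight \<beta> n * (cmod (u n + v n))\<^sup>2
        \<le> log_weight \<beta> n * (2 * ((cmod (u n))\<^sup>2 + (cmod (v n))\<^sup>2))"
      using log_weight_pos[of \<beta> n] by (intro mult_left_mono) auto
    then show "log_weight \<beta> n * (cmod (u n + v n))\<^sup>2
        \<le> 2 * (log_weight \<beta> n * (cmod (u n))\<^sup>2 + log_weight \<beta> n * (cmod (v n))\<^sup>2)"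
      by (simp add: algebra_simps)
  qed (rule log_weight_mult_nonneg)
qed (use Hr0_logD[OF assms(1)] Hr0_logD[OF assms(2)] in auto)

lemma ip_log_summable:
  assumes "u \<in> Hr0_log \<beta>" "v \<in> Hr0_log \<beta>"
  shows "(\<lambda>n. log_weight \<beta> n * Re (u n * cnj (v n))) summable_on UNIV"
proof -
  have "(\<lambda>n. log_weight \<beta> n * (cmod (u n))\<^sup>2 + log_weight \<beta> n * (cmod (v n))\<^sup>2) summable_on UNIV"
    by (intro summable_on_add Hr0_logD[OF assms(1)] Hr0_logD[OF assms(2)])
  then have "(\<lambda>n. norm (log_weight \<beta> n * Re (u n * cnj (v n)))) summable_on UNIV"
  proof (rule summable_on_comparison_test)
    fix n :: int
    have "\<bar>Re (u n * cnj (v n))\<bar> \<le> cmod (u n) * cmod (v n)"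
      using abs_Re_le_cmod[of "u n * cnj (v n)"] by (simp add: norm_mult)
    also have "\<dots> \<le> (cmod (u n))\<^sup>2 + (cmod (v n))\<^sup>2"
    proof -
      have "0 \<le> cmod (u n) * cmod (v n)" by simp
      then show ?thesis using sum_squares_bound[of "cmod (u n)" "cmod (v n)"] by linarith
    qed
    finally have "log_weight \<beta> n * \<bar>Re (u n * cnj (v n))\<bar>
        \<le> log_weight \<beta> n * ((cmod (u n))\<^sup>2 + (cmod (v n))\<^sup>2)"
      using log_weight_pos[of \<beta> n] by (intro mult_left_mono) auto
    then show "norm (log_weight \<beta> n * Re (u n * cnj (v n)))
        \<le> log_weight \<beta> n * (cmod (u n))\<^sup>2 + log_weight \<beta> n * (cmod (v n))\<^sup>2"
      using log_weight_pos[of \<beta> n] by (simp add: abs_mult distrib_left del: times_complex.sel)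
  qed auto
  then show ?thesis
    by (rule abs_summable_summable)
qed

lemma ip_log_commute: "ip_log \<beta> u v = ip_log \<beta> v u"
  by (simp add: ip_log_def mult_ac)

lemma ip_log_add:
  assumes "u \<in> Hr0_log \<beta>" "v \<in> Hr0_log \<beta>" "w \<in> Hr0_log \<beta>"
  shows "ip_log \<beta> (\<lambda>n. u n + v n) w = ip_log \<beta> u w + ip_log \<beta> v w"
  using infsum_add[OF ip_log_summable[OF assms(1,3)] ip_log_summable[OF assms(2,3)]]
  by (simp add: ip_log_def algebra_simps)

lemma ip_log_scale: "ip_log \<beta> (\<lambda>n. complex_of_real c * u n) v = c * ip_log \<beta> u v"
proof -
  have "ip_log \<beta> (\<lambda>n. complex_of_real c * u n) v
      = (\<Sum>\<^sub>\<infinity>n. c * (log_weight \<beta> n * Re (u n * cnj (v n))))"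
    unfolding ip_log_def by (intro infsum_cong) (simp add: algebra_simps)
  then show ?thesis
    by (simp add: ip_log_def infsum_cmult_right')
qed

lemma ip_log_self: "ip_log \<beta> u u = (\<Sum>\<^sub>\<infinity>n. log_weight \<beta> n * (cmod (u n))\<^sup>2)"
  unfolding ip_log_def
  by (intro infsum_cong) (simp add: complex_norm_square[symmetric] del: times_complex.sel of_real_power)

lemma ip_log_nonneg: "0 \<le> ip_log \<beta> u u"
  unfolding ip_log_self by (intro infsum_nonneg log_weight_mult_nonneg)

lemma ip_log_eq_0_iff:
  assumes "u \<in> Hr0_log \<beta>"
  shows "ip_log \<beta> u u = 0 \<longleftrightarrow> u = (\<lambda>n. 0)"
proof
  assume "ip_log \<beta> u u = 0"
  then have "log_weight \<beta> n * (cmod (u n))\<^sup>2 = 0" for n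
    unfolding ip_log_self
    by (rule nonneg_infsum_le_0D[OF eq_refl])
       (use Hr0_logD(3)[OF assms] log_weight_mult_nonneg in auto)
  then show "u = (\<lambda>n. 0)"
    using log_weight_pos[of \<beta>] by (metis less_irrefl mult_eq_0_iff norm_eq_zero power_eq_0_iff ext)
qed (simp add: ip_log_def)

text \<open>The first type is the space of distributions $H^{-1/2,\sqrt{\log}}_{r,0}$, the second the
  sequence space $h^{0,\sqrt{\log}}_{r,0}$.\<close>

typedef H_mhalf_log = "Hr0_log (- 1/2)"
  morphisms fourier_coeff Abs_H_mhalf_log
  using zero_Hr0_log by blast

typedef h_zero_log = "Hr0_log 0"
  morphisms entry Abs_h_zero_log
  using zero_Hr0_log by blast

setup_lifting type_definition_H_mhalf_log
setup_lifting type_definition_h_zero_log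

instantiation H_mhalf_log :: real_inner
begin

lift_definition zero_H_mhalf_log :: H_mhalf_log is "\<lambda>n. 0"
  by (rule zero_Hr0_log)

lift_definition plus_H_mhalf_log :: "H_mhalf_log \<Rightarrow> H_mhalf_log \<Rightarrow> H_mhalf_log" is "\<lambda>u v n. u n + v n"
  by (rule add_Hr0_log)

lift_definition scaleR_H_mhalf_log :: "real \<Rightarrow> H_mhalf_log \<Rightarrow> H_mhalf_log" is
  "\<lambda>c u n. complex_of_real c * u n"
  by (rule scale_Hr0_log)

definition "uminus x = (-1) *\<^sub>R (x::H_mhalf_log)"

definition "x - y = x + - (y::H_mhalf_log)"

lift_definition inner_H_mhalf_log :: "H_mhalf_log \<Rightarrow> H_mhalf_log \<Rightarrow> real" is "ip_log (- 1/2)" .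

definition "norm (x::H_mhalf_log) = sqrt (inner x x)"

definition "dist (x::H_mhalf_log) y = norm (x - y)"

definition sgn_H_mhalf_log :: "H_mhalf_log \<Rightarrow> H_mhalf_log" where
  "sgn_H_mhalf_log x = inverse (norm x) *\<^sub>R x"

definition "uniformity = (INF e\<in>{0<..}. principal {(x::H_mhalf_log, y). dist x y < e})"

definition "open (U :: H_mhalf_log set) =
  (\<forall>x\<in>U. eventually (\<lambda>(x', y). x' = x \<longrightarrow> y \<in> U) uniformity)"

instance
proof
  fix x y z :: H_mhalf_log and a b :: real
  show "x + y + z = x + (y + z)" by transfer (simp add: add_ac)
  show "x + y = y + x" by transfer (simp add: add_ac)
  show "0 + x = x" by transfer simp
  show "- x + x = 0" unfolding uminus_H_mhalf_log_def by transfer simp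
  show "x - y = x + - y" by (rule minus_H_mhalf_log_def)
  show "a *\<^sub>R (x + y) = a *\<^sub>R x + a *\<^sub>R y" by transfer (simp add: algebra_simps)
  show "(a + b) *\<^sub>R x = a *\<^sub>R x + b *\<^sub>R x" by transfer (simp add: algebra_simps)
  show "a *\<^sub>R b *\<^sub>R x = (a * b) *\<^sub>R x" by transfer (simp add: algebra_simps)
  show "1 *\<^sub>R x = x" by transfer simp
  show "inner x y = inner y x" by transfer (rule ip_log_commute)
  show "inner (x + y) z = inner x z + inner y z" by transfer (rule ip_log_add)
  show "inner (a *\<^sub>R x) y = a * inner x y" by transfer (rule ip_log_scale)
  show "0 \<le> inner x x" by transfer (rule ip_log_nonneg)
  show "(inner x x = 0) = (x = 0)" by transfer (rule ip_log_eq_0_iff)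
qed (rule norm_H_mhalf_log_def dist_H_mhalf_log_def sgn_H_mhalf_log_def uniformity_H_mhalf_log_def open_H_mhalf_log_def)+

end

instantiation h_zero_log :: real_inner
begin

lift_definition zero_h_zero_log :: h_zero_log is "\<lambda>n. 0"
  by (rule zero_Hr0_log)

lift_definition plus_h_zero_log :: "h_zero_log \<Rightarrow> h_zero_log \<Rightarrow> h_zero_log" is "\<lambda>u v n. u n + v n"
  by (rule add_Hr0_log)

lift_definition scaleR_h_zero_log :: "real \<Rightarrow> h_zero_log \<Rightarrow> h_zero_log" is
  "\<lambda>c u n. complex_of_real c * u n"
  by (rule scale_Hr0_log)

definition "uminus x = (-1) *\<^sub>R (x::h_zero_log)"

definition "x - y = x + - (y::h_zero_log)"

lift_definition inner_h_zero_log :: "h_zero_log \<Rightarrow> h_zero_log \<Rightarrow> real" is "ip_log 0" .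

definition "norm (x::h_zero_log) = sqrt (inner x x)"

definition "dist (x::h_zero_log) y = norm (x - y)"

definition sgn_h_zero_log :: "h_zero_log \<Rightarrow> h_zero_log" where
  "sgn_h_zero_log x = inverse (norm x) *\<^sub>R x"

definition "uniformity = (INF e\<in>{0<..}. principal {(x::h_zero_log, y). dist x y < e})"

definition "open (U :: h_zero_log set) =
  (\<forall>x\<in>U. eventually (\<lambda>(x', y). x' = x \<longrightarrow> y \<in> U) uniformity)"

instance
proof
  fix x y z :: h_zero_log and a b :: real
  show "x + y + z = x + (y + z)" by transfer (simp add: add_ac)
  show "x + y = y + x" by transfer (simp add: add_ac)
  show "0 + x = x" by transfer simp
  show "- x + x = 0" unfolding uminus_h_zero_log_def by transfer simp
  show "x - y = x + - y" by (rule minus_h_zero_log_def)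
  show "a *\<^sub>R (x + y) = a *\<^sub>R x + a *\<^sub>R y" by transfer (simp add: algebra_simps)
  show "(a + b) *\<^sub>R x = a *\<^sub>R x + b *\<^sub>R x" by transfer (simp add: algebra_simps)
  show "a *\<^sub>R b *\<^sub>R x = (a * b) *\<^sub>R x" by transfer (simp add: algebra_simps)
  show "1 *\<^sub>R x = x" by transfer simp
  show "inner x y = inner y x" by transfer (rule ip_log_commute)
  show "inner (x + y) z = inner x z + inner y z" by transfer (rule ip_log_add)
  show "inner (a *\<^sub>R x) y = a * inner x y" by transfer (rule ip_log_scale)
  show "0 \<le> inner x x" by transfer (rule ip_log_nonneg)
  show "(inner x x = 0) = (x = 0)" by transfer (rule ip_log_eq_0_iff)
qed (rule norm_h_zero_log_def dist_h_zero_log_def sgn_h_zero_log_def uniformity_h_zero_log_def open_h_zero_log_def)+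

end


lemma Hr0_subset_Hr0_log:
  assumes s: "s > - 1/2"
  shows "Hr0 s \<subseteq> Hr0_log (- 1/2)"
proof
  fix u assume u: "u \<in> Hr0 s"
  define a where "a = 2 * s + 1"
  have a: "a > 0" using s by (simp add: a_def)
  have "(\<lambda>n. (2 powr a / a) * (jap n powr (2 * s) * (cmod (u n))\<^sup>2)) summable_on UNIV"
    using u by (intro summable_on_cmult_right) (auto simp: Hr0_def Hc_def)
  then have "(\<lambda>n. log_weight (- 1/2) n * (cmod (u n))\<^sup>2) summable_on UNIV"
  proof (rule summable_on_comparison_test)
    fix n :: int
    have j: "jap n \<ge> 1" by (simp add: jap_def)
    have "ln (jap n + 1) \<le> (jap n + 1) powr a / a"
      using j a by (intro ln_powr_bound) auto
    also have "\<dots> \<le> (2 * jap n) powr a / a"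
      using j a by (intro divide_right_mono powr_mono2) auto
    also have "\<dots> = (2 powr a / a) * jap n powr a"
      using j by (simp add: powr_mult)
    finally have "jap n powr (- 1) * ln (jap n + 1)
        \<le> jap n powr (- 1) * ((2 powr a / a) * jap n powr a)"
      by (intro mult_left_mono) auto
    also have "\<dots> = (2 powr a / a) * jap n powr (2 * s)"
      using j by (simp add: a_def powr_add powr_minus field_simps)
    finally have "log_weight (- 1/2) n \<le> (2 powr a / a) * jap n powr (2 * s)"
      by (simp add: log_weight_def)
    then show "log_weight (- 1/2) n * (cmod (u n))\<^sup>2
        \<le> (2 powr a / a) * (jap n powr (2 * s) * (cmod (u n))\<^sup>2)"
      using mult_right_mono[of _ _ "(cmod (u n))\<^sup>2"] by (fastforce simp: mult_ac)
  qed (rule log_weight_mult_nonneg)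
  then show "u \<in> Hr0_log (- 1/2)"
    using u by (intro Hr0_logI) (auto simp: Hr0_def)
qed


text \<open>
  A single function \<open>A\<close> on lists carries the whole sequence of Taylor coefficients: its restriction
  to lists of length \<open>k\<close> is the \<open>k\<close>-linear one. Symmetry is not required, since only the values
  on the diagonal enter the power series and \<open>A\<close> can be symmetrized without increasing norms.
\<close>

definition multilinear_bounded ::
  "nat \<Rightarrow> real \<Rightarrow> ('a::real_normed_vector list \<Rightarrow> 'b::real_normed_vector) \<Rightarrow> bool" where
  "multilinear_bounded k C A \<longleftrightarrow>
     (\<forall>xs. length xs = k \<longrightarrow>
        (\<forall>i<k. linear (\<lambda>x. A (xs[i := x]))) \<and>
        norm (A xs) \<le> C * prod_list (map norm xs))"

definition real_analytic_at ::
  "('a::real_normed_vector \<Rightarrow> 'b::real_normed_vector) \<Rightarrow> 'a \<Rightarrow> bool" where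
  "real_analytic_at f x \<longleftrightarrow>
     (\<exists>A C r. r > 0 \<and>
        (\<forall>k. C k \<ge> 0 \<and> multilinear_bounded k (C k) A) \<and>
        summable (\<lambda>k. C k * r ^ k) \<and>
        (\<forall>h. norm h < r \<longrightarrow> (\<lambda>k. A (replicate k h)) sums f (x + h)))"

definition real_analytic :: "('a::real_normed_vector \<Rightarrow> 'b::real_normed_vector) \<Rightarrow> bool" where
  "real_analytic f \<longleftrightarrow> (\<forall>x. real_analytic_at f x)"


text \<open>By Parseval, this is $\frac{1}{2\pi}\int_0^{2\pi} f \overline{g}\,dx$ for
  \<open>f\<close> and \<open>g\<close> in $L^2$.\<close>

definition ip :: "(int \<Rightarrow> complex) \<Rightarrow> (int \<Rightarrow> complex) \<Rightarrow> complex" where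
  "ip f g = (\<Sum>\<^sub>\<infinity>n. f n * cnj (g n))"

definition mode :: "int \<Rightarrow> int \<Rightarrow> complex" where
  "mode k = (\<lambda>n. if n = k then 1 else 0)"

text \<open>The product of two distributions is the convolution of their Fourier coefficients. For
  \<open>u\<close> in \<open>Hc s\<close> and \<open>f\<close> in \<open>Hc (1 + s)\<close> with \<open>s > -1/2\<close> the series converges absolutely.\<close>

definition mult :: "(int \<Rightarrow> complex) \<Rightarrow> (int \<Rightarrow> complex) \<Rightarrow> int \<Rightarrow> complex" where
  "mult u f n = (\<Sum>\<^sub>\<infinity>k. u (n - k) * f k)"

definition Szego :: "(int \<Rightarrow> complex) \<Rightarrow> int \<Rightarrow> complex" where
  "Szego f n = (if n \<ge> 0 then f n else 0)"

definition Toeplitz :: "(int \<Rightarrow> complex) \<Rightarrow> (int \<Rightarrow> complex) \<Rightarrow> int \<Rightarrow> complex" where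
  "Toeplitz u f = Szego (mult u f)"

definition Lax :: "(int \<Rightarrow> complex) \<Rightarrow> (int \<Rightarrow> complex) \<Rightarrow> int \<Rightarrow> complex" where
  "Lax u f n = of_int n * f n - Toeplitz u f n"

text \<open>\<open>Lax u\<close> is bounded from \<open>Hplus (1 + s)\<close> to \<open>Hplus s\<close>, so by the open mapping theorem a
  bijective \<open>Lax u - \<mu>\<close> has a bounded inverse; no boundedness condition is needed.\<close>

definition Lax_spectrum :: "real \<Rightarrow> (int \<Rightarrow> complex) \<Rightarrow> complex set" where
  "Lax_spectrum s u =
     {\<mu>. \<not> bij_betw (\<lambda>f n. Lax u f n - \<mu> * f n) (Hplus (1 + s)) (Hplus s)}"

definition Lax_ev :: "real \<Rightarrow> (int \<Rightarrow> complex) \<Rightarrow> nat \<Rightarrow> real" where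
  "Lax_ev s u =
     (THE l. strict_mono l \<and> range (\<lambda>n. complex_of_real (l n)) = Lax_spectrum s u)"

definition orthonormal_basis_L2_plus :: "(nat \<Rightarrow> int \<Rightarrow> complex) \<Rightarrow> bool" where
  "orthonormal_basis_L2_plus f \<longleftrightarrow>
     (\<forall>n. f n \<in> Hplus 0) \<and>
     (\<forall>m n. ip (f m) (f n) = (if m = n then 1 else 0)) \<and>
     (\<forall>g \<in> Hplus 0.
        (\<lambda>N. \<Sum>\<^sub>\<infinity>k. (cmod (g k - (\<Sum>n<N. ip g (f n) * f n k)))\<^sup>2) \<longlonglongrightarrow> 0)"

definition Lax_basis :: "real \<Rightarrow> (int \<Rightarrow> complex) \<Rightarrow> nat \<Rightarrow> int \<Rightarrow> complex" where
  "Lax_basis s u =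
     (THE f. orthonormal_basis_L2_plus f \<and>
        (\<forall>n. f n \<in> Hplus (1 + s)) \<and>
        (\<forall>n. Lax u (f n) = (\<lambda>k. complex_of_real (Lax_ev s u n) * f n k)) \<and>
        (ip (f 0) (mode 0) \<in> \<real> \<and> Re (ip (f 0) (mode 0)) > 0) \<and>
        (\<forall>n\<ge>1. ip (f n) (mult (mode 1) (f (n - 1))) \<in> \<real> \<and>
                Re (ip (f n) (mult (mode 1) (f (n - 1)))) > 0))"

definition gap :: "real \<Rightarrow> (int \<Rightarrow> complex) \<Rightarrow> nat \<Rightarrow> real" where
  "gap s u n = Lax_ev s u n - Lax_ev s u (n - 1) - 1"

definition kappa :: "real \<Rightarrow> (int \<Rightarrow> complex) \<Rightarrow> nat \<Rightarrow> real" where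
  "kappa s u n =
     1 / (Lax_ev s u n - Lax_ev s u 0) *
     (\<Prod>p. if p = 0 \<or> p = n then 1 else 1 - gap s u p / (Lax_ev s u p - Lax_ev s u n))"

definition Birkhoff_pos :: "real \<Rightarrow> (int \<Rightarrow> complex) \<Rightarrow> nat \<Rightarrow> complex" where
  "Birkhoff_pos s u n = ip (mode 0) (Lax_basis s u n) / complex_of_real (sqrt (kappa s u n))"

text \<open>The map on \<open>Hr0 s\<close>, for \<open>s > -1/2\<close>; for \<open>s > 0\<close> it is the restriction of the map on
  \<open>Hr0 0\<close>, which is what \<open>min s 0\<close> accomplishes.\<close>

definition Birkhoff :: "real \<Rightarrow> (int \<Rightarrow> complex) \<Rightarrow> int \<Rightarrow> complex" where
  "Birkhoff s u n =
     (if n > 0 then Birkhoff_pos (min s 0) u (nat n)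
      else if n = 0 then 0
      else cnj (Birkhoff_pos (min s 0) u (nat (- n))))"

end

theory Submission
  imports Defs
begin

text \<open>
  Why no analytic extension exists. If \<open>\<Psi>\<close> extended \<open>\<Phi>\<close> analytically, its second Taylor coefficient at
  \<open>0\<close> would be a bounded quadratic map from $H^{-1/2,\sqrt{\log}}_{r,0}$ to
  $h^{0,\sqrt{\log}}_{r,0}$. On trigonometric polynomials \<open>h\<close> this map is forced by \<open>\<Phi>\<close>, and
  second-order perturbation theory for the eigenvectors of \<open>L\<^sub>u = D - T\<^sub>u\<close> at \<open>u = 0\<close> gives
  \[ Q_n(h) = -\frac{1}{\sqrt n} \sum_{m \ge 1,\, m \ne n} \frac{h_m h_{n-m}}{m-n}. \]
  Let a low-frequency part of \<open>h\<close> interact with a block of high frequencies around \<open>n\<close>. The indices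
  \<open>m = n \<plusminus> l\<close> with small \<open>l\<close> contribute the high coefficient times \<open>h\<^sub>l / l\<close>, and for purely
  imaginary \<open>h\<^sub>l\<close> the two signs add up instead of cancelling. So \<open>Q\<close> multiplies the high block by
  \<open>\<Sum> \<bar>h\<^sub>l\<bar> / l\<close>, the Wiener norm of the primitive of the low part. That norm is not controlled by
  \<open>\<Sum> \<bar>h\<^sub>l\<bar>\<^sup>2 ln (l + 1) / l\<close>: the logarithm is just too weak, since for \<open>\<bar>h\<^sub>l\<bar> = 1 / ln (l + 1)\<close> both
  sums equal \<open>\<Sum> 1 / (l ln (l + 1))\<close>, which diverges like \<open>ln ln\<close>; the operator norm therefore grows
  like the square root of this sum. This is lemma \<open>quadratic_term_unbounded\<close>.

  The larger part of the work is to identify \<open>Q\<close>, because \<open>\<Phi>\<close> is built from the whole spectrum and a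
  complete eigenbasis. For a trigonometric polynomial \<open>u\<close> with \<open>\<Sum> \<bar>u\<^sub>k\<bar> 2\<^sup>\<bar>\<^sup>k\<^sup>\<bar> \<le> \<epsilon>\<close> small, a contraction
  argument yields eigenvectors \<open>F\<^sub>n = e\<^sub>n + G\<^sub>n\<close> with \<open>\<bar>G\<^sub>n(k)\<bar> \<le> 2 \<epsilon> 2\<^sup>-\<^sup>\<bar>\<^sup>k\<^sup>-\<^sup>n\<^sup>\<bar>\<close>. This Toeplitz-type
  bound makes \<open>e\<^sub>n \<mapsto> F\<^sub>n\<close> a perturbation of the identity of norm less than \<open>1\<close> (Schur's test), which
  forces completeness (\<open>expansion_complete\<close>); hence the spectrum is exactly the sequence of the
  eigenvalues found (\<open>Lax_spectrum_eq\<close>) and the normalized basis is determined (\<open>Lax_basis_eq\<close>).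
  The commutator of \<open>L\<^sub>u\<close> with the shift has rank one, so the gaps \<open>\<gamma>\<^sub>p\<close> are of order \<open>\<epsilon>\<^sup>2 2\<^sup>-\<^sup>p\<close>
  (\<open>gap_bound\<close>). Consequently \<open>n \<kappa>\<^sub>n\<close>, the norm of \<open>F\<^sub>n\<close> and the normalizing phases all are
  \<open>1 + O(\<epsilon>\<^sup>2)\<close>. As \<open>F\<^sub>n(0) = O(\<epsilon>)\<close>, they do not affect \<open>\<Phi>\<^sub>n\<close> up to order \<open>\<epsilon>\<^sup>2\<close>, and the
  quadratic term can be read off from the eigenvector equation (\<open>Birkhoff_pos_expansion\<close>).
\<close>

section \<open>Square-summable sequences\<close>

definition l2 :: "(int \<Rightarrow> complex) \<Rightarrow> bool" where
  "l2 f \<longleftrightarrow> (\<lambda>k. (cmod (f k))\<^sup>2) summable_on UNIV"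

definition nsq :: "(int \<Rightarrow> complex) \<Rightarrow> real" where
  "nsq f = (\<Sum>\<^sub>\<infinity>k. (cmod (f k))\<^sup>2)"

lemma cmod_add_sq_le: "(cmod (a + b))\<^sup>2 \<le> 2 * (cmod a)\<^sup>2 + 2 * (cmod b)\<^sup>2"
proof -
  have "(cmod (a + b))\<^sup>2 \<le> (cmod a + cmod b)\<^sup>2"
    by (intro power_mono norm_triangle_ineq) auto
  also have "\<dots> \<le> 2 * (cmod a)\<^sup>2 + 2 * (cmod b)\<^sup>2"
    using sum_squares_bound[of "cmod a" "cmod b"] by (simp add: power2_sum)
  finally show ?thesis .
qed

lemma l2_bound:
  assumes "l2 g" "\<And>k. cmod (f k) \<le> C * cmod (g k)"
  shows "l2 f"
  unfolding l2_def
proof (rule summable_on_comparison_test)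
  show "(\<lambda>k. C\<^sup>2 * (cmod (g k))\<^sup>2) summable_on UNIV"
    using assms(1) unfolding l2_def by (rule summable_on_cmult_right)
  show "(cmod (f k))\<^sup>2 \<le> C\<^sup>2 * (cmod (g k))\<^sup>2" for k
    using power_mono[OF assms(2)[of k], of 2] by (simp add: power_mult_distrib)
qed auto

lemma l2_add:
  assumes "l2 f" "l2 g"
  shows "l2 (\<lambda>k. f k + g k)"
  unfolding l2_def
proof (rule summable_on_comparison_test)
  show "(\<lambda>k. 2 * (cmod (f k))\<^sup>2 + 2 * (cmod (g k))\<^sup>2) summable_on UNIV"
    using assms unfolding l2_def by (intro summable_on_add summable_on_cmult_right)
qed (rule cmod_add_sq_le, simp)

lemma l2_cmult: "l2 f \<Longrightarrow> l2 (\<lambda>k. c * f k)"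
  by (rule l2_bound[of f _ "cmod c"]) (auto simp: norm_mult)

lemma l2_diff: "l2 f \<Longrightarrow> l2 g \<Longrightarrow> l2 (\<lambda>k. f k - g k)"
  using l2_add[of f "\<lambda>k. (-1) * g k"] l2_cmult[of g "-1"] by simp

lemma l2_zero: "l2 (\<lambda>k. 0)"
  by (simp add: l2_def)

lemma l2_sum:
  assumes "\<And>i. i \<in> I \<Longrightarrow> l2 (f i)"
  shows "l2 (\<lambda>k. \<Sum>i\<in>I. f i k)"
  using assms by (induction I rule: infinite_finite_induct) (auto intro: l2_add l2_zero)

lemma l2_shift:
  assumes "l2 f"
  shows "l2 (\<lambda>k. f (k - j))"
proof -
  have "bij_betw (\<lambda>k. k - j) UNIV UNIV"
    by (rule bij_betwI[of _ _ _ "\<lambda>k. k + j"]) auto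
  from summable_on_reindex_bij_betw[OF this, of "\<lambda>k. (cmod (f k))\<^sup>2"] assms
  show ?thesis by (simp add: l2_def)
qed

lemma infsum_shift:
  fixes f :: "int \<Rightarrow> 'a::{topological_comm_monoid_add,t2_space}"
  shows "(\<Sum>\<^sub>\<infinity>k. f (k - j)) = (\<Sum>\<^sub>\<infinity>k. f k)"
proof -
  have "bij_betw (\<lambda>k. k - j) UNIV UNIV"
    by (rule bij_betwI[of _ _ _ "\<lambda>k. k + j"]) auto
  from infsum_reindex_bij_betw[OF this, of f] show ?thesis by simp
qed

lemma ip_summable:
  assumes "l2 f" "l2 g"
  shows "(\<lambda>k. f k * cnj (g k)) summable_on UNIV"
proof (rule abs_summable_summable, rule summable_on_comparison_test)
  show "(\<lambda>k. (cmod (f k))\<^sup>2 + (cmod (g k))\<^sup>2) summable_on UNIV"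
    using assms unfolding l2_def by (intro summable_on_add)
  show "cmod (f k * cnj (g k)) \<le> (cmod (f k))\<^sup>2 + (cmod (g k))\<^sup>2" for k
  proof -
    have "0 \<le> cmod (f k) * cmod (g k)" by simp
    then show ?thesis
      using sum_squares_bound[of "cmod (f k)" "cmod (g k)"] unfolding norm_mult complex_mod_cnj by linarith
  qed
qed auto

lemma ip_cnj: "ip g f = cnj (ip f g)"
  unfolding ip_def by (subst infsum_cnj[symmetric]) (simp add: mult.commute)

lemma ip_add_left:
  assumes "l2 f" "l2 g" "l2 h"
  shows "ip (\<lambda>k. f k + g k) h = ip f h + ip g h"
  using infsum_add[OF ip_summable[OF assms(1,3)] ip_summable[OF assms(2,3)]]
  by (simp add: ip_def algebra_simps)

lemma ip_cmult_left: "ip (\<lambda>k. c * f k) h = c * ip f h"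
  unfolding ip_def by (subst infsum_cmult_right'[symmetric]) (simp add: mult.assoc)

lemma ip_diff_left:
  assumes "l2 f" "l2 g" "l2 h"
  shows "ip (\<lambda>k. f k - g k) h = ip f h - ip g h"
  using ip_add_left[OF assms(1) l2_cmult[OF assms(2), of "-1"] assms(3)]
    ip_cmult_left[of "-1" g h] by simp

lemma ip_zero_left [simp]: "ip (\<lambda>k. 0) h = 0"
  by (simp add: ip_def)

lemma ip_sum_left:
  assumes "\<And>i. i \<in> I \<Longrightarrow> l2 (f i)" "l2 h"
  shows "ip (\<lambda>k. \<Sum>i\<in>I. f i k) h = (\<Sum>i\<in>I. ip (f i) h)"
  using assms
  by (induction I rule: infinite_finite_induct) (auto simp: ip_add_left l2_sum)

lemma ip_cmult_right: "ip f (\<lambda>k. c * h k) = cnj c * ip f h"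
  using ip_cnj[of f "\<lambda>k. c * h k"] ip_cnj[of f h] by (simp add: ip_cmult_left)

lemma ip_diff_right:
  assumes "l2 f" "l2 g" "l2 h"
  shows "ip h (\<lambda>k. f k - g k) = ip h f - ip h g"
  using ip_diff_left[OF assms] ip_cnj[of h f] ip_cnj[of h g] ip_cnj[of h "\<lambda>k. f k - g k"] by simp

lemma ip_sum_right:
  assumes "\<And>i. i \<in> I \<Longrightarrow> l2 (f i)" "l2 h"
  shows "ip h (\<lambda>k. \<Sum>i\<in>I. f i k) = (\<Sum>i\<in>I. ip h (f i))"
proof -
  have "ip h (\<lambda>k. \<Sum>i\<in>I. f i k) = cnj (\<Sum>i\<in>I. ip (f i) h)"
    using ip_sum_left[of I f h] assms ip_cnj[of h "\<lambda>k. \<Sum>i\<in>I. f i k"] by simp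
  also have "\<dots> = (\<Sum>i\<in>I. ip h (f i))"
    by (simp add: ip_cnj[symmetric])
  finally show ?thesis .
qed

lemma ip_self:
  assumes "l2 f"
  shows "ip f f = complex_of_real (nsq f)"
proof -
  have "((\<lambda>k. complex_of_real ((cmod (f k))\<^sup>2)) has_sum complex_of_real (nsq f)) UNIV"
    using assms unfolding l2_def nsq_def by (intro has_sum_of_real has_sum_infsum)
  then show ?thesis
    unfolding ip_def by (simp add: infsumI complex_norm_square[symmetric] del: of_real_power)
qed

lemma nsq_nonneg: "0 \<le> nsq f"
  unfolding nsq_def by (rule infsum_nonneg) auto

lemma nsq_cmult: "nsq (\<lambda>k. c * f k) = (cmod c)\<^sup>2 * nsq f"
  unfolding nsq_def by (subst infsum_cmult_right'[symmetric]) (simp add: norm_mult power_mult_distrib)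

lemma nsq_add_le:
  assumes "l2 f" "l2 g"
  shows "nsq (\<lambda>k. f k + g k) \<le> 2 * nsq f + 2 * nsq g"
proof -
  have "nsq (\<lambda>k. f k + g k) \<le> (\<Sum>\<^sub>\<infinity>k. 2 * (cmod (f k))\<^sup>2 + 2 * (cmod (g k))\<^sup>2)"
    unfolding nsq_def using l2_add[OF assms] assms unfolding l2_def
    by (intro infsum_mono summable_on_add summable_on_cmult_right cmod_add_sq_le) auto
  also have "\<dots> = 2 * nsq f + 2 * nsq g"
    using assms unfolding l2_def nsq_def
    by (subst infsum_add) (auto intro: summable_on_cmult_right simp: infsum_cmult_right')
  finally show ?thesis .
qed

lemma coord_le_nsq:
  assumes "l2 f"
  shows "(cmod (f k))\<^sup>2 \<le> nsq f"
proof -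
  have "infsum (\<lambda>k. (cmod (f k))\<^sup>2) {k} \<le> infsum (\<lambda>k. (cmod (f k))\<^sup>2) UNIV"
    using assms unfolding l2_def by (intro infsum_mono_neutral) auto
  then show ?thesis by (simp add: nsq_def)
qed

lemma nsq_diff_orthogonal:
  assumes "l2 r" "l2 w" "ip r w = 0"
  shows "nsq (\<lambda>k. r k - w k) = nsq r + nsq w"
proof -
  have "complex_of_real (nsq (\<lambda>k. r k - w k)) = ip r r - ip r w - (ip w r - ip w w)"
    unfolding ip_self[OF l2_diff[OF assms(1,2)], symmetric]
    by (simp add: ip_diff_left ip_diff_right l2_diff assms)
  also have "\<dots> = complex_of_real (nsq r + nsq w)"
    using assms ip_cnj[of w r] by (simp add: ip_self)
  finally show ?thesis using of_real_eq_iff by blast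
qed

lemma Hplus_0_iff: "f \<in> Hplus 0 \<longleftrightarrow> l2 f \<and> (\<forall>n<0. f n = 0)"
proof -
  have "jap n powr (2 * 0) = 1" for n by (simp add: jap_def)
  then show ?thesis by (simp add: Hplus_def Hc_def l2_def)
qed

section \<open>Sequences with exponential decay\<close>

text \<open>
  The eigenvectors constructed below decay like \<open>geo (k - n)\<close> away from their main mode. The
  elementary facts needed are that convolution with \<open>u\<close> preserves this decay when
  \<open>\<Sum> \<bar>u\<^sub>k\<bar> 2\<^sup>\<bar>\<^sup>k\<^sup>\<bar>\<close> is finite, which rests on \<open>geo_diff_le\<close>, and that all row and column sums
  of the matrix \<open>geo (k - n)\<close> are at most 3.
\<close>

definition geo :: "int \<Rightarrow> real" where
  "geo m = (1/2) ^ nat \<bar>m\<bar>"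

lemma geo_pos: "0 < geo m" and geo_le_1: "geo m \<le> 1" and geo_0 [simp]: "geo 0 = 1"
  by (auto simp: geo_def power_le_one)

lemma geo_minus [simp]: "geo (- m) = geo m"
  by (simp add: geo_def)

lemma geo_commute: "geo (a - b) = geo (b - a)"
  by (metis geo_minus minus_diff_eq)

lemma geo_diff_le: "geo (m - k) \<le> 2 ^ nat \<bar>k\<bar> * geo m"
proof -
  have "nat \<bar>m\<bar> \<le> nat \<bar>m - k\<bar> + nat \<bar>k\<bar>" by linarith
  then have "(1/2::real) ^ (nat \<bar>m - k\<bar> + nat \<bar>k\<bar>) \<le> (1/2) ^ nat \<bar>m\<bar>"
    by (rule power_decreasing) auto
  then show ?thesis by (simp add: geo_def power_add power_one_over field_simps)
qed

lemma has_sum_int_symmetric: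
  fixes f :: "int \<Rightarrow> real"
  assumes "\<And>n. f n \<ge> 0" "(\<lambda>n::nat. f (int n)) sums a" "(\<lambda>n::nat. f (- 1 - int n)) sums b"
  shows "(f has_sum (a + b)) UNIV"
proof -
  have 1: "bij_betw int UNIV {0..}"
    by (rule bij_betwI[of _ _ _ nat]) auto
  have 2: "bij_betw (\<lambda>n. - 1 - int n) UNIV {..<0}"
    by (rule bij_betwI[of _ _ _ "\<lambda>k. nat (- 1 - k)"]) auto
  have "((\<lambda>n::nat. f (int n)) has_sum a) UNIV"
    using assms by (intro sums_nonneg_imp_has_sum) auto
  then have A: "(f has_sum a) {0..}"
    using has_sum_reindex_bij_betw[OF 1, of f a] by simp
  have "((\<lambda>n::nat. f (- 1 - int n)) has_sum b) UNIV"
    using assms by (intro sums_nonneg_imp_has_sum) auto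
  then have B: "(f has_sum b) {..<0}"
    using has_sum_reindex_bij_betw[OF 2, of f b] by simp
  have "(f has_sum (a + b)) ({0..} \<union> {..<0})"
    by (rule has_sum_Un_disjoint[OF A B]) auto
  moreover have "{0..} \<union> {..<0} = (UNIV :: int set)" by auto
  ultimately show ?thesis by simp
qed

lemma has_sum_geo: "(geo has_sum 3) UNIV"
proof -
  have "(\<lambda>n. (1/2::real) ^ n) sums 2" using geometric_sums[of "1/2::real"] by simp
  moreover have "(\<lambda>n. (1/2::real) * (1/2) ^ n) sums (1/2 * 2)"
    by (rule sums_mult) fact
  moreover have g: "geo (- 1 - int n) = (1/2) * (1/2) ^ n" for n
  proof -
    have "nat \<bar>- 1 - int n\<bar> = Suc n" by linarith
    then show ?thesis by (simp add: geo_def)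
  qed
  ultimately have "(\<lambda>n. geo (- 1 - int n)) sums 1"
    unfolding g by simp
  with \<open>(\<lambda>n. (1/2::real) ^ n) sums 2\<close> have "(geo has_sum (2 + 1)) UNIV"
    by (intro has_sum_int_symmetric) (use geo_pos in \<open>auto simp: geo_def less_imp_le\<close>)
  then show ?thesis by simp
qed

lemma has_sum_geo_shift: "((\<lambda>k. geo (k - n)) has_sum 3) UNIV"
proof -
  have "bij_betw (\<lambda>k. k - n) UNIV UNIV"
    by (rule bij_betwI[of _ _ _ "\<lambda>k. k + n"]) auto
  from has_sum_reindex_bij_betw[OF this, of geo 3] has_sum_geo show ?thesis by simp
qed

lemma sum_geo_le:
  assumes "finite A"
  shows "(\<Sum>k\<in>A. geo (k - n)) \<le> 3"
  using has_sum_geo_shift[of n] assms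
  by (metis finite_sum_le_has_sum geo_pos less_imp_le top_greatest)

lemma sum_geo_nat_le: "(\<Sum>n<N. geo (k - int n)) \<le> 3"
proof -
  have "(\<Sum>n<N. geo (k - int n)) = (\<Sum>j\<in>int ` {..<N}. geo (j - k))"
    by (subst sum.reindex) (auto simp: inj_on_def geo_commute)
  then show ?thesis using sum_geo_le[of "int ` {..<N}" k] by simp
qed

lemma summable_weighted_geo: "(\<lambda>k. (1 + real_of_int \<bar>k\<bar>)\<^sup>2 * (geo k)\<^sup>2) summable_on UNIV"
proof (rule summable_on_comparison_test)
  show "(\<lambda>k. 16 * geo k) summable_on UNIV"
    using has_sum_geo by (intro summable_on_cmult_right) (auto simp: summable_on_def)
  fix k :: int
  have "(1 + real j)\<^sup>2 \<le> 16 * 2 ^ j" for j :: nat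
  proof (induction j)
    case (Suc j)
    consider "j = 0" | "j = 1" | "j \<ge> 2" by linarith
    then show ?case
    proof cases
      case 3
      then have "2 * real j \<le> real j * real j" by (intro mult_right_mono) auto
      then have "(1 + real (Suc j))\<^sup>2 \<le> 2 * (1 + real j)\<^sup>2"
        using \<open>j \<ge> 2\<close> mult_mono[of 2 "real j" 2 "real j"] by (simp add: power2_eq_square algebra_simps)
      then show ?thesis using Suc by simp
    qed (auto simp: power2_eq_square)
  qed auto
  from this[of "nat \<bar>k\<bar>"] have "(1 + real (nat \<bar>k\<bar>))\<^sup>2 * (1/2) ^ nat \<bar>k\<bar> \<le> 16"
    by (simp add: power_one_over field_simps)
  then have "((1 + real (nat \<bar>k\<bar>))\<^sup>2 * (1/2) ^ nat \<bar>k\<bar>) * geo k \<le> 16 * geo k"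
    using geo_pos[of k] by (intro mult_right_mono) auto
  moreover have "real (nat \<bar>k\<bar>) = \<bar>real_of_int k\<bar>" by simp
  ultimately show "(1 + real_of_int \<bar>k\<bar>)\<^sup>2 * (geo k)\<^sup>2 \<le> 16 * geo k"
    by (simp add: geo_def power2_eq_square mult_ac)
qed auto

text \<open>
  Decaying sequences lie in the domain of \<open>D\<close>, so \<open>L\<^sub>u\<close> is symmetric when one argument decays.
\<close>

lemma l2_weighted_geo:
  assumes "\<And>k. cmod (f k) \<le> C * geo (k - n)"
  shows "l2 (\<lambda>k. of_int k * f k)"
proof -
  have "l2 (\<lambda>k. complex_of_real ((1 + real_of_int \<bar>k\<bar>) * geo k))"
    using summable_weighted_geo by (simp add: l2_def power_mult_distrib norm_mult abs_mult del: of_real_mult of_real_add)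
  from l2_shift[OF this, of n]
  have "l2 (\<lambda>k. complex_of_real ((1 + real_of_int \<bar>k - n\<bar>) * geo (k - n)))" .
  then show ?thesis
  proof (rule l2_bound[where C = "C * (1 + \<bar>n\<bar>)"])
    fix k
    have C: "0 \<le> C" 
      using order_trans[OF norm_ge_zero assms[of n]] by simp
    have "real_of_int \<bar>k\<bar> \<le> (1 + real_of_int \<bar>n\<bar>) * (1 + real_of_int \<bar>k - n\<bar>)"
    proof -
      have "real_of_int \<bar>k\<bar> \<le> real_of_int \<bar>n\<bar> + real_of_int \<bar>k - n\<bar>" by linarith
      moreover have "0 \<le> real_of_int \<bar>n\<bar> * real_of_int \<bar>k - n\<bar>" by simp
      ultimately show ?thesis by (simp only: algebra_simps)
    qed
    then have "real_of_int \<bar>k\<bar> * cmod (f k) \<le> ((1 + real_of_int \<bar>n\<bar>) * (1 + real_of_int \<bar>k - n\<bar>)) * (C * geo (k - n))"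
      using C geo_pos[of "k - n"] by (intro mult_mono assms) auto
    moreover have "cmod (complex_of_real ((1 + real_of_int \<bar>k - n\<bar>) * geo (k - n))) = (1 + real_of_int \<bar>k - n\<bar>) * geo (k - n)"
      using geo_pos[of "k - n"] by (simp add: norm_mult del: of_real_mult)
    ultimately show "cmod (of_int k * f k) \<le> C * (1 + \<bar>n\<bar>) * cmod (complex_of_real ((1 + real_of_int \<bar>k - n\<bar>) * geo (k - n)))"
      by (simp add: norm_mult mult_ac)
  qed
qed

lemma l2_geo:
  assumes "\<And>k. cmod (f k) \<le> C * geo (k - n)"
  shows "l2 f"
proof -
  have "l2 (\<lambda>k. complex_of_real (geo k))"
    unfolding l2_def
  proof (rule summable_on_comparison_test)
    show "geo summable_on UNIV" using has_sum_geo by (auto simp: summable_on_def)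
    show "(cmod (complex_of_real (geo k)))\<^sup>2 \<le> geo k" for k
      using geo_pos[of k] geo_le_1[of k] by (simp add: power2_eq_square mult_left_le)
  qed auto
  from l2_shift[OF this, of n] show ?thesis
    by (rule l2_bound[where C = C]) (use assms geo_pos in \<open>auto simp: less_imp_le\<close>)
qed

section \<open>Orthonormal systems close to the Fourier modes\<close>

locale orthonormal_sequence =
  fixes f :: "nat \<Rightarrow> int \<Rightarrow> complex"
  assumes l2_f: "l2 (f n)"
    and ip_f: "ip (f m) (f n) = (if m = n then 1 else 0)"
begin

definition partial_expansion :: "(int \<Rightarrow> complex) \<Rightarrow> nat \<Rightarrow> int \<Rightarrow> complex" where
  "partial_expansion g N k = (\<Sum>n<N. ip g (f n) * f n k)"

abbreviation residual :: "(int \<Rightarrow> complex) \<Rightarrow> nat \<Rightarrow> int \<Rightarrow> complex" where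
  "residual g N \<equiv> \<lambda>k. g k - partial_expansion g N k"

lemma l2_combination: "l2 (\<lambda>k. \<Sum>n<N. c n * f n k)"
  by (intro l2_sum l2_cmult l2_f)

lemma ip_combination:
  "ip (\<lambda>k. \<Sum>n<N. c n * f n k) (f m) = (if m < N then c m else 0)"
proof -
  have "ip (\<lambda>k. \<Sum>n<N. c n * f n k) (f m) = (\<Sum>n<N. c n * (if n = m then 1 else 0))"
    by (simp add: ip_sum_left l2_cmult l2_f ip_cmult_left ip_f)
  also have "\<dots> = (if m < N then c m else 0)"
    by (simp add: sum.delta' if_distrib cong: if_cong)
  finally show ?thesis .
qed

lemma nsq_combination: "nsq (\<lambda>k. \<Sum>n<N. c n * f n k) = (\<Sum>n<N. (cmod (c n))\<^sup>2)"
proof -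
  define w where "w = (\<lambda>k. \<Sum>n<N. c n * f n k)"
  have w: "l2 w" unfolding w_def by (rule l2_combination)
  have "complex_of_real (nsq w) = ip w (\<lambda>k. \<Sum>m<N. c m * f m k)"
    using ip_self[OF w] by (simp add: w_def)
  also have "\<dots> = (\<Sum>m<N. cnj (c m) * ip w (f m))"
    using w by (subst ip_sum_right) (auto intro: l2_cmult l2_f simp: ip_cmult_right)
  also have "\<dots> = (\<Sum>m<N. complex_of_real ((cmod (c m))\<^sup>2))"
    unfolding w_def
    by (intro sum.cong refl) (simp add: ip_combination complex_norm_square mult.commute del: of_real_power)
  finally have "complex_of_real (nsq w) = complex_of_real (\<Sum>m<N. (cmod (c m))\<^sup>2)"
    by (simp only: of_real_sum)
  then show ?thesis
    by (simp only: of_real_eq_iff w_def)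
qed

lemma l2_partial_expansion: "l2 (partial_expansion g N)"
  unfolding partial_expansion_def by (rule l2_combination)

lemma l2_residual: "l2 g \<Longrightarrow> l2 (residual g N)"
  by (intro l2_diff l2_partial_expansion)

lemma ip_residual:
  assumes "l2 g" "n < N"
  shows "ip (residual g N) (f n) = 0"
proof -
  have "ip (partial_expansion g N) (f n) = ip g (f n)"
    unfolding partial_expansion_def[abs_def] ip_combination using assms(2) by simp
  then show ?thesis
    using assms(1) by (simp add: ip_diff_left l2_partial_expansion l2_f)
qed

text \<open>
  Subtracting the projection leaves a vector orthogonal to the span, so any other combination adds
  its squared distance to the projection. This is how an explicit approximation, whose
  coefficients are not the Fourier coefficients, bounds the residual.
\<close>

lemma residual_best_approximation:
  assumes "l2 g"
  shows "nsq (residual g N) \<le> nsq (\<lambda>k. g k - (\<Sum>n<N. c n * f n k))"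
proof -
  define w where "w = (\<lambda>k. \<Sum>n<N. (c n - ip g (f n)) * f n k)"
  have w: "l2 w" unfolding w_def by (rule l2_combination)
  have "ip (residual g N) w = (\<Sum>n<N. cnj (c n - ip g (f n)) * ip (residual g N) (f n))"
    unfolding w_def using l2_residual[OF assms]
    by (subst ip_sum_right) (auto intro: l2_cmult l2_f simp: ip_cmult_right)
  also have "\<dots> = 0"
    by (intro sum.neutral ballI) (simp add: ip_residual assms)
  finally have "nsq (\<lambda>k. residual g N k - w k) = nsq (residual g N) + nsq w"
    by (intro nsq_diff_orthogonal l2_residual assms w)
  moreover have "(\<lambda>k. residual g N k - w k) = (\<lambda>k. g k - (\<Sum>n<N. c n * f n k))"
    by (auto simp: w_def partial_expansion_def sum_subtractf algebra_simps)
  ultimately show ?thesis using nsq_nonneg[of w] by simp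
qed

lemma residual_antimono:
  assumes "l2 g" "N \<le> M"
  shows "nsq (residual g M) \<le> nsq (residual g N)"
proof -
  have "(\<Sum>n<M. (if n < N then ip g (f n) else 0) * f n k) = partial_expansion g N k" for k
    unfolding partial_expansion_def using assms(2)
    by (intro sum.mono_neutral_cong_right) auto
  then show ?thesis
    using residual_best_approximation[OF assms(1), of M "\<lambda>n. if n < N then ip g (f n) else 0"] by simp
qed

lemma bessel:
  assumes "l2 g"
  shows "(\<Sum>n<N. (cmod (ip g (f n)))\<^sup>2) \<le> nsq g"
proof -
  define w where "w = (\<lambda>k. - 1 * partial_expansion g N k)"
  have w: "l2 w" unfolding w_def by (intro l2_cmult l2_partial_expansion)
  define r where "r = residual g N"
  have r: "l2 r" unfolding r_def by (rule l2_residual[OF assms])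
  have "ip r (partial_expansion g N) = (\<Sum>n<N. cnj (ip g (f n)) * ip r (f n))"
    unfolding partial_expansion_def[abs_def] using r
    by (subst ip_sum_right) (auto intro: l2_cmult l2_f simp: ip_cmult_right)
  also have "\<dots> = 0"
    by (intro sum.neutral ballI) (simp add: ip_residual assms r_def)
  finally have "ip r w = 0"
    unfolding w_def ip_cmult_right by simp
  then have "nsq (\<lambda>k. r k - w k) = nsq r + nsq w"
    by (rule nsq_diff_orthogonal[OF r w])
  moreover have "nsq w = nsq (partial_expansion g N)"
    unfolding w_def nsq_cmult by simp
  moreover have "(\<lambda>k. r k - w k) = g"
    by (simp add: r_def w_def)
  ultimately have "nsq g = nsq (residual g N) + nsq (partial_expansion g N)"
    by (simp add: r_def)
  then show ?thesis
    using nsq_nonneg[of "residual g N"] nsq_combination[where c = "\<lambda>n. ip g (f n)" and N = N]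
    by (simp add: partial_expansion_def[abs_def])
qed

text \<open>
  A coordinatewise limit of orthogonal partial sums with bounded norms has finite norm, since
  each finite piece of it does; this replaces completeness of the sequence space.
\<close>

lemma l2_expansion:
  assumes "\<And>N. (\<Sum>n<N. (cmod (c n))\<^sup>2) \<le> B" "\<And>k. (\<lambda>n. c n * f n k) sums h k"
  shows "l2 h"
  unfolding l2_def
proof (rule nonneg_bounded_partial_sums_imp_summable_on)
  show "\<forall>\<^sub>F A in finite_subsets_at_top UNIV. (\<Sum>k\<in>A. (cmod (h k))\<^sup>2) \<le> B"
  proof (intro eventually_finite_subsets_at_top_weakI)
    fix A :: "int set" assume "finite A"
    have "(\<lambda>N. \<Sum>k\<in>A. (cmod (\<Sum>n<N. c n * f n k))\<^sup>2) \<longlonglongrightarrow> (\<Sum>k\<in>A. (cmod (h k))\<^sup>2)"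
      using assms(2) unfolding sums_def by (intro tendsto_intros)
    moreover have "(\<Sum>k\<in>A. (cmod (\<Sum>n<N. c n * f n k))\<^sup>2) \<le> B" for N
    proof -
      have "(\<Sum>k\<in>A. (cmod (\<Sum>n<N. c n * f n k))\<^sup>2) \<le> nsq (\<lambda>k. \<Sum>n<N. c n * f n k)"
        unfolding nsq_def using l2_combination[where N = N and c = c] \<open>finite A\<close> unfolding l2_def
        by (intro finite_sum_le_infsum) auto
      then show ?thesis using assms(1)[of N] by (simp add: nsq_combination)
    qed
    ultimately show "(\<Sum>k\<in>A. (cmod (h k))\<^sup>2) \<le> B"
      by (intro LIMSEQ_le_const2) auto
  qed
qed auto

end

lemma has_sum_sum_finite:
  fixes f :: "'i \<Rightarrow> 'k \<Rightarrow> real"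
  assumes "\<And>i. (f i has_sum s i) A"
  shows "((\<lambda>k. \<Sum>i\<in>I. f i k) has_sum (\<Sum>i\<in>I. s i)) A"
  by (induction I rule: infinite_finite_induct) (auto intro: has_sum_add assms)

text \<open>
  Schur's test: a matrix dominated by \<open>q geo (k - n)\<close> has row and column sums at most \<open>3 q\<close>,
  hence operator norm at most \<open>3 q\<close>. The estimate is by Cauchy-Schwarz with weight \<open>geo\<close>.
\<close>

lemma schur_geo:
  assumes "l2 x" "\<And>n k. cmod (G n k) \<le> q * geo (k - int n)" "0 \<le> q"
  shows "nsq (\<lambda>k. \<Sum>n<M. x (int n) * G n k) \<le> 9 * q\<^sup>2 * nsq x"
proof -
  define y where "y = (\<lambda>k. \<Sum>n<M. x (int n) * G n k)"
  define B where "B = (\<lambda>k. \<Sum>n<M. (cmod (x (int n)))\<^sup>2 * geo (k - int n))"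
  have pt: "(cmod (y k))\<^sup>2 \<le> 3 * q\<^sup>2 * B k" for k
  proof -
    have "cmod (y k) \<le> (\<Sum>n<M. cmod (x (int n)) * (q * geo (k - int n)))"
      unfolding y_def
      by (rule order_trans[OF norm_sum]) (auto intro!: sum_mono mult_left_mono assms(2) simp: norm_mult)
    also have "\<dots> = q * (\<Sum>n<M. sqrt (geo (k - int n)) * (sqrt (geo (k - int n)) * cmod (x (int n))))"
      unfolding sum_distrib_left
    proof (intro sum.cong refl)
      fix n
      have "geo (k - int n) = sqrt (geo (k - int n)) * sqrt (geo (k - int n))"
        using geo_pos[of "k - int n"] by simp
      then show "cmod (x (int n)) * (q * geo (k - int n))
          = q * (sqrt (geo (k - int n)) * (sqrt (geo (k - int n)) * cmod (x (int n))))"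
        by (metis mult.assoc mult.commute)
    qed
    finally have "(cmod (y k))\<^sup>2 \<le> q\<^sup>2 * (\<Sum>n<M. sqrt (geo (k - int n)) * (sqrt (geo (k - int n)) * cmod (x (int n))))\<^sup>2"
      unfolding power_mult_distrib[symmetric] by (intro power_mono) auto
    also have "\<dots> \<le> q\<^sup>2 * ((\<Sum>n<M. (sqrt (geo (k - int n)))\<^sup>2) * (\<Sum>n<M. (sqrt (geo (k - int n)) * cmod (x (int n)))\<^sup>2))"
      by (intro mult_left_mono Cauchy_Schwarz_ineq_sum) auto
    also have "\<dots> = q\<^sup>2 * ((\<Sum>n<M. geo (k - int n)) * B k)"
      using geo_pos by (simp add: B_def power_mult_distrib less_imp_le mult.commute)
    also have "\<dots> \<le> q\<^sup>2 * (3 * B k)"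
      using sum_geo_nat_le geo_pos unfolding B_def
      by (intro mult_left_mono mult_right_mono sum_nonneg mult_nonneg_nonneg) (auto simp: less_imp_le)
    finally show ?thesis by (simp add: mult_ac)
  qed
  have hs: "((\<lambda>k. 3 * q\<^sup>2 * B k) has_sum (3 * q\<^sup>2 * (\<Sum>n<M. (cmod (x (int n)))\<^sup>2 * 3))) UNIV"
    unfolding B_def by (intro has_sum_cmult_right has_sum_sum_finite has_sum_geo_shift)
  have "nsq y \<le> 3 * q\<^sup>2 * (\<Sum>n<M. (cmod (x (int n)))\<^sup>2 * 3)"
    unfolding nsq_def
  proof (rule has_sum_mono[OF has_sum_infsum hs])
    show "(\<lambda>k. (cmod (y k))\<^sup>2) summable_on UNIV"
      by (rule summable_on_comparison_test[OF has_sum_imp_summable[OF hs]]) (simp_all add: pt)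
  qed (rule pt)
  also have "\<dots> = 9 * q\<^sup>2 * (\<Sum>k\<in>int ` {..<M}. (cmod (x k))\<^sup>2)"
    by (simp add: sum.reindex sum_distrib_right[symmetric])
  also have "\<dots> \<le> 9 * q\<^sup>2 * nsq x"
    unfolding nsq_def using assms(1) unfolding l2_def
    by (intro mult_left_mono finite_sum_le_infsum) auto
  finally show ?thesis by (simp add: y_def)
qed

lemma nsq_tail_tendsto_0:
  assumes "l2 x" "\<forall>k<0. x k = 0"
  shows "(\<lambda>M. nsq (\<lambda>k. if k < int M then 0 else x k)) \<longlonglongrightarrow> 0"
proof -
  have bij: "bij_betw int UNIV {0..}"
    by (rule bij_betwI[of _ _ _ nat]) auto
  have "((\<lambda>k. (cmod (x k))\<^sup>2) has_sum nsq x) UNIV"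
    using assms(1) unfolding l2_def nsq_def by (rule has_sum_infsum)
  then have "((\<lambda>k. (cmod (x k))\<^sup>2) has_sum nsq x) {0..}"
    by (subst has_sum_cong_neutral[where T = UNIV]) (use assms(2) in auto)
  then have "((\<lambda>n. (cmod (x (int n)))\<^sup>2) has_sum nsq x) UNIV"
    using has_sum_reindex_bij_betw[OF bij, of "\<lambda>k. (cmod (x k))\<^sup>2"] by simp
  then have lim: "(\<lambda>M. \<Sum>n<M. (cmod (x (int n)))\<^sup>2) \<longlonglongrightarrow> nsq x"
    by (auto dest: has_sum_imp_sums simp: sums_def)
  have "nsq (\<lambda>k. if k < int M then 0 else x k) = nsq x - (\<Sum>n<M. (cmod (x (int n)))\<^sup>2)" for M
  proof -
    define S where "S = int ` {..<M}"
    have "nsq x = (\<Sum>\<^sub>\<infinity>k. (if k \<in> S then (cmod (x k))\<^sup>2 else 0) + (cmod (if k < int M then 0 else x k))\<^sup>2)"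
      unfolding nsq_def
    proof (rule infsum_cong)
      fix k :: int
      have "k \<in> S \<longleftrightarrow> 0 \<le> k \<and> k < int M" unfolding S_def by (auto simp: image_iff intro: bexI[of _ "nat k"])
      then show "(cmod (x k))\<^sup>2 = (if k \<in> S then (cmod (x k))\<^sup>2 else 0) + (cmod (if k < int M then 0 else x k))\<^sup>2"
        using assms(2) by auto
    qed
    also have "\<dots> = (\<Sum>\<^sub>\<infinity>k. if k \<in> S then (cmod (x k))\<^sup>2 else 0) + nsq (\<lambda>k. if k < int M then 0 else x k)"
      unfolding nsq_def
    proof (rule infsum_add)
      show "(\<lambda>k. (cmod (if k < int M then 0 else x k))\<^sup>2) summable_on UNIV"
        using l2_bound[OF assms(1), of "\<lambda>k. if k < int M then 0 else x k" 1] by (auto simp: l2_def)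
      show "(\<lambda>k. if k \<in> S then (cmod (x k))\<^sup>2 else 0) summable_on UNIV"
        by (rule summable_on_comparison_test[OF assms(1)[unfolded l2_def]]) auto
    qed
    also have "(\<Sum>\<^sub>\<infinity>k. if k \<in> S then (cmod (x k))\<^sup>2 else 0) = (\<Sum>\<^sub>\<infinity>k\<in>S. (cmod (x k))\<^sup>2)"
      by (rule infsum_cong_neutral) auto
    also have "\<dots> = (\<Sum>n<M. (cmod (x (int n)))\<^sup>2)"
      unfolding S_def by (simp add: sum.reindex)
    finally show ?thesis by simp
  qed
  then show ?thesis using tendsto_diff[OF tendsto_const[of "nsq x"] lim] by simp
qed

text \<open>
  An orthonormal system obtained by rescaling vectors \<open>F\<^sub>n\<close> that differ from the Fourier modes
  by a matrix small in the sense of Schur's test. Such a system is complete.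
\<close>

locale near_mode_system = orthonormal_sequence +
  fixes F :: "nat \<Rightarrow> int \<Rightarrow> complex" and z :: "nat \<Rightarrow> complex" and q :: real
  assumes f_eq: "f n k = z n * F n k"
    and z_nz: "z n \<noteq> 0"
    and near: "cmod (F n k - mode (int n) k) \<le> q * geo (k - int n)"
    and q: "0 \<le> q" "q \<le> 1/10"
    and f_neg: "k < 0 \<Longrightarrow> f n k = 0"
begin

text \<open>
  Let \<open>x\<close> be the residual after \<open>N\<close> terms. Replacing in \<open>x = \<Sum> x\<^sub>n e\<^sub>n\<close> each mode \<open>e\<^sub>n\<close> with
  \<open>n < M\<close> by \<open>F\<^sub>n\<close> gives an element of the span whose distance to \<open>x\<close> consists of a tail of \<open>x\<close> and
  of an error of norm at most \<open>3 q \<parallel>x\<parallel>\<close>. So adding enough terms at least halves the squared residual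
  up to a tail; this is the Neumann series argument for surjectivity of \<open>e\<^sub>n \<mapsto> F\<^sub>n\<close>.
\<close>

lemma residual_step:
  assumes "l2 g" "\<forall>k<0. g k = 0" "N \<le> M"
  shows "nsq (residual g M)
    \<le> 2 * nsq (\<lambda>k. if k < int M then 0 else residual g N k) + 1/2 * nsq (residual g N)"
proof -
  define x where "x = residual g N"
  define G where "G = (\<lambda>n k. mode (int n) k - F n k)"
  have x: "l2 x" "x k = 0" if "k < 0" for k
    unfolding x_def using l2_residual[OF assms(1)] that assms(2)
    by (auto simp: partial_expansion_def f_neg)
  have x2: "l2 x" using l2_residual[OF assms(1)] by (simp add: x_def)
  \<comment> \<open>Coefficients of \<open>f\<^sub>n\<close> in the partial expansion plus \<open>\<Sum>n<M. x\<^sub>n F\<^sub>n\<close>, as \<open>F\<^sub>n = f\<^sub>n / z\<^sub>n\<close>.\<close>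
  define c where "c = (\<lambda>n. (if n < N then ip g (f n) else 0) + x (int n) / z n)"
  have F: "l2 (F n)" for n
    using l2_cmult[OF l2_f[of n], of "1 / z n"] z_nz[of n] by (simp add: f_eq)
  have "g k - (\<Sum>n<M. c n * f n k) = (if k < int M then 0 else x k) + (\<Sum>n<M. x (int n) * G n k)" for k
  proof -
    have "(\<Sum>n<M. c n * f n k) = partial_expansion g N k + (\<Sum>n<M. x (int n) * F n k)"
    proof -
      have "(\<Sum>n<M. (if n < N then ip g (f n) else 0) * f n k) = partial_expansion g N k"
        unfolding partial_expansion_def using assms(3)
        by (intro sum.mono_neutral_cong_right) auto
      moreover have "x (int n) / z n * f n k = x (int n) * F n k" for n
        using z_nz[of n] by (simp add: f_eq)
      ultimately show ?thesis by (simp add: c_def distrib_right sum.distrib)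
    qed
    moreover have "(\<Sum>n<M. x (int n) * mode (int n) k) = (if k < int M then x k else 0)"
    proof (cases "0 \<le> k")
      case True
      then have "(\<Sum>n<M. x (int n) * mode (int n) k) = (\<Sum>n<M. if n = nat k then x k else 0)"
        by (intro sum.cong) (auto simp: mode_def)
      then show ?thesis using True by (auto simp: zless_nat_conj nat_less_iff)
    next
      case False
      then have "(\<Sum>n<M. x (int n) * mode (int n) k) = 0"
        by (intro sum.neutral) (auto simp: mode_def)
      then show ?thesis using False x(2) by auto
    qed
    moreover have "g k = x k + partial_expansion g N k" by (simp add: x_def)
    ultimately show ?thesis by (simp add: G_def right_diff_distrib sum_subtractf)
  qed
  then have "nsq (residual g M) \<le> nsq (\<lambda>k. (if k < int M then 0 else x k) + (\<Sum>n<M. x (int n) * G n k))"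
    using residual_best_approximation[OF assms(1), of M c] by simp
  also have "\<dots> \<le> 2 * nsq (\<lambda>k. if k < int M then 0 else x k) + 2 * nsq (\<lambda>k. \<Sum>n<M. x (int n) * G n k)"
  proof (rule nsq_add_le)
    show "l2 (\<lambda>k. if k < int M then 0 else x k)"
      by (rule l2_bound[OF x2, of _ 1]) auto
    have "l2 (G n)" for n
      by (rule l2_geo[of _ q "int n"]) (use near in \<open>simp add: G_def norm_minus_commute\<close>)
    then show "l2 (\<lambda>k. \<Sum>n<M. x (int n) * G n k)"
      by (intro l2_sum l2_cmult)
  qed
  also have "nsq (\<lambda>k. \<Sum>n<M. x (int n) * G n k) \<le> 9 * q\<^sup>2 * nsq x"
    by (rule schur_geo[OF x2]) (use near q in \<open>auto simp: G_def norm_minus_commute\<close>)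
  also have "9 * q\<^sup>2 * nsq x \<le> 1/4 * nsq x"
  proof (rule mult_right_mono)
    have "q\<^sup>2 \<le> (1/10)\<^sup>2" using q by (intro power_mono) auto
    then show "9 * q\<^sup>2 \<le> 1/4" by (simp add: power2_eq_square)
  qed (rule nsq_nonneg)
  finally show ?thesis unfolding x_def by simp
qed

text \<open>
  The residuals decrease to some \<open>e\<close>; letting \<open>M\<close> tend to infinity in \<open>residual_step\<close> yields
  \<open>e \<le> e / 2\<close>.
\<close>

theorem expansion_complete:
  assumes "l2 g" "\<forall>k<0. g k = 0"
  shows "(\<lambda>N. nsq (residual g N)) \<longlonglongrightarrow> 0"
proof -
  define E where "E = (\<lambda>N. nsq (residual g N))"
  have dec: "decseq E"
    unfolding E_def decseq_def using residual_antimono[OF assms(1)] by blast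
  have "0 \<le> E N" for N
    unfolding E_def by (rule nsq_nonneg)
  then obtain e where e: "E \<longlonglongrightarrow> e"
    using decseq_convergent[OF dec, of 0] by metis
  have "e \<le> 1/2 * E N" for N
  proof (rule LIMSEQ_le[OF e])
    have "(\<lambda>M. 2 * nsq (\<lambda>k. if k < int M then 0 else residual g N k) + 1/2 * E N)
        \<longlonglongrightarrow> 2 * 0 + 1/2 * E N"
      using assms by (intro tendsto_intros nsq_tail_tendsto_0 l2_residual)
        (auto simp: partial_expansion_def f_neg)
    then show "(\<lambda>M. 2 * nsq (\<lambda>k. if k < int M then 0 else residual g N k) + 1/2 * E N)
        \<longlonglongrightarrow> 1/2 * E N" by simp
    show "\<exists>M0. \<forall>M\<ge>M0. E M \<le> 2 * nsq (\<lambda>k. if k < int M then 0 else residual g N k) + 1/2 * E N"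
      using residual_step[OF assms, of N] unfolding E_def by blast
  qed
  then have "e \<le> 1/2 * e"
    by (intro LIMSEQ_le_const[OF tendsto_mult[OF tendsto_const e]]) auto
  moreover have "0 \<le> e"
    using nsq_nonneg by (intro LIMSEQ_le_const[OF e]) (auto simp: E_def)
  ultimately have "e = 0" by simp
  then show ?thesis using e by (simp add: E_def)
qed

lemma expansion_pointwise:
  assumes "l2 g" "\<forall>k<0. g k = 0"
  shows "(\<lambda>n. ip g (f n) * f n k) sums g k"
proof -
  have "(\<lambda>N. sqrt (nsq (residual g N))) \<longlonglongrightarrow> sqrt 0"
    using expansion_complete[OF assms] by (rule tendsto_real_sqrt)
  then have lim: "(\<lambda>N. sqrt (nsq (residual g N))) \<longlonglongrightarrow> 0" by simp
  have "cmod (partial_expansion g N k - g k) \<le> sqrt (nsq (residual g N))" for N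
    using coord_le_nsq[OF l2_residual[OF assms(1)], of k]
    by (intro real_le_rsqrt) (simp add: norm_minus_commute)
  then have "(\<lambda>N. partial_expansion g N k - g k) \<longlonglongrightarrow> 0"
    by (intro Lim_null_comparison[OF _ lim] eventuallyI)
  then show ?thesis
    unfolding sums_def partial_expansion_def by (simp add: LIM_zero_iff)
qed

lemma eq_0_if_orthogonal:
  assumes "l2 g" "\<forall>k<0. g k = 0" "\<And>n. ip g (f n) = 0"
  shows "g k = 0"
  using expansion_pointwise[OF assms(1,2), of k] assms(3) by (simp add: sums_iff)

lemma orthonormal_basis: "orthonormal_basis_L2_plus f"
  unfolding orthonormal_basis_L2_plus_def Hplus_0_iff
proof (intro conjI allI ballI)
  fix g assume "g \<in> Hplus 0"
  then show "(\<lambda>N. \<Sum>\<^sub>\<infinity>k. (cmod (g k - (\<Sum>n<N. ip g (f n) * f n k)))\<^sup>2) \<longlonglongrightarrow> 0"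
    using expansion_complete[of g] by (simp add: Hplus_0_iff nsq_def partial_expansion_def)
qed (use l2_f f_neg ip_f in auto)

end

section \<open>Eigenvectors of the Lax operator of a small trigonometric polynomial\<close>

text \<open>
  Used for the squared norms of the eigenvectors and for the overlaps of consecutive ones: both are
  sums with one term equal to 1 and all others quadratically small.
\<close>

lemma infsum_near_1:
  fixes f :: "int \<Rightarrow> 'a :: {real_normed_algebra_1, banach}"
  assumes "f n = 1" "\<And>k. k \<noteq> n \<Longrightarrow> norm (f k) \<le> C * geo (k - n)"
  shows "norm ((\<Sum>\<^sub>\<infinity>k. f k) - 1) \<le> 3 * C"
proof -
  define e where "e = (\<lambda>k. if k = n then (1::'a) else 0)"
  have C: "0 \<le> C"
    using order_trans[OF norm_ge_zero assms(2)[of "n + 1"]] geo_pos[of 1] by (simp add: zero_le_mult_iff)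
  have e: "(e has_sum 1) UNIV"
    unfolding e_def by (rule has_sum_finite_neutralI[of "{n}"]) auto
  have bound: "norm (f k - e k) \<le> C * geo (k - n)" for k
    using assms C by (auto simp: e_def)
  have hs: "((\<lambda>k. C * geo (k - n)) has_sum (C * 3)) UNIV"
    by (intro has_sum_cmult_right has_sum_geo_shift)
  have abs: "(\<lambda>k. norm (f k - e k)) summable_on UNIV"
  proof (rule summable_on_comparison_test)
    show "(\<lambda>k. C * geo (k - n)) summable_on UNIV"
      using hs by (rule has_sum_imp_summable)
  qed (simp_all add: bound)
  then have s: "(\<lambda>k. f k - e k) summable_on UNIV"
    by (rule abs_summable_summable)
  have "(\<Sum>\<^sub>\<infinity>k. f k) = (\<Sum>\<^sub>\<infinity>k. (f k - e k) + e k)" by simp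
  also have "\<dots> = (\<Sum>\<^sub>\<infinity>k. f k - e k) + 1"
    using infsum_add[OF s has_sum_imp_summable[OF e]] infsumI[OF e] by simp
  finally have "norm ((\<Sum>\<^sub>\<infinity>k. f k) - 1) = norm (\<Sum>\<^sub>\<infinity>k. f k - e k)" by simp
  also have "\<dots> \<le> (\<Sum>\<^sub>\<infinity>k. norm (f k - e k))"
    by (rule norm_infsum_bound[OF abs])
  also have "\<dots> \<le> 3 * C"
    using has_sum_mono[OF has_sum_infsum[OF abs] hs bound] by simp
  finally show ?thesis .
qed

lemma infsum_diff_complex:
  fixes f g :: "'k \<Rightarrow> complex"
  assumes "f summable_on A" "g summable_on A"
  shows "infsum (\<lambda>k. f k - g k) A = infsum f A - infsum g A"
  using infsum_add[OF assms(1), of "\<lambda>k. - g k"] assms(2) by (simp add: infsum_uminus summable_on_uminus)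

text \<open>
  The weight \<open>2\<^sup>\<bar>\<^sup>k\<^sup>\<bar>\<close> makes convolution with \<open>u\<close> an operator of norm at most \<open>\<epsilon>\<close> for the
  exponentially weighted sup norms around every \<open>n\<close> at once. The finite support turns every
  convolution into a finite sum. The bound \<open>1/200\<close> keeps denominators, overlaps and normalizing
  factors away from 0.
\<close>

locale small_potential =
  fixes u :: "int \<Rightarrow> complex" and K :: int and \<epsilon> :: real
  assumes supp: "K < \<bar>k\<bar> \<Longrightarrow> u k = 0"
    and u_0: "u 0 = 0"
    and u_minus: "u (- k) = cnj (u k)"
    and weight: "(\<Sum>k\<in>{-K..K}. cmod (u k) * 2 ^ nat \<bar>k\<bar>) \<le> \<epsilon>"
    and eps: "\<epsilon> \<le> 1/200"
begin

lemma eps_nonneg: "0 \<le> \<epsilon>"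
  by (rule order_trans[OF sum_nonneg weight]) auto

definition conv :: "(int \<Rightarrow> complex) \<Rightarrow> int \<Rightarrow> complex" where
  "conv f m = (\<Sum>j\<in>{-K..K}. u j * f (m - j))"

lemma mult_eq_conv: "mult u f = conv f"
proof
  fix m :: int
  have "bij_betw (\<lambda>j. m - j) UNIV UNIV"
    by (rule bij_betwI[of _ _ _ "\<lambda>j. m - j"]) auto
  from infsum_reindex_bij_betw[OF this, of "\<lambda>k. u (m - k) * f k"]
  have "mult u f m = (\<Sum>\<^sub>\<infinity>j. u j * f (m - j))"
    by (simp add: mult_def)
  also have "\<dots> = (\<Sum>\<^sub>\<infinity>j\<in>{-K..K}. u j * f (m - j))"
    by (rule infsum_cong_neutral) (auto simp: supp abs_le_iff not_le)
  finally show "mult u f m = conv f m" by (simp add: conv_def)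
qed

lemma Lax_eq: "Lax u f m = of_int m * f m - (if 0 \<le> m then conv f m else 0)"
  by (simp add: Lax_def Toeplitz_def Szego_def mult_eq_conv)

lemma conv_add: "conv (\<lambda>k. f k + g k) m = conv f m + conv g m"
  and conv_diff: "conv (\<lambda>k. f k - g k) m = conv f m - conv g m"
  and conv_cmult: "conv (\<lambda>k. c * f k) m = c * conv f m"
  by (simp_all add: conv_def algebra_simps sum.distrib sum_subtractf sum_distrib_left)

lemma conv_mode: "conv (mode n) m = u (m - n)"
proof -
  have "conv (mode n) m = (\<Sum>j\<in>{-K..K}. if j = m - n then u j else 0)"
    unfolding conv_def by (intro sum.cong) (auto simp: mode_def)
  then show ?thesis using supp[of "m - n"] by (auto simp: abs_le_iff not_le)
qed

lemma conv_geo: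
  assumes "\<And>k. cmod (f k) \<le> C * geo (k - n)"
  shows "cmod (conv f m) \<le> \<epsilon> * C * geo (m - n)"
proof -
  have C: "0 \<le> C" using order_trans[OF norm_ge_zero assms[of n]] by simp
  have "cmod (conv f m) \<le> (\<Sum>j\<in>{-K..K}. (cmod (u j) * 2 ^ nat \<bar>j\<bar>) * (C * geo (m - n)))"
    unfolding conv_def
  proof (rule sum_norm_le)
    fix j assume "j \<in> {-K..K}"
    have "cmod (f (m - j)) \<le> C * geo (m - n - j)"
      using assms[of "m - j"] by (simp add: algebra_simps)
    also have "\<dots> \<le> C * (2 ^ nat \<bar>j\<bar> * geo (m - n))"
      using C by (intro mult_left_mono geo_diff_le)
    finally have "cmod (u j) * cmod (f (m - j)) \<le> cmod (u j) * (C * (2 ^ nat \<bar>j\<bar> * geo (m - n)))"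
      by (intro mult_left_mono) auto
    then show "cmod (u j * f (m - j)) \<le> (cmod (u j) * 2 ^ nat \<bar>j\<bar>) * (C * geo (m - n))"
      by (simp add: norm_mult mult_ac)
  qed
  also have "\<dots> = (\<Sum>j\<in>{-K..K}. cmod (u j) * 2 ^ nat \<bar>j\<bar>) * (C * geo (m - n))"
    by (rule sum_distrib_right[symmetric])
  also have "\<dots> \<le> \<epsilon> * (C * geo (m - n))"
    using C geo_pos[of "m - n"] by (intro mult_right_mono weight) auto
  finally show ?thesis by (simp add: mult_ac)
qed

lemma sum_u_le: "(\<Sum>j\<in>{-K..K}. cmod (u j)) \<le> \<epsilon>"
proof -
  have "(\<Sum>j\<in>{-K..K}. cmod (u j)) \<le> (\<Sum>k\<in>{-K..K}. cmod (u k) * 2 ^ nat \<bar>k\<bar>)"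
    by (intro sum_mono) (simp add: mult_le_cancel_left1)
  then show ?thesis using weight by linarith
qed

lemma conv_sup:
  assumes "\<And>k. cmod (f k) \<le> C"
  shows "cmod (conv f m) \<le> \<epsilon> * C"
proof -
  have C: "0 \<le> C" using order_trans[OF norm_ge_zero assms[of 0]] by simp
  have "cmod (conv f m) \<le> (\<Sum>j\<in>{-K..K}. cmod (u j) * C)"
    unfolding conv_def by (rule sum_norm_le) (auto simp: norm_mult intro!: mult_left_mono assms)
  also have "\<dots> = (\<Sum>j\<in>{-K..K}. cmod (u j)) * C"
    by (rule sum_distrib_right[symmetric])
  also have "\<dots> \<le> \<epsilon> * C"
    by (rule mult_right_mono[OF sum_u_le C])
  finally show ?thesis .
qed

lemma l2_conv: "l2 f \<Longrightarrow> l2 (conv f)"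
  unfolding conv_def[abs_def] by (intro l2_sum l2_cmult l2_shift)

lemma conv_tendsto:
  assumes "\<And>k. (\<lambda>i. f i k) \<longlonglongrightarrow> g k"
  shows "(\<lambda>i. conv (f i) m) \<longlonglongrightarrow> conv g m"
  unfolding conv_def by (intro tendsto_intros assms)

lemma conv_symmetric:
  assumes "l2 f" "l2 g"
  shows "ip (conv f) g = ip f (conv g)"
proof -
  have s: "l2 (\<lambda>k. h (k - j))" if "l2 h" for h j using l2_shift[OF that] .
  have "ip (conv f) g = (\<Sum>j\<in>{-K..K}. u j * ip (\<lambda>k. f (k - j)) g)"
    unfolding conv_def[abs_def]
    by (subst ip_sum_left) (auto intro!: l2_cmult s assms simp: ip_cmult_left)
  also have "\<dots> = (\<Sum>j\<in>{-K..K}. u j * ip f (\<lambda>k. g (k - (- j))))"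
  proof (intro sum.cong refl arg_cong2[where f = "(*)"])
    fix j
    show "ip (\<lambda>k. f (k - j)) g = ip f (\<lambda>k. g (k - (- j)))"
      unfolding ip_def using infsum_shift[of "\<lambda>k. f k * cnj (g (k + j))" j] by simp
  qed
  also have "\<dots> = (\<Sum>j\<in>{-K..K}. u (- j) * ip f (\<lambda>k. g (k - j)))"
    by (rule sum.reindex_bij_witness[of _ uminus uminus]) auto
  also have "\<dots> = ip f (conv g)"
    unfolding conv_def[abs_def]
    by (subst ip_sum_right) (auto intro!: l2_cmult s assms simp: ip_cmult_right u_minus)
  finally show ?thesis .
qed

text \<open>
  The domain condition rests on \<open>g\<close> alone, so that the identity applies to eigenvectors \<open>f\<close> that
  are known merely to be square summable; \<open>g\<close> will always decay exponentially.
\<close>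

lemma Lax_symmetric:
  assumes f: "l2 f" "\<And>k. k < 0 \<Longrightarrow> f k = 0"
    and g: "l2 g" "\<And>k. k < 0 \<Longrightarrow> g k = 0" "l2 (\<lambda>k. of_int k * g k)"
  shows "ip (Lax u f) g = ip f (Lax u g)"
proof -
  have "ip (Lax u f) g = (\<Sum>\<^sub>\<infinity>k. f k * cnj (of_int k * g k) - conv f k * cnj (g k))"
    unfolding ip_def
  proof (rule infsum_cong)
    fix k show "Lax u f k * cnj (g k) = f k * cnj (of_int k * g k) - conv f k * cnj (g k)"
      by (cases "k < 0") (simp_all add: Lax_eq f g algebra_simps)
  qed
  also have "\<dots> = ip f (\<lambda>k. of_int k * g k) - ip (conv f) g"
    unfolding ip_def by (intro infsum_diff_complex ip_summable f g l2_conv)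
  also have "\<dots> = ip f (\<lambda>k. of_int k * g k) - ip f (conv g)"
    by (simp add: conv_symmetric f g)
  also have "\<dots> = (\<Sum>\<^sub>\<infinity>k. f k * cnj (of_int k * g k) - f k * cnj (conv g k))"
    unfolding ip_def by (intro infsum_diff_complex[symmetric] ip_summable f g l2_conv)
  also have "\<dots> = ip f (Lax u g)"
    unfolding ip_def
  proof (rule infsum_cong)
    fix k show "f k * cnj (of_int k * g k) - f k * cnj (conv g k) = f k * cnj (Lax u g k)"
      by (cases "k < 0") (simp_all add: Lax_eq f g algebra_simps)
  qed
  finally show ?thesis .
qed

text \<open>
  An eigenvector near the mode \<open>e\<^sub>n\<close> is sought as \<open>e\<^sub>n + g\<close> with \<open>g n = 0\<close>. The \<open>n\<close>-th component of
  \<open>L\<^sub>u (e\<^sub>n + g) = \<lambda> (e\<^sub>n + g)\<close> then gives \<open>\<lambda> = n - conv g n\<close>, and the others say that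
  \<open>(m - \<lambda>) g m = conv (e\<^sub>n + g) m\<close>, a fixed point equation for \<open>g\<close>. As \<open>m - \<lambda>\<close> is bounded away from
  0, the map \<open>picard_step\<close> gains a factor of order \<open>\<epsilon>\<close>.
\<close>

definition corrector :: "int \<Rightarrow> (int \<Rightarrow> complex) \<Rightarrow> bool" where
  "corrector n g \<longleftrightarrow> (\<forall>m. cmod (g m) \<le> 2 * \<epsilon> * geo (m - n)) \<and> (\<forall>m. m < 0 \<or> m = n \<longrightarrow> g m = 0)"

definition picard_step :: "int \<Rightarrow> (int \<Rightarrow> complex) \<Rightarrow> int \<Rightarrow> complex" where
  "picard_step n g m = (if 0 \<le> m \<and> m \<noteq> n
     then conv (\<lambda>k. mode n k + g k) m / (of_int (m - n) + conv g n) else 0)"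

lemma corrector_bounds:
  assumes "corrector n g"
  shows "cmod (g m) \<le> 2 * \<epsilon> * geo (m - n)" "cmod (mode n m + g m) \<le> geo (m - n)"
    "m < 0 \<Longrightarrow> g m = 0" "g n = 0" "cmod (conv g m) \<le> 2 * \<epsilon>\<^sup>2"
proof -
  have g: "cmod (g m) \<le> 2 * \<epsilon> * geo (m - n)" for m
    using assms by (simp add: corrector_def)
  then show "cmod (g m) \<le> 2 * \<epsilon> * geo (m - n)" .
  show "m < 0 \<Longrightarrow> g m = 0" and gn: "g n = 0"
    using assms by (auto simp: corrector_def)
  have "2 * \<epsilon> * geo (m - n) \<le> 1 * geo (m - n)"
    using eps geo_pos[of "m - n"] by (intro mult_right_mono) auto
  then show "cmod (mode n m + g m) \<le> geo (m - n)"
    using g[of m] gn by (auto simp: mode_def)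
  have "cmod (g m) \<le> 2 * \<epsilon>" for m
    using g[of m] mult_left_le[OF geo_le_1[of "m - n"], of "2 * \<epsilon>"] eps_nonneg by simp
  from conv_sup[of g, OF this, of m] show "cmod (conv g m) \<le> 2 * \<epsilon>\<^sup>2"
    by (simp add: power2_eq_square mult_ac)
qed

lemma eps_sq: "\<epsilon>\<^sup>2 \<le> 1/40000"
  using power_mono[OF eps eps_nonneg, of 2] by (simp add: power2_eq_square)

lemma denominator:
  assumes "corrector n g" "m \<noteq> n"
  shows "1/2 \<le> cmod (of_int (m - n) + conv g n)"
proof -
  have "1 \<le> cmod (of_int (m - n) :: complex)"
    using assms(2) unfolding norm_of_int by simp
  moreover have "cmod (conv g n) \<le> 1/2"
    using corrector_bounds(5)[OF assms(1), of n] eps_sq by linarith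
  ultimately show ?thesis
    using norm_diff_ineq[of "of_int (m - n) :: complex" "conv g n"] by linarith
qed

lemma corrector_picard_step:
  assumes "corrector n g"
  shows "corrector n (picard_step n g)"
  unfolding corrector_def
proof (intro conjI allI impI)
  fix m
  have "cmod (conv (\<lambda>k. mode n k + g k) m / (of_int (m - n) + conv g n)) \<le> 2 * \<epsilon> * geo (m - n)" if "m \<noteq> n"
  proof -
    have "cmod (conv (\<lambda>k. mode n k + g k) m) \<le> \<epsilon> * 1 * geo (m - n)"
      by (rule conv_geo) (use corrector_bounds(2)[OF assms] in auto)
    then have "cmod (conv (\<lambda>k. mode n k + g k) m) / cmod (of_int (m - n) + conv g n)
        \<le> (\<epsilon> * 1 * geo (m - n)) / (1/2)"
      using denominator[OF assms that] eps_nonneg geo_pos[of "m - n"]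
      by (intro frac_le) auto
    then show ?thesis by (simp add: norm_divide)
  qed
  then show "cmod (picard_step n g m) \<le> 2 * \<epsilon> * geo (m - n)"
    using eps_nonneg geo_pos[of "m - n"] by (auto simp: picard_step_def)
qed (auto simp: picard_step_def)

text \<open>
  The contraction holds in the plain sup norm, while the decay built into \<open>corrector\<close> is
  preserved by each step and by pointwise limits.
\<close>

lemma picard_step_contraction:
  assumes g: "corrector n g" and h: "corrector n h" and d: "\<And>m. cmod (g m - h m) \<le> d"
  shows "cmod (picard_step n g m - picard_step n h m) \<le> d / 2"
proof -
  have d0: "0 \<le> d" using order_trans[OF norm_ge_zero d[of 0]] .
  show ?thesis
  proof (cases "0 \<le> m \<and> m \<noteq> n")
    case True
    define a b where "a = conv (\<lambda>k. mode n k + g k) m" and "b = conv (\<lambda>k. mode n k + h k) m"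
    define x y where "x = of_int (m - n) + conv g n" and "y = of_int (m - n) + conv h n"
    have x: "1/2 \<le> cmod x" and y: "1/2 \<le> cmod y"
      unfolding x_def y_def using True denominator[OF g] denominator[OF h] by blast+
    have nz: "x \<noteq> 0" "y \<noteq> 0" using x y by auto
    have "a - b = conv (\<lambda>k. g k - h k) m"
      by (simp add: a_def b_def conv_add conv_diff)
    then have ab: "cmod (a - b) \<le> \<epsilon> * d"
      using conv_sup[of "\<lambda>k. g k - h k", OF d] by simp
    have "y - x = - conv (\<lambda>k. g k - h k) n"
      by (simp add: x_def y_def conv_diff)
    then have yx: "cmod (y - x) \<le> \<epsilon> * d"
      using conv_sup[of "\<lambda>k. g k - h k", OF d] by simp
    have "cmod (mode n k + h k) \<le> 1" for k
      using corrector_bounds(2)[OF h, of k] geo_le_1[of "k - n"] by linarith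
    from conv_sup[of "\<lambda>k. mode n k + h k", OF this] have b: "cmod b \<le> \<epsilon>"
      by (simp add: b_def)
    have st: "picard_step n g m - picard_step n h m = a / x - b / y"
      using True by (simp add: picard_step_def a_def b_def x_def y_def)
    have "picard_step n g m - picard_step n h m = (a - b) / x + b * (y - x) / (x * y)"
      unfolding st using nz by (simp add: field_simps)
    also have "cmod \<dots> \<le> cmod ((a - b) / x) + cmod (b * (y - x) / (x * y))"
      by (rule norm_triangle_ineq)
    also have "cmod ((a - b) / x) \<le> (\<epsilon> * d) / (1/2)"
      unfolding norm_divide using x ab eps_nonneg d0 by (intro frac_le) auto
    also have "cmod (b * (y - x) / (x * y)) \<le> (\<epsilon> * (\<epsilon> * d)) / (1/2 * (1/2))"
      unfolding norm_divide norm_mult using x y b yx eps_nonneg d0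
      by (intro frac_le mult_mono) auto
    also have "(\<epsilon> * d) / (1/2) + (\<epsilon> * (\<epsilon> * d)) / (1/2 * (1/2)) = (2 * \<epsilon> + 4 * \<epsilon>\<^sup>2) * d"
      by (simp add: power2_eq_square algebra_simps)
    also have "\<dots> \<le> 1/2 * d"
      using eps eps_sq by (intro mult_right_mono d0) linarith
    finally show ?thesis by simp
  qed (use d0 in \<open>auto simp: picard_step_def\<close>)
qed

lemma ex_fixed_corrector: "\<exists>g. corrector n g \<and> (\<forall>m. picard_step n g m = g m)"
proof -
  define s where "s = (\<lambda>i. (picard_step n ^^ i) (\<lambda>k. 0))"
  have s_Suc: "s (Suc i) = picard_step n (s i)" for i by (simp add: s_def)
  have cor: "corrector n (s i)" for i
  proof (induction i)
    case 0
    then show ?case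
      using eps_nonneg geo_pos by (auto simp: s_def corrector_def less_imp_le)
  qed (simp add: s_Suc corrector_picard_step)
  have diff: "cmod (s (Suc i) m - s i m) \<le> (1/2) ^ i" for i m
  proof (induction i arbitrary: m)
    case 0
    have "cmod (s 1 m) \<le> 2 * \<epsilon> * 1"
      using corrector_bounds(1)[OF cor[of 1], of m] geo_le_1[of "m - n"] eps_nonneg
      by (meson mult_left_mono order_trans mult_nonneg_nonneg zero_le_numeral)
    then show ?case using eps by (simp add: s_def)
  next
    case (Suc i)
    then show ?case
      using picard_step_contraction[OF cor[of "Suc i"] cor[of i], of "(1/2) ^ i" m] by (simp add: s_Suc)
  qed
  have "\<exists>l. (\<lambda>i. s i m) \<longlonglongrightarrow> l" for m
  proof -
    have "summable (\<lambda>i. s (Suc i) m - s i m)"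
      by (rule summable_comparison_test'[OF summable_geometric[of "1/2::real"], of 0]) (use diff in auto)
    then have "(\<lambda>N. \<Sum>i<N. s (Suc i) m - s i m) \<longlonglongrightarrow> (\<Sum>i. s (Suc i) m - s i m)"
      by (rule summable_LIMSEQ)
    moreover have "(\<Sum>i<N. s (Suc i) m - s i m) = s N m" for N
      using sum_lessThan_telescope[of "\<lambda>i. s i m" N] by (simp add: s_def)
    ultimately show ?thesis by auto
  qed
  then obtain g where g: "\<And>m. (\<lambda>i. s i m) \<longlonglongrightarrow> g m" by metis
  have "corrector n g"
    unfolding corrector_def
  proof (intro conjI allI impI)
    show "cmod (g m) \<le> 2 * \<epsilon> * geo (m - n)" for m
      using corrector_bounds(1)[OF cor] by (intro LIMSEQ_le_const2[OF tendsto_norm[OF g]]) auto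
    show "g m = 0" if "m < 0 \<or> m = n" for m
      using g[of m] cor that by (auto simp: corrector_def LIMSEQ_const_iff)
  qed
  moreover have "picard_step n g m = g m" for m
  proof (rule LIMSEQ_unique)
    show "(\<lambda>i. s (Suc i) m) \<longlonglongrightarrow> g m" by (rule LIMSEQ_Suc[OF g])
    show "(\<lambda>i. s (Suc i) m) \<longlonglongrightarrow> picard_step n g m"
    proof (cases "0 \<le> m \<and> m \<noteq> n")
      case True
      have "of_int (m - n) + conv g n \<noteq> 0"
        using denominator[OF \<open>corrector n g\<close>, of m] True by auto
      then show ?thesis
        unfolding s_Suc picard_step_def using True
        by (auto intro!: tendsto_divide tendsto_add conv_tendsto g)
    qed (auto simp: s_Suc picard_step_def)
  qed
  ultimately show ?thesis by blast
qed

definition G :: "nat \<Rightarrow> int \<Rightarrow> complex" where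
  "G n = (SOME g. corrector (int n) g \<and> (\<forall>m. picard_step (int n) g m = g m))"

definition F :: "nat \<Rightarrow> int \<Rightarrow> complex" where
  "F n k = mode (int n) k + G n k"

definition \<delta> :: "nat \<Rightarrow> complex" where
  "\<delta> n = conv (G n) (int n)"

definition lam :: "nat \<Rightarrow> real" where
  "lam n = real n - Re (\<delta> n)"

lemma corrector_G: "corrector (int n) (G n)" and picard_step_G: "picard_step (int n) (G n) m = G n m"
  using someI_ex[OF ex_fixed_corrector[of "int n"]] by (auto simp: G_def)

lemma G_bound: "cmod (G n k) \<le> 2 * \<epsilon> * geo (k - int n)"
  and F_bound: "cmod (F n k) \<le> geo (k - int n)"
  and \<delta>_bound: "cmod (\<delta> n) \<le> 2 * \<epsilon>\<^sup>2"
  using corrector_bounds[OF corrector_G] by (auto simp: F_def \<delta>_def)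

lemma F_neg: "k < 0 \<Longrightarrow> F n k = 0" and G_diag: "G n (int n) = 0" and F_diag: "F n (int n) = 1"
  using corrector_bounds[OF corrector_G] by (auto simp: F_def mode_def)

lemma F_off: "k \<noteq> int n \<Longrightarrow> F n k = G n k"
  by (simp add: F_def mode_def)

lemma G_eq:
  assumes "0 \<le> m" "m \<noteq> int n"
  shows "(of_int (m - int n) + \<delta> n) * G n m = conv (F n) m"
proof -
  have "of_int (m - int n) + \<delta> n \<noteq> 0"
    using denominator[OF corrector_G assms(2)] unfolding \<delta>_def by auto
  then show ?thesis
    using picard_step_G[of n m] assms unfolding picard_step_def F_def[abs_def] \<delta>_def
    by (auto simp: divide_eq_eq mult.commute)
qed

lemma l2_F: "l2 (F n)" and l2_int_F: "l2 (\<lambda>k. of_int k * F n k)"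
  using F_bound[of n] by (auto intro: l2_geo[of _ 1 "int n"] l2_weighted_geo[of _ 1 "int n"])

lemma nsq_F: "1 \<le> nsq (F n)" "nsq (F n) \<le> 1 + 12 * \<epsilon>\<^sup>2"
proof -
  show "1 \<le> nsq (F n)"
    using coord_le_nsq[OF l2_F, of n "int n"] by (simp add: F_diag)
  have "norm ((cmod (F n k))\<^sup>2) \<le> 4 * \<epsilon>\<^sup>2 * geo (k - int n)" if "k \<noteq> int n" for k
  proof -
    have "(cmod (F n k))\<^sup>2 \<le> (2 * \<epsilon> * geo (k - int n))\<^sup>2"
      using G_bound[of n k] that by (intro power_mono) (auto simp: F_off)
    also have "\<dots> = 4 * \<epsilon>\<^sup>2 * (geo (k - int n) * geo (k - int n))"
      by (simp add: power2_eq_square)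
    also have "\<dots> \<le> 4 * \<epsilon>\<^sup>2 * (geo (k - int n) * 1)"
      using geo_pos[of "k - int n"] geo_le_1[of "k - int n"] by (intro mult_left_mono) auto
    finally show ?thesis by simp
  qed
  from infsum_near_1[of "\<lambda>k. (cmod (F n k))\<^sup>2", OF _ this]
  show "nsq (F n) \<le> 1 + 12 * \<epsilon>\<^sup>2"
    by (simp add: F_diag nsq_def abs_le_iff)
qed

text \<open>
  The construction produces the eigenvalue \<open>n - \<delta>\<^sub>n\<close> as a complex number; symmetry shows that it is
  real.
\<close>

lemma Lax_F: "Lax u (F n) = (\<lambda>k. complex_of_real (lam n) * F n k)"
proof -
  have L: "Lax u (F n) = (\<lambda>k. (of_nat n - \<delta> n) * F n k)"
  proof
    fix k
    consider "k < 0" | "k = int n" | "0 \<le> k" "k \<noteq> int n" by linarith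
    then show "Lax u (F n) k = (of_nat n - \<delta> n) * F n k"
    proof cases
      case 1
      then show ?thesis by (simp add: Lax_eq F_neg)
    next
      case 2
      have "conv (F n) (int n) = \<delta> n"
        unfolding F_def[abs_def] conv_add conv_mode by (simp add: u_0 \<delta>_def)
      then show ?thesis using 2 by (simp add: Lax_eq F_diag)
    next
      case 3
      then show ?thesis
        using G_eq[OF 3] by (simp add: Lax_eq F_off algebra_simps)
    qed
  qed
  have "ip (Lax u (F n)) (F n) = ip (F n) (Lax u (F n))"
    by (rule Lax_symmetric) (auto intro: l2_F l2_int_F F_neg)
  then have "(of_nat n - \<delta> n) * nsq (F n) = cnj (of_nat n - \<delta> n) * nsq (F n)"
    unfolding L ip_cmult_left ip_cmult_right by (simp add: ip_self l2_F)
  then have "of_nat n - \<delta> n = cnj (of_nat n - \<delta> n)"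
    using nsq_F(1)[of n] by auto
  then have "Im (of_nat n - \<delta> n) = 0"
    by (metis cnj.simps(2) equal_neg_zero)
  then have "of_nat n - \<delta> n = complex_of_real (lam n)"
    by (simp add: complex_eq_iff lam_def)
  then show ?thesis using L by simp
qed

lemma lam_bound: "\<bar>lam n - real n\<bar> \<le> 2 * \<epsilon>\<^sup>2"
  using \<delta>_bound[of n] abs_Re_le_cmod[of "\<delta> n"] by (simp add: lam_def)

lemma lam_diff: "\<bar>(lam m - lam n) - (real m - real n)\<bar> \<le> 4 * \<epsilon>\<^sup>2"
  using lam_bound[of m] lam_bound[of n] by linarith

lemma lam_strict_mono: "strict_mono lam"
proof (rule strict_monoI)
  fix m n :: nat assume "m < n"
  then show "lam m < lam n" using lam_diff[of m n] eps_sq by (simp add: abs_le_iff)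
qed

lemma lam_eq_iff: "lam m = lam n \<longleftrightarrow> m = n"
  using strict_mono_eq[OF lam_strict_mono] .

lemma eigenvectors_orthogonal:
  assumes "l2 g" "\<And>k. k < 0 \<Longrightarrow> g k = 0" "Lax u g = (\<lambda>k. \<mu> * g k)" "\<mu> \<noteq> complex_of_real (lam n)"
  shows "ip g (F n) = 0"
proof -
  have "ip (Lax u g) (F n) = ip g (Lax u (F n))"
    by (rule Lax_symmetric) (auto intro: l2_F l2_int_F F_neg assms)
  then have "\<mu> * ip g (F n) = lam n * ip g (F n)"
    unfolding assms(3) Lax_F ip_cmult_left ip_cmult_right by simp
  then show ?thesis using assms(4) by simp
qed

lemma ip_F: "m \<noteq> n \<Longrightarrow> ip (F m) (F n) = 0"
  by (rule eigenvectors_orthogonal[OF l2_F _ Lax_F]) (auto simp: F_neg lam_eq_iff)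

end

section \<open>The spectrum and the normalized eigenbasis\<close>

lemma jap_ge_1: "1 \<le> jap k"
  by (simp add: jap_def)

lemma Hc_iff_l2: "f \<in> Hc \<beta> \<longleftrightarrow> l2 (\<lambda>k. complex_of_real (jap k powr \<beta>) * f k)"
proof -
  have "jap k powr (2 * \<beta>) = (jap k powr \<beta>)\<^sup>2" for k
    using jap_ge_1[of k] by (simp add: power2_eq_square flip: powr_add)
  then show ?thesis
    by (simp add: Hc_def l2_def norm_mult power_mult_distrib)
qed

lemma Hplus_iff_l2:
  "f \<in> Hplus \<beta> \<longleftrightarrow> l2 (\<lambda>k. complex_of_real (jap k powr \<beta>) * f k) \<and> (\<forall>k<0. f k = 0)"
  by (simp add: Hplus_def Hc_iff_l2)

lemma HplusI:
  assumes "l2 g" "\<And>k. jap k powr \<beta> * cmod (f k) \<le> C * cmod (g k)" "\<And>k. k < 0 \<Longrightarrow> f k = 0"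
  shows "f \<in> Hplus \<beta>"
  unfolding Hplus_iff_l2 using assms by (auto intro!: l2_bound[OF assms(1)] simp: norm_mult)

lemma Hplus_add: "f \<in> Hplus \<beta> \<Longrightarrow> g \<in> Hplus \<beta> \<Longrightarrow> (\<lambda>k. f k + g k) \<in> Hplus \<beta>"
  using l2_add[of "\<lambda>k. complex_of_real (jap k powr \<beta>) * f k" "\<lambda>k. complex_of_real (jap k powr \<beta>) * g k"]
  by (simp add: Hplus_iff_l2 distrib_left)

lemma Hplus_cmult: "f \<in> Hplus \<beta> \<Longrightarrow> (\<lambda>k. c * f k) \<in> Hplus \<beta>"
  using l2_cmult[of "\<lambda>k. complex_of_real (jap k powr \<beta>) * f k" c]
  by (simp add: Hplus_iff_l2 mult.left_commute)

lemma Hplus_antimono: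
  assumes "f \<in> Hplus \<beta>" "\<gamma> \<le> \<beta>"
  shows "f \<in> Hplus \<gamma>"
proof (rule HplusI[where C = 1])
  show "l2 (\<lambda>k. complex_of_real (jap k powr \<beta>) * f k)" "\<And>k. k < 0 \<Longrightarrow> f k = 0"
    using assms by (auto simp: Hplus_iff_l2)
  show "jap k powr \<gamma> * cmod (f k) \<le> 1 * cmod (complex_of_real (jap k powr \<beta>) * f k)" for k
    using assms(2) jap_ge_1[of k] by (auto simp: norm_mult intro!: mult_right_mono powr_mono)
qed

text \<open>
  On nonnegative indices \<open>\<langle>k\<rangle> \<le> k + 1\<close>, which is why the two hypotheses suffice.
\<close>

lemma Hplus_1I:
  assumes "l2 g" "l2 (\<lambda>k. of_int k * g k)" "\<And>k. k < 0 \<Longrightarrow> g k = 0"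
  shows "g \<in> Hplus 1"
proof (rule HplusI[where C = 1])
  show "l2 (\<lambda>k. (of_int k + 1) * g k)"
    using l2_add[OF assms(2,1)] by (simp add: distrib_right)
  show "jap k powr 1 * cmod (g k) \<le> 1 * cmod ((of_int k + 1) * g k)" for k
  proof (cases "k < 0")
    case False
    have "cmod (of_int k + 1) = real_of_int k + 1"
      using False norm_of_int[of "k + 1", where 'a = complex] by simp
    moreover have "jap k powr 1 \<le> real_of_int k + 1"
      using False by (simp add: jap_def)
    ultimately show ?thesis by (simp add: norm_mult mult_right_mono)
  qed (simp add: assms(3))
qed (rule assms(3))

lemma strict_mono_range_unique:
  fixes l m :: "nat \<Rightarrow> 'a::linorder"
  assumes "strict_mono l" "strict_mono m" "range l = range m"
  shows "l = m"
proof -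
  have *: "m n \<le> l n" if "strict_mono l" "strict_mono m" "range l \<subseteq> range m" for l m :: "nat \<Rightarrow> 'a" and n
  proof -
    have "\<forall>n. \<exists>p. l n = m p" using that(3) by blast
    then obtain p where p: "\<And>n. l n = m (p n)" by metis
    have "strict_mono p"
      using that(1,2) by (auto simp: strict_mono_def p strict_mono_less[OF that(2)])
    then have "n \<le> p n" by (rule strict_mono_imp_increasing)
    then show ?thesis using that(2) by (simp add: p strict_mono_less_eq)
  qed
  show ?thesis
    using *[of l m] *[of m l] assms by (auto intro!: ext antisym)
qed

lemma unimodular_eq_1:
  assumes "\<alpha> * x = y" "x \<in> \<real>" "Re x > 0" "y \<in> \<real>" "Re y > 0" "cmod \<alpha> = 1"
  shows "\<alpha> = 1"
proof -
  obtain a b where ab: "x = complex_of_real a" "y = complex_of_real b"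
    using assms by (auto elim!: Reals_cases)
  then have pos: "a > 0" "b > 0" using assms by auto
  have "cmod (\<alpha> * x) = cmod y" using assms(1) by simp
  then have "a = b" using pos assms(6) by (simp add: ab norm_mult)
  then show ?thesis using assms(1) pos by (simp add: ab)
qed

lemma mult_mode_1: "mult (mode 1) f = (\<lambda>k. f (k - 1))"
proof
  fix n
  have "mult (mode 1) f n = (\<Sum>\<^sub>\<infinity>k\<in>{n - 1}. f k)"
    unfolding mult_def by (rule infsum_cong_neutral) (auto simp: mode_def)
  then show "mult (mode 1) f n = f (n - 1)" by simp
qed

lemma ip_mode: "ip f (mode n) = f n"
proof -
  have "ip f (mode n) = (\<Sum>\<^sub>\<infinity>k\<in>{n}. f k)"
    unfolding ip_def by (rule infsum_cong_neutral) (auto simp: mode_def)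
  then show ?thesis by simp
qed

context small_potential
begin

text \<open>
  The normalization \<open>\<langle>f\<^sub>n | e\<^sup>i\<^sup>x f\<^sub>n\<^sub>-\<^sub>1\<rangle> > 0\<close> is achieved recursively by rotating \<open>F\<^sub>n\<close> by the conjugate
  sign of its overlap with the shifted predecessor.
\<close>

definition overlap :: "nat \<Rightarrow> complex" where
  "overlap n = ip (F (Suc n)) (\<lambda>k. F n (k - 1))"

primrec phase :: "nat \<Rightarrow> complex" where
  "phase 0 = 1"
| "phase (Suc n) = phase n * cnj (sgn (overlap n))"

definition z :: "nat \<Rightarrow> complex" where
  "z n = phase n / complex_of_real (sqrt (nsq (F n)))"

definition f :: "nat \<Rightarrow> int \<Rightarrow> complex" where
  "f n k = z n * F n k"

lemma overlap_bound: "cmod (overlap n - 1) \<le> 12 * \<epsilon>\<^sup>2"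
proof -
  have "cmod (F (Suc n) k * cnj (F n (k - 1))) \<le> 4 * \<epsilon>\<^sup>2 * geo (k - (1 + int n))" if "k \<noteq> 1 + int n" for k
  proof -
    have "cmod (F (Suc n) k) \<le> 2 * \<epsilon> * geo (k - (1 + int n))"
      using G_bound[of "Suc n" k] F_off[of k "Suc n"] that by simp
    moreover have "cmod (F n (k - 1)) \<le> 2 * \<epsilon> * geo (k - (1 + int n))"
      using G_bound[of n "k - 1"] F_off[of "k - 1" n] that by (simp add: algebra_simps)
    moreover have "2 * \<epsilon> * geo (k - (1 + int n)) \<le> 2 * \<epsilon>"
      using eps_nonneg geo_le_1[of "k - (1 + int n)"] by (simp add: mult_left_le)
    ultimately have "cmod (F (Suc n) k) * cmod (F n (k - 1)) \<le> (2 * \<epsilon> * geo (k - (1 + int n))) * (2 * \<epsilon>)"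
      using eps_nonneg geo_pos[of "k - (1 + int n)"]
      by (intro mult_mono) (auto intro: order_trans)
    then show ?thesis by (simp add: norm_mult power2_eq_square mult_ac)
  qed
  from infsum_near_1[OF _ this] show ?thesis
    using F_diag[of n] F_diag[of "Suc n"] by (simp add: overlap_def ip_def)
qed

lemma overlap_nz: "overlap n \<noteq> 0"
proof
  assume "overlap n = 0"
  then show False using overlap_bound[of n] eps_sq by simp
qed

lemma norm_phase: "cmod (phase n) = 1"
  by (induction n) (simp_all add: norm_mult norm_sgn overlap_nz)

lemma norm_z_le: "cmod (z n) \<le> 1" and z_nz: "z n \<noteq> 0"
  and nsq_F_z: "(cmod (z n))\<^sup>2 * nsq (F n) = 1"
proof -
  have *: "cmod (z n) = 1 / sqrt (nsq (F n))"
    using nsq_F(1)[of n] by (simp add: z_def norm_divide norm_phase)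
  have "1 \<le> sqrt (nsq (F n))" using nsq_F(1)[of n] by simp
  then show "cmod (z n) \<le> 1" "z n \<noteq> 0" using * by auto
  show "(cmod (z n))\<^sup>2 * nsq (F n) = 1"
    using * nsq_F(1)[of n] by (simp add: power_divide)
qed

sublocale near_mode_system f F z "2 * \<epsilon>"
proof
  show "l2 (f n)" for n
    unfolding f_def[abs_def] by (intro l2_cmult l2_F)
  show "ip (f m) (f n) = (if m = n then 1 else 0)" for m n
  proof (cases "m = n")
    case True
    have "ip (f n) (f n) = complex_of_real ((cmod (z n))\<^sup>2 * nsq (F n))"
      unfolding f_def[abs_def] ip_cmult_left ip_cmult_right
      by (simp add: ip_self l2_F complex_norm_square mult.assoc del: of_real_power)
    then show ?thesis using True by (simp add: nsq_F_z)
  next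
    case False
    then show ?thesis
      unfolding f_def[abs_def] ip_cmult_left ip_cmult_right by (simp add: ip_F)
  qed
  show "cmod (F n k - mode (int n) k) \<le> 2 * \<epsilon> * geo (k - int n)" for n k
    using G_bound[of n k] by (simp add: F_def)
qed (use eps eps_nonneg z_nz in \<open>auto simp: f_def F_neg\<close>)

lemma Lax_add: "Lax u (\<lambda>k. g k + h k) m = Lax u g m + Lax u h m"
  and Lax_diff: "Lax u (\<lambda>k. g k - h k) m = Lax u g m - Lax u h m"
  and Lax_cmult: "Lax u (\<lambda>k. c * g k) m = c * Lax u g m"
  by (simp_all add: Lax_eq conv_add conv_diff conv_cmult algebra_simps)

lemma Lax_f: "Lax u (f n) = (\<lambda>k. complex_of_real (lam n) * f n k)"
  unfolding f_def[abs_def] Lax_cmult Lax_F by (simp add: mult.left_commute)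

lemma f_Hplus:
  assumes "\<beta> \<le> 1"
  shows "f n \<in> Hplus \<beta>"
proof (rule Hplus_antimono[OF Hplus_1I assms])
  show "l2 (\<lambda>k. of_int k * f n k)"
    using l2_cmult[OF l2_int_F[of n], of "z n"] by (simp add: f_def mult_ac)
qed (auto intro: l2_f f_neg)

lemma f_0_0: "ip (f 0) (mode 0) \<in> \<real>" "Re (ip (f 0) (mode 0)) > 0"
proof -
  have "ip (f 0) (mode 0) = complex_of_real (1 / sqrt (nsq (F 0)))"
    using F_diag[of 0] by (simp add: ip_mode f_def z_def)
  moreover have "0 < 1 / sqrt (nsq (F 0))" using nsq_F(1)[of 0] by simp
  ultimately show "ip (f 0) (mode 0) \<in> \<real>" "Re (ip (f 0) (mode 0)) > 0" by (simp_all only: Reals_of_real Re_complex_of_real)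
qed

lemma f_shift:
  "ip (f (Suc n)) (mult (mode 1) (f n)) \<in> \<real>" "Re (ip (f (Suc n)) (mult (mode 1) (f n))) > 0"
proof -
  have "ip (f (Suc n)) (mult (mode 1) (f n)) = cnj (z n) * (z (Suc n) * overlap n)"
    unfolding f_def[abs_def] mult_mode_1 ip_cmult_left ip_cmult_right overlap_def
    by (rule mult.left_commute)
  also have "\<dots> = (cnj (phase n) * phase n) * (cnj (sgn (overlap n)) * overlap n)
      / complex_of_real (sqrt (nsq (F n)) * sqrt (nsq (F (Suc n))))"
    by (simp add: z_def)
  also have "cnj (phase n) * phase n = 1"
    using complex_norm_square[of "phase n"] by (simp add: norm_phase mult.commute)
  also have "cnj (sgn (overlap n)) * overlap n = complex_of_real (cmod (overlap n))"
  proof -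
    have "cnj (sgn (overlap n)) * overlap n = (overlap n * cnj (overlap n)) / complex_of_real (cmod (overlap n))"
      by (simp add: sgn_eq)
    also have "\<dots> = complex_of_real ((cmod (overlap n))\<^sup>2) / complex_of_real (cmod (overlap n))"
      by (simp only: complex_norm_square)
    finally show ?thesis by (simp add: power2_eq_square overlap_nz)
  qed
  finally have *: "ip (f (Suc n)) (mult (mode 1) (f n))
      = complex_of_real (cmod (overlap n) / (sqrt (nsq (F n)) * sqrt (nsq (F (Suc n)))))"
    by simp
  have "0 < cmod (overlap n) / (sqrt (nsq (F n)) * sqrt (nsq (F (Suc n))))"
    using overlap_nz[of n] nsq_F(1)[of n] nsq_F(1)[of "Suc n"] by simp
  then show "ip (f (Suc n)) (mult (mode 1) (f n)) \<in> \<real>" "Re (ip (f (Suc n)) (mult (mode 1) (f n))) > 0"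
    unfolding * by (simp_all only: Reals_of_real Re_complex_of_real)
qed

lemma eigenvector_orthogonal_f:
  assumes "l2 g" "\<And>k. k < 0 \<Longrightarrow> g k = 0" "Lax u g = (\<lambda>k. \<mu> * g k)" "\<mu> \<noteq> complex_of_real (lam n)"
  shows "ip g (f n) = 0"
  unfolding f_def[abs_def] ip_cmult_right using eigenvectors_orthogonal[OF assms] by simp

lemma resolvent_coefficients_bounded:
  assumes "\<And>n. \<mu> \<noteq> complex_of_real (lam n)"
  shows "\<exists>B. \<forall>n. cmod (1 / (complex_of_real (lam n) - \<mu>)) \<le> B"
proof -
  define b where "b = (\<lambda>n. cmod (1 / (complex_of_real (lam n) - \<mu>)))"
  obtain N :: nat where N: "cmod \<mu> + 2 \<le> real N" using real_arch_simple by blast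
  have "b n \<le> 1 + (\<Sum>i<N. b i)" for n
  proof (cases "n < N")
    case True
    then have "b n \<le> (\<Sum>i<N. b i)" by (intro member_le_sum) (auto simp: b_def)
    then show ?thesis by simp
  next
    case False
    have "1 \<le> lam n - cmod \<mu>"
      using lam_bound[of n] eps_sq N False by (simp add: abs_le_iff)
    also have "\<dots> \<le> cmod (complex_of_real (lam n) - \<mu>)"
      using norm_triangle_ineq2[of "complex_of_real (lam n)" \<mu>] by simp
    finally have "b n \<le> 1" by (simp add: b_def norm_divide divide_le_eq)
    moreover have "0 \<le> (\<Sum>i<N. b i)" by (intro sum_nonneg) (auto simp: b_def)
    ultimately show ?thesis by simp
  qed
  then show ?thesis unfolding b_def by blast
qed

text \<open>
  The solution is \<open>\<Sum> \<langle>g | f\<^sub>n\<rangle> / (\<lambda>\<^sub>n - \<mu>) f\<^sub>n\<close>. As \<open>L\<^sub>u\<close> acts through finite sums in each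
  coordinate, it may be applied termwise; the equation itself then shows that the solution lies
  in the domain of \<open>D\<close>.
\<close>

lemma resolvent_L2:
  assumes \<mu>: "\<And>n. \<mu> \<noteq> complex_of_real (lam n)" and g: "l2 g" "\<And>k. k < 0 \<Longrightarrow> g k = 0"
  shows "\<exists>h\<in>Hplus 1. \<forall>k. Lax u h k - \<mu> * h k = g k"
proof -
  obtain B where B: "\<And>n. cmod (1 / (complex_of_real (lam n) - \<mu>)) \<le> B"
    using resolvent_coefficients_bounded[OF \<mu>] by blast
  define c where "c = (\<lambda>n. ip g (f n) * (1 / (complex_of_real (lam n) - \<mu>)))"
  have c: "cmod (c n) \<le> B * cmod (ip g (f n))" for n
    using mult_right_mono[OF B[of n], of "cmod (ip g (f n))"] by (simp add: c_def norm_mult norm_divide mult_ac)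
  have c_sum: "(\<Sum>n<N. (cmod (c n))\<^sup>2) \<le> B\<^sup>2 * nsq g" for N
  proof -
    have "(\<Sum>n<N. (cmod (c n))\<^sup>2) \<le> (\<Sum>n<N. B\<^sup>2 * (cmod (ip g (f n)))\<^sup>2)"
      using power_mono[OF c norm_ge_zero, where n = 2] by (intro sum_mono) (simp add: power_mult_distrib)
    also have "\<dots> \<le> B\<^sup>2 * nsq g"
      unfolding sum_distrib_left[symmetric] by (intro mult_left_mono bessel g) auto
    finally show ?thesis .
  qed
  have summ: "summable (\<lambda>n. c n * f n k)" for k
  proof (rule summable_comparison_test')
    show "summable (\<lambda>n. sqrt (B\<^sup>2 * nsq g) * geo (k - int n))"
    proof (intro summable_mult bounded_imp_summable)
      show "0 \<le> geo (k - int n)" for n using geo_pos[of "k - int n"] by simp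
      show "(\<Sum>n\<le>N. geo (k - int n)) \<le> 3" for N
        using sum_geo_nat_le[of k "Suc N"] by (simp only: lessThan_Suc_atMost)
    qed
    fix n :: nat
    have "(cmod (c n))\<^sup>2 \<le> (\<Sum>n<Suc n. (cmod (c n))\<^sup>2)"
      by (intro member_le_sum) auto
    then have "cmod (c n) \<le> sqrt (B\<^sup>2 * nsq g)"
      using c_sum[of "Suc n"] by (intro real_le_rsqrt) linarith
    moreover have "cmod (f n k) \<le> geo (k - int n)"
      using mult_mono[OF norm_z_le[of n] F_bound[of n k]] by (simp add: f_def norm_mult)
    ultimately show "norm (c n * f n k) \<le> sqrt (B\<^sup>2 * nsq g) * geo (k - int n)"
      using nsq_nonneg[of g] unfolding norm_mult by (intro mult_mono) auto
  qed
  define h where "h = (\<lambda>k. \<Sum>n. c n * f n k)"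
  have h: "(\<lambda>n. c n * f n k) sums h k" for k
    unfolding h_def by (rule summable_sums[OF summ])
  have h_l2: "l2 h"
    by (rule l2_expansion[OF c_sum h])
  have h_neg: "h k = 0" if "k < 0" for k
    using h[of k] that by (simp add: f_neg sums_iff)
  have conv_h: "(\<lambda>n. conv (\<lambda>k. c n * f n k) k) sums conv h k" for k
    unfolding conv_def by (intro sums_sum sums_mult h)
  have "(\<lambda>n. Lax u (\<lambda>k. c n * f n k) k - \<mu> * (c n * f n k)) sums (Lax u h k - \<mu> * h k)" for k
    unfolding Lax_eq using conv_h by (cases "0 \<le> k") (auto intro!: sums_diff sums_mult h)
  moreover have "Lax u (\<lambda>k. c n * f n k) k - \<mu> * (c n * f n k) = ip g (f n) * f n k" for n k
  proof -
    have "Lax u (\<lambda>k. c n * f n k) k - \<mu> * (c n * f n k) = (c n * (complex_of_real (lam n) - \<mu>)) * f n k"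
      unfolding Lax_cmult Lax_f by (simp add: algebra_simps)
    also have "c n * (complex_of_real (lam n) - \<mu>) = ip g (f n)"
      using \<mu>[of n] by (simp add: c_def)
    finally show ?thesis .
  qed
  ultimately have "(\<lambda>n. ip g (f n) * f n k) sums (Lax u h k - \<mu> * h k)" for k by simp
  then have eq: "Lax u h k - \<mu> * h k = g k" for k
    using expansion_pointwise[of g k] g sums_unique2 by blast
  have "l2 (\<lambda>k. of_int k * h k)"
  proof -
    define w where "w = (\<lambda>k. g k + \<mu> * h k + conv h k)"
    have w: "l2 w" unfolding w_def by (intro l2_add g l2_cmult h_l2 l2_conv)
    have "cmod (of_int k * h k) \<le> 1 * cmod (w k)" for k
    proof (cases "k < 0")
      case False
      then have "of_int k * h k = w k" using eq[of k] by (simp add: w_def Lax_eq algebra_simps)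
      then show ?thesis by simp
    qed (simp add: h_neg)
    then show ?thesis by (rule l2_bound[OF w])
  qed
  then have "h \<in> Hplus 1"
    using h_l2 h_neg by (intro Hplus_1I)
  then show ?thesis using eq by blast
qed

text \<open>
  Injectivity of \<open>L\<^sub>u - \<mu>\<close> off the eigenvalues is completeness. For surjectivity onto the space of
  order \<open>\<sigma> \<le> 0\<close>, whose elements need not be square summable, the singular part is removed first:
  \<open>f0 = g / (k + 1)\<close> lies in the domain, and \<open>g - (L\<^sub>u - \<mu>) f0\<close> is square summable, so that
  \<open>resolvent_L2\<close> applies.
\<close>

lemma Lax_spectrum_eq:
  assumes \<sigma>: "-1 \<le> \<sigma>" "\<sigma> \<le> 0"
  shows "Lax_spectrum \<sigma> u = range (\<lambda>n. complex_of_real (lam n))"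
proof (intro equalityI subsetI)
  fix \<mu> assume "\<mu> \<in> range (\<lambda>n. complex_of_real (lam n))"
  then obtain n where n: "\<mu> = complex_of_real (lam n)" by blast
  define T where "T = (\<lambda>f n. Lax u f n - \<mu> * f n)"
  have "T (f n) = T (\<lambda>k. 0)"
    unfolding T_def Lax_f by (auto simp: n Lax_eq conv_def)
  moreover have "f n \<in> Hplus (1 + \<sigma>)" "(\<lambda>k. 0) \<in> Hplus (1 + \<sigma>)"
    using f_Hplus[of "1 + \<sigma>" n] \<sigma> by (auto simp: Hplus_iff_l2 l2_zero)
  moreover have "f n \<noteq> (\<lambda>k. 0)"
    using ip_f[of n n] by auto
  ultimately have "\<not> inj_on T (Hplus (1 + \<sigma>))"
    by (auto simp: inj_on_def)
  then show "\<mu> \<in> Lax_spectrum \<sigma> u"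
    unfolding Lax_spectrum_def bij_betw_def T_def by blast
next
  fix \<mu> assume spec: "\<mu> \<in> Lax_spectrum \<sigma> u"
  show "\<mu> \<in> range (\<lambda>n. complex_of_real (lam n))"
  proof (rule ccontr)
    assume "\<mu> \<notin> range (\<lambda>n. complex_of_real (lam n))"
    then have \<mu>: "\<mu> \<noteq> complex_of_real (lam n)" for n by blast
    define T where "T = (\<lambda>f n. Lax u f n - \<mu> * f n)"
    have l2: "l2 g" "\<And>k. k < 0 \<Longrightarrow> g k = 0" if "g \<in> Hplus (1 + \<sigma>)" for g
      using Hplus_antimono[OF that, of 0] \<sigma> by (auto simp: Hplus_0_iff)
    have "inj_on T (Hplus (1 + \<sigma>))"
    proof (rule inj_onI)
      fix g h assume g: "g \<in> Hplus (1 + \<sigma>)" and h: "h \<in> Hplus (1 + \<sigma>)" and eq: "T g = T h"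
      define d where "d = (\<lambda>k. g k - h k)"
      have d: "l2 d" "\<And>k. k < 0 \<Longrightarrow> d k = 0"
        unfolding d_def using l2[OF g] l2[OF h] by (auto intro: l2_diff)
      have "Lax u d = (\<lambda>k. \<mu> * d k)"
      proof
        fix k show "Lax u d k = \<mu> * d k"
          using fun_cong[OF eq, of k] by (simp add: T_def d_def Lax_diff algebra_simps)
      qed
      then have "ip d (f n) = 0" for n
        using eigenvector_orthogonal_f[OF d] \<mu> by blast
      then have "d k = 0" for k
        using eq_0_if_orthogonal[of d] d by blast
      then show "g = h" by (auto simp: d_def)
    qed
    moreover have "T g \<in> Hplus \<sigma>" if g: "g \<in> Hplus (1 + \<sigma>)" for g
    proof -
      have "(\<lambda>k. of_int k * g k) \<in> Hplus \<sigma>"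
      proof (rule HplusI[where C = 1])
        show "l2 (\<lambda>k. complex_of_real (jap k powr (1 + \<sigma>)) * g k)"
          using g by (simp add: Hplus_iff_l2)
        fix k
        have "jap k powr \<sigma> * \<bar>real_of_int k\<bar> \<le> jap k powr \<sigma> * jap k"
          by (intro mult_left_mono) (auto simp: jap_def)
        also have "\<dots> = jap k powr (1 + \<sigma>)"
          using jap_ge_1[of k] by (simp add: powr_add mult.commute)
        finally have "(jap k powr \<sigma> * \<bar>real_of_int k\<bar>) * cmod (g k) \<le> jap k powr (1 + \<sigma>) * cmod (g k)"
          by (rule mult_right_mono) auto
        then show "jap k powr \<sigma> * cmod (of_int k * g k) \<le> 1 * cmod (complex_of_real (jap k powr (1 + \<sigma>)) * g k)"
          by (simp add: norm_mult mult_ac)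
      qed (simp add: l2[OF g])
      moreover have "(\<lambda>k. (-1) * (if 0 \<le> k then conv g k else 0)) \<in> Hplus \<sigma>"
      proof (intro Hplus_cmult Hplus_antimono[OF _ \<sigma>(2)])
        have "l2 (\<lambda>k. if 0 \<le> k then conv g k else 0)"
          by (rule l2_bound[OF l2_conv[OF l2(1)[OF g]], of _ 1]) auto
        then show "(\<lambda>k. if 0 \<le> k then conv g k else 0) \<in> Hplus 0" by (simp add: Hplus_0_iff)
      qed
      moreover have "(\<lambda>k. (- \<mu>) * g k) \<in> Hplus \<sigma>"
        using \<sigma> by (intro Hplus_cmult Hplus_antimono[OF g]) auto
      ultimately have "(\<lambda>k. (of_int k * g k + (-1) * (if 0 \<le> k then conv g k else 0)) + (- \<mu>) * g k) \<in> Hplus \<sigma>"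
        by (intro Hplus_add)
      then show ?thesis by (simp add: T_def Lax_eq[abs_def])
    qed
    moreover have "\<exists>w\<in>Hplus (1 + \<sigma>). T w = g" if g: "g \<in> Hplus \<sigma>" for g
    proof -
      have g_neg: "g k = 0" if "k < 0" for k using g that by (auto simp: Hplus_iff_l2)
      define f0 where "f0 = (\<lambda>k. g k / of_int (k + 1))"
      have f0: "f0 \<in> Hplus (1 + \<sigma>)"
      proof (rule HplusI[where C = 1])
        show "l2 (\<lambda>k. complex_of_real (jap k powr \<sigma>) * g k)"
          using g by (simp add: Hplus_iff_l2)
        show "f0 k = 0" if "k < 0" for k using that by (simp add: f0_def g_neg)
        fix k
        show "jap k powr (1 + \<sigma>) * cmod (f0 k) \<le> 1 * cmod (complex_of_real (jap k powr \<sigma>) * g k)"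
        proof (cases "k < 0")
          case False
          have n: "cmod (of_int (k + 1)) = real_of_int (k + 1)"
            using False norm_of_int[of "k + 1", where 'a = complex] by simp
          have "jap k * cmod (f0 k) \<le> real_of_int (k + 1) * cmod (f0 k)"
            using False by (intro mult_right_mono) (auto simp: jap_def)
          also have "\<dots> = cmod (g k)"
            using False unfolding f0_def norm_divide n by simp
          finally have "jap k powr \<sigma> * (jap k * cmod (f0 k)) \<le> jap k powr \<sigma> * cmod (g k)"
            by (rule mult_left_mono) auto
          then show ?thesis
            using jap_ge_1[of k] by (simp add: norm_mult powr_add mult_ac)
        qed (simp add: f0_def g_neg)
      qed
      define g1 where "g1 = (\<lambda>k. g k - T f0 k)"
      have "l2 (\<lambda>k. (1 + \<mu>) * f0 k + conv f0 k)"
        by (intro l2_add l2_cmult l2_conv l2 f0)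
      then have g1: "l2 g1"
      proof (rule l2_bound[where C = 1])
        fix k
        show "cmod (g1 k) \<le> 1 * cmod ((1 + \<mu>) * f0 k + conv f0 k)"
        proof (cases "k < 0")
          case False
          then have "of_int (k + 1) \<noteq> (0::complex)" by (simp only: of_int_eq_0_iff)
          then have "g k = of_int (k + 1) * f0 k" by (simp add: f0_def)
          then have "g1 k = (1 + \<mu>) * f0 k + conv f0 k"
            using False by (simp add: g1_def T_def Lax_eq algebra_simps)
          then show ?thesis by simp
        qed (simp add: g1_def T_def Lax_eq f0_def g_neg)
      qed
      have g1_neg: "g1 k = 0" if "k < 0" for k
        using that by (simp add: g1_def T_def Lax_eq f0_def g_neg)
      obtain h where h: "h \<in> Hplus 1" "\<And>k. Lax u h k - \<mu> * h k = g1 k"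
        using resolvent_L2[OF \<mu> g1 g1_neg] by blast
      have "(\<lambda>k. f0 k + h k) \<in> Hplus (1 + \<sigma>)"
        using \<sigma> by (intro Hplus_add f0 Hplus_antimono[OF h(1)]) auto
      moreover have "T (\<lambda>k. f0 k + h k) = g"
      proof
        fix k show "T (\<lambda>k. f0 k + h k) k = g k"
          using h(2)[of k] by (simp add: T_def g1_def Lax_add algebra_simps)
      qed
      ultimately show ?thesis by blast
    qed
    ultimately have "bij_betw T (Hplus (1 + \<sigma>)) (Hplus \<sigma>)"
      unfolding bij_betw_def by blast
    then show False using spec by (simp add: Lax_spectrum_def T_def)
  qed
qed

lemma Lax_ev_eq:
  assumes "-1 \<le> \<sigma>" "\<sigma> \<le> 0"
  shows "Lax_ev \<sigma> u = lam"
  unfolding Lax_ev_def Lax_spectrum_eq[OF assms]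
proof (rule the_equality)
  fix l :: "nat \<Rightarrow> real"
  assume l: "strict_mono l \<and> range (\<lambda>n. complex_of_real (l n)) = range (\<lambda>n. complex_of_real (lam n))"
  then have "Re ` range (\<lambda>n. complex_of_real (l n)) = Re ` range (\<lambda>n. complex_of_real (lam n))" by simp
  then have "range l = range lam" by (simp add: image_image)
  then show "l = lam"
    using l lam_strict_mono by (intro strict_mono_range_unique) auto
qed (simp add: lam_strict_mono)

text \<open>
  By completeness an eigenvector for \<open>\<lambda>\<^sub>n\<close> is a multiple of \<open>f\<^sub>n\<close>. If it is normalized, the multiplier is
  unimodular, and the sign conditions make it 1, by induction on \<open>n\<close>.
\<close>

lemma Lax_basis_eq:
  assumes \<sigma>: "-1 \<le> \<sigma>" "\<sigma> \<le> 0"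
  shows "Lax_basis \<sigma> u = f"
  unfolding Lax_basis_def Lax_ev_eq[OF assms]
proof (rule the_equality, goal_cases)
  case 1
  have "ip (f n) (mult (mode 1) (f (n - 1))) \<in> \<real> \<and> 0 < Re (ip (f n) (mult (mode 1) (f (n - 1))))"
    if "1 \<le> n" for n
    using f_shift[of "n - 1"] that by simp
  then show ?case
    using orthonormal_basis f_Hplus[of "1 + \<sigma>"] \<sigma> Lax_f f_0_0 by auto
next
  case (2 f')
  have f': "l2 (f' n)" "\<And>k. k < 0 \<Longrightarrow> f' n k = 0" "ip (f' n) (f' n) = 1" for n
    using 2 unfolding orthonormal_basis_L2_plus_def Hplus_0_iff by auto
  define \<alpha> where "\<alpha> = (\<lambda>n. ip (f' n) (f n))"
  have multiple: "f' n = (\<lambda>k. \<alpha> n * f n k)" for n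
  proof
    fix k
    have "ip (f' n) (f m) = 0" if "m \<noteq> n" for m
      by (rule eigenvector_orthogonal_f[OF f'(1,2), of n "complex_of_real (lam n)"])
         (use 2 that in \<open>auto simp: lam_eq_iff\<close>)
    then have "(\<lambda>m. ip (f' n) (f m) * f m k) = (\<lambda>m. if m = n then \<alpha> n * f n k else 0)"
      by (auto simp: \<alpha>_def)
    then have "(\<lambda>m. ip (f' n) (f m) * f m k) sums (\<alpha> n * f n k)"
      using sums_single[of n "\<lambda>_. \<alpha> n * f n k"] by simp
    then show "f' n k = \<alpha> n * f n k"
      using expansion_pointwise[of "f' n" k] f' sums_unique2 by blast
  qed
  have norm_\<alpha>: "cmod (\<alpha> n) = 1" for n
  proof -
    have "1 = cnj (\<alpha> n) * (\<alpha> n * ip (f n) (f n))"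
      using f'(3)[of n] unfolding multiple ip_cmult_left ip_cmult_right by (simp add: mult_ac)
    then have "\<alpha> n * cnj (\<alpha> n) = 1" by (simp add: ip_f mult.commute)
    then have "complex_of_real ((cmod (\<alpha> n))\<^sup>2) = 1" by (simp only: complex_norm_square)
    then have "(cmod (\<alpha> n))\<^sup>2 = 1" by (simp only: of_real_eq_1_iff)
    then show ?thesis using norm_ge_zero[of "\<alpha> n"] by (auto simp: power2_eq_1_iff)
  qed
  have "f' n = f n" for n
  proof (induction n)
    case 0
    have "\<alpha> 0 * ip (f 0) (mode 0) = ip (f' 0) (mode 0)"
      unfolding multiple[of 0] ip_cmult_left ..
    then have "\<alpha> 0 = 1"
      by (rule unimodular_eq_1) (use 2 f_0_0 norm_\<alpha> in auto)
    then show ?case using multiple[of 0] by simp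
  next
    case (Suc n)
    have "\<alpha> (Suc n) * ip (f (Suc n)) (mult (mode 1) (f n)) = ip (f' (Suc n)) (mult (mode 1) (f' n))"
      unfolding multiple[of "Suc n"] ip_cmult_left Suc ..
    moreover have "ip (f' (Suc n)) (mult (mode 1) (f' n)) \<in> \<real>" "0 < Re (ip (f' (Suc n)) (mult (mode 1) (f' n)))"
      using 2 by (metis One_nat_def Suc_le_mono diff_Suc_1 le0)+
    ultimately have "\<alpha> (Suc n) = 1"
      using f_shift[of n] norm_\<alpha> by (intro unimodular_eq_1)
    then show ?case using multiple[of "Suc n"] by simp
  qed
  then show ?case by auto
qed

end

section \<open>Second-order expansion of the Birkhoff coordinates\<close>

lemma prodinf_near_1:
  fixes x :: "nat \<Rightarrow> real"
  assumes x: "\<And>p. \<bar>x p\<bar> \<le> C * (1/2) ^ p" and C: "0 \<le> C" "C \<le> 1/4"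
  shows "\<bar>(\<Prod>p. 1 + x p) - 1\<bar> \<le> 4 * C"
proof -
  have "summable (\<lambda>p. C * (1/2) ^ p)" by (intro summable_mult summable_geometric) auto
  then have s: "summable (\<lambda>p. norm (x p))"
    by (rule summable_comparison_test'[where N = 0]) (use x in auto)
  have "convergent_prod (\<lambda>p. 1 + x p)"
    by (rule abs_convergent_prod_imp_convergent_prod, rule summable_imp_abs_convergent_prod) (use s in simp)
  then have lim: "(\<lambda>N. \<Prod>p\<le>N. 1 + x p) \<longlonglongrightarrow> (\<Prod>p. 1 + x p)"
    by (rule convergent_prod_LIMSEQ)
  have "\<bar>(\<Prod>p\<le>N. 1 + x p) - 1\<bar> \<le> 4 * C" for N
  proof -
    have "\<bar>(\<Prod>p\<le>N. 1 + x p) - 1\<bar> \<le> (\<Prod>p\<le>N. 1 + \<bar>x p\<bar>) - 1"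
      using norm_prod_minus1_le_prod_minus1[of x "{..N}"] by simp
    also have "(\<Prod>p\<le>N. 1 + \<bar>x p\<bar>) \<le> (\<Prod>p\<le>N. exp \<bar>x p\<bar>)"
      by (intro prod_mono) (auto intro: exp_ge_add_one_self)
    also have "\<dots> = exp (\<Sum>p\<le>N. \<bar>x p\<bar>)" by (simp add: exp_sum)
    also have "(\<Sum>p\<le>N. \<bar>x p\<bar>) \<le> (\<Sum>p\<le>N. C * (1/2) ^ p)"
      by (intro sum_mono x)
    also have "(\<Sum>p\<le>N. C * (1/2) ^ p) \<le> (\<Sum>p. C * (1/2) ^ p)"
      using C by (intro sum_le_suminf summable_mult summable_geometric) auto
    also have "(\<Sum>p. C * (1/2) ^ p) = 2 * C"
      using suminf_mult[OF summable_geometric[of "1/2::real"], of C] suminf_geometric[of "1/2::real"] by simp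
    also have "exp (2 * C) \<le> 1 + 2 * C + (2 * C)\<^sup>2"
      using C by (intro exp_bound) auto
    also have "(2 * C)\<^sup>2 \<le> 2 * C"
      using C mult_left_le[of "2 * C" "2 * C"] by (simp add: power2_eq_square)
    finally show ?thesis by simp
  qed
  then show ?thesis
    by (intro LIMSEQ_le_const2[OF tendsto_rabs[OF tendsto_diff[OF lim tendsto_const]]]) auto
qed

lemma inverse_sqrt_near_1:
  assumes "1/2 \<le> (X::real)"
  shows "\<bar>1 / sqrt X - 1\<bar> \<le> \<bar>X - 1\<bar>"
proof -
  have s: "1/2 \<le> sqrt X" using assms by (intro real_le_rsqrt) (simp add: power2_eq_square)
  have "1 \<le> sqrt X * (1 + sqrt X)"
    using s assms by (simp add: distrib_left)
  have "\<bar>1 / sqrt X - 1\<bar> * (sqrt X * (1 + sqrt X)) = \<bar>(1 / sqrt X - 1) * (sqrt X * (1 + sqrt X))\<bar>"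
    using assms by (simp add: abs_mult)
  also have "(1 / sqrt X - 1) * (sqrt X * (1 + sqrt X)) = 1 - sqrt X * sqrt X"
  proof -
    have "(1 / y - 1) * (y * (1 + y)) = 1 - y * y" if "y \<noteq> 0" for y :: real
      using that by (simp add: field_simps)
    from this[of "sqrt X"] show ?thesis using s by fastforce
  qed
  finally have "\<bar>1 / sqrt X - 1\<bar> * (sqrt X * (1 + sqrt X)) = \<bar>X - 1\<bar>"
    using assms by simp
  moreover have "\<bar>1 / sqrt X - 1\<bar> * 1 \<le> \<bar>1 / sqrt X - 1\<bar> * (sqrt X * (1 + sqrt X))"
    using \<open>1 \<le> _\<close> by (intro mult_left_mono) auto
  ultimately show ?thesis by simp
qed

lemma sgn_near_1:
  assumes "a \<noteq> (0::complex)"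
  shows "cmod (sgn a - 1) \<le> 2 * cmod (a - 1)"
proof -
  have "sgn a - a = complex_of_real (1 - cmod a) * sgn a"
    using assms by (simp add: sgn_eq field_simps)
  then have "cmod (sgn a - a) = \<bar>cmod 1 - cmod a\<bar>"
    using assms by (simp add: norm_mult norm_sgn del: of_real_diff)
  also have "\<dots> \<le> cmod (a - 1)"
    using norm_triangle_ineq3[of 1 a] by (simp add: norm_minus_commute)
  finally show ?thesis
    using norm_triangle_ineq[of "sgn a - a" "a - 1"] by simp
qed

text \<open>
  Up to the factor \<open>-1 / sqrt n\<close> this is the second Taylor coefficient of \<open>\<Phi>\<^sub>n\<close> at 0 for potentials
  with frequencies in \<open>{-K..K}\<close>.
\<close>

definition quadratic_term :: "int \<Rightarrow> (int \<Rightarrow> complex) \<Rightarrow> nat \<Rightarrow> complex" where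
  "quadratic_term K u n = (\<Sum>m\<in>{1..K} - {int n}. u m * u (int n - m) / of_int (m - int n))"

context small_potential
begin

text \<open>
  Shifting an eigenvector for \<open>\<lambda>\<^sub>p\<close> gives an eigenvector for \<open>\<lambda>\<^sub>p + 1\<close> up to a multiple of \<open>e\<^sub>0\<close>: the
  Szego projection creates the only defect, at frequency \<open>-1\<close> before the shift. Pairing with
  \<open>F\<^sub>p\<^sub>+\<^sub>1\<close> and using symmetry expresses the gap through that defect. Both factors on the right are
  values far from the main mode, so the gap is exponentially small in \<open>p\<close>.
\<close>

lemma gap_identity:
  "complex_of_real (lam (Suc p) - lam p - 1) * overlap p = - (cnj (conv (F p) (-1)) * F (Suc p) 0)"
proof -
  define g where "g = (\<lambda>k. F p (k - 1))"
  define c where "c = conv (F p) (-1)"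
  have g: "cmod (g k) \<le> 1 * geo (k - (1 + int p))" for k
    using F_bound[of p "k - 1"] by (simp add: g_def algebra_simps)
  have overlap_g: "overlap p = ip (F (Suc p)) g"
    by (simp add: overlap_def g_def)
  have g_neg: "g k = 0" if "k < 1" for k using that by (simp add: g_def F_neg)
  have Lax_g: "Lax u g = (\<lambda>k. complex_of_real (lam p + 1) * g k - c * mode 0 k)"
  proof
    fix k
    have conv_g: "conv g k = conv (F p) (k - 1)"
      by (simp add: conv_def g_def algebra_simps)
    consider "k < 0" | "k = 0" | "k \<ge> 1" by linarith
    then show "Lax u g k = complex_of_real (lam p + 1) * g k - c * mode 0 k"
    proof cases
      case 3
      have "Lax u (F p) (k - 1) = of_int (k - 1) * F p (k - 1) - conv (F p) (k - 1)"
        using 3 by (simp add: Lax_eq)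
      then have "of_int (k - 1) * F p (k - 1) - conv (F p) (k - 1) = lam p * F p (k - 1)"
        unfolding Lax_F by simp
      then show ?thesis
        using 3 by (simp add: Lax_eq conv_g mode_def) (simp add: g_def algebra_simps)
    next
      case 2
      then show ?thesis using conv_g by (simp add: Lax_eq g_neg c_def mode_def)
    qed (simp add: Lax_eq g_neg mode_def)
  qed
  have "ip (Lax u (F (Suc p))) g = ip (F (Suc p)) (Lax u g)"
    by (rule Lax_symmetric) (auto intro: l2_F F_neg l2_geo[OF g] l2_weighted_geo[OF g] g_neg)
  also have "\<dots> = complex_of_real (lam p + 1) * overlap p - cnj c * F (Suc p) 0"
  proof -
    have "l2 (mode 0)" by (rule l2_geo[of _ 1 0]) (auto simp: mode_def geo_pos less_imp_le)
    then show ?thesis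
      unfolding Lax_g
      by (subst ip_diff_right) (auto intro: l2_cmult l2_geo[OF g] l2_F simp: ip_cmult_right ip_mode overlap_g)
  qed
  finally have "lam (Suc p) * overlap p = complex_of_real (lam p + 1) * overlap p - cnj c * F (Suc p) 0"
    unfolding Lax_F ip_cmult_left by (simp add: overlap_def g_def)
  then show ?thesis by (simp add: c_def algebra_simps)
qed

lemma gap_bound: "\<bar>lam (Suc p) - lam p - 1\<bar> \<le> 4 * \<epsilon>\<^sup>2 * (1/2) ^ Suc p"
proof -
  have geo: "geo (- 1 - int p) = (1/2) ^ Suc p" "geo (0 - int (Suc p)) = (1/2) ^ Suc p"
  proof -
    have "nat \<bar>- 1 - int p\<bar> = Suc p" "nat \<bar>0 - int (Suc p)\<bar> = Suc p" by linarith+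
    then show "geo (- 1 - int p) = (1/2) ^ Suc p" "geo (0 - int (Suc p)) = (1/2) ^ Suc p"
      unfolding geo_def by simp_all
  qed
  have "1/2 \<le> cmod (overlap p)"
    using overlap_bound[of p] eps_sq norm_triangle_ineq2[of 1 "1 - overlap p"] by (simp add: norm_minus_commute)
  then have "\<bar>lam (Suc p) - lam p - 1\<bar> * (1/2) \<le> \<bar>lam (Suc p) - lam p - 1\<bar> * cmod (overlap p)"
    by (intro mult_left_mono) auto
  also have "\<dots> = cmod (complex_of_real (lam (Suc p) - lam p - 1) * overlap p)"
    by (simp only: norm_mult norm_of_real)
  also have "\<dots> = cmod (conv (F p) (-1)) * cmod (F (Suc p) 0)"
    unfolding gap_identity by (simp add: norm_mult)
  also have "\<dots> \<le> \<epsilon> * (2 * \<epsilon> * (1/2) ^ Suc p)"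
  proof (rule mult_mono)
    have "cmod (conv (F p) (-1)) \<le> \<epsilon> * 1 * geo (- 1 - int p)"
      by (rule conv_geo) (use F_bound in simp)
    also have "\<dots> \<le> \<epsilon> * 1 * 1"
      using eps_nonneg geo_le_1 by (intro mult_left_mono) auto
    finally show "cmod (conv (F p) (-1)) \<le> \<epsilon>" by simp
    show "cmod (F (Suc p) 0) \<le> 2 * \<epsilon> * (1/2) ^ Suc p"
      using G_bound[of "Suc p" 0] F_off[of 0 "Suc p"] unfolding geo by simp
  qed (use eps_nonneg in auto)
  finally show ?thesis by (simp add: power2_eq_square)
qed

text \<open>
  Summability of the gaps makes the infinite product converge absolutely, with a value
  \<open>1 + O(\<epsilon>\<^sup>2)\<close>. The norm of \<open>F\<^sub>n\<close> is included because it enters the Birkhoff coordinate together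
  with \<open>\<kappa>\<^sub>n\<close>.
\<close>

lemma kappa_near:
  assumes \<sigma>: "-1 \<le> \<sigma>" "\<sigma> \<le> 0" and n: "1 \<le> n"
  shows "\<bar>nsq (F n) * (real n * kappa \<sigma> u n) - 1\<bar> \<le> 100 * \<epsilon>\<^sup>2"
proof -
  define x where "x = (\<lambda>p. if p = 0 \<or> p = n then 0 else - (lam p - lam (p - 1) - 1) / (lam p - lam n))"
  define P where "P = (\<Prod>p. 1 + x p)"
  define b where "b = real n / (lam n - lam 0)"
  have kap: "kappa \<sigma> u n = 1 / (lam n - lam 0) * P"
  proof -
    have "(\<lambda>p. if p = 0 \<or> p = n then 1 else 1 - gap \<sigma> u p / (Lax_ev \<sigma> u p - Lax_ev \<sigma> u n)) = (\<lambda>p. 1 + x p)"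
      by (auto simp: x_def gap_def Lax_ev_eq[OF \<sigma>] diff_conv_add_uminus minus_divide_left simp del: add_uminus_conv_diff)
    then show ?thesis by (simp only: kappa_def P_def Lax_ev_eq[OF \<sigma>])
  qed
  have "\<bar>x p\<bar> \<le> 8 * \<epsilon>\<^sup>2 * (1/2) ^ p" for p
  proof (cases "p = 0 \<or> p = n")
    case False
    then obtain r where r: "p = Suc r" by (cases p) auto
    have "1/2 \<le> \<bar>lam p - lam n\<bar>"
    proof -
      have "1 \<le> \<bar>real p - real n\<bar>" using False by linarith
      then show ?thesis using lam_diff[of p n] eps_sq by linarith
    qed
    then have "\<bar>lam p - lam (p - 1) - 1\<bar> / \<bar>lam p - lam n\<bar> \<le> (4 * \<epsilon>\<^sup>2 * (1/2) ^ p) / (1/2)"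
      using gap_bound[of r] r by (intro frac_le) auto
    moreover have "\<bar>x p\<bar> = \<bar>lam p - lam (p - 1) - 1\<bar> / \<bar>lam p - lam n\<bar>"
      using False by (simp only: x_def abs_divide abs_minus_cancel if_False)
    ultimately show ?thesis by simp
  qed (simp add: x_def)
  then have P: "\<bar>P - 1\<bar> \<le> 4 * (8 * \<epsilon>\<^sup>2)"
    unfolding P_def by (rule prodinf_near_1) (use eps_sq in auto)
  have ln: "1/2 \<le> lam n - lam 0" "\<bar>real n - (lam n - lam 0)\<bar> \<le> 4 * \<epsilon>\<^sup>2"
    using lam_diff[of n 0] n eps_sq by (auto simp: abs_le_iff)
  have "b - 1 = (real n - (lam n - lam 0)) / (lam n - lam 0)"
    using ln by (simp add: b_def field_simps)
  then have "\<bar>b - 1\<bar> = \<bar>real n - (lam n - lam 0)\<bar> / (lam n - lam 0)"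
    using ln(1) by (simp add: abs_divide)
  also have "\<dots> \<le> (4 * \<epsilon>\<^sup>2) / (1/2)"
    using ln by (intro frac_le) auto
  finally have b: "\<bar>b - 1\<bar> \<le> 8 * \<epsilon>\<^sup>2" by simp
  define a where "a = nsq (F n)"
  have a: "\<bar>a - 1\<bar> \<le> 12 * \<epsilon>\<^sup>2" using nsq_F[of n] by (simp add: a_def)
  have "a * (b * P) - 1 = (a - 1) * (b * P) + ((b - 1) * P + (P - 1))"
    by (simp add: algebra_simps)
  also have "\<bar>\<dots>\<bar> \<le> \<bar>a - 1\<bar> * (\<bar>b\<bar> * \<bar>P\<bar>) + (\<bar>b - 1\<bar> * \<bar>P\<bar> + \<bar>P - 1\<bar>)"
    unfolding abs_mult[symmetric] by linarith
  also have "\<dots> \<le> 12 * \<epsilon>\<^sup>2 * (2 * 2) + (8 * \<epsilon>\<^sup>2 * 2 + 4 * (8 * \<epsilon>\<^sup>2))"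
    using a b P eps_sq by (intro add_mono mult_mono) auto
  also have "\<dots> \<le> 100 * \<epsilon>\<^sup>2" by simp
  finally show ?thesis by (simp add: kap a_def b_def)
qed

lemma phase_near: "cmod (phase n - 1) \<le> 24 * \<epsilon>\<^sup>2 * real n"
proof (induction n)
  case (Suc n)
  have "phase (Suc n) - 1 = (phase n - 1) * cnj (sgn (overlap n)) + cnj (sgn (overlap n) - 1)"
    by (simp add: algebra_simps)
  also have "cmod \<dots> \<le> cmod (phase n - 1) * 1 + cmod (sgn (overlap n) - 1)"
    by (rule order_trans[OF norm_triangle_ineq])
       (simp add: norm_mult norm_sgn overlap_nz complex_mod_cnj del: complex_cnj_diff)
  also have "cmod (sgn (overlap n) - 1) \<le> 24 * \<epsilon>\<^sup>2"
    using sgn_near_1[OF overlap_nz, of n] overlap_bound[of n] by linarith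
  finally show ?case using Suc by (simp add: algebra_simps)
qed simp

lemma G_first_order:
  assumes "0 \<le> m" "m \<noteq> int n"
  shows "cmod (G n m - u (m - int n) / of_int (m - int n)) \<le> 3 * \<epsilon>\<^sup>2"
proof -
  define d where "d = (of_int (m - int n) :: complex)"
  have d: "1 \<le> cmod d" using assms(2) unfolding d_def norm_of_int by simp
  have "conv (F n) m = u (m - int n) + conv (G n) m"
    unfolding F_def[abs_def] conv_add conv_mode ..
  then have "d * G n m = u (m - int n) + conv (G n) m - \<delta> n * G n m"
    using G_eq[OF assms] by (simp add: d_def algebra_simps)
  moreover have "d \<noteq> 0" using d by auto
  ultimately have "G n m - u (m - int n) / d = (conv (G n) m - \<delta> n * G n m) / d"
    by (simp add: field_simps)
  then have "cmod (G n m - u (m - int n) / d) = cmod (conv (G n) m - \<delta> n * G n m) / cmod d"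
    by (simp add: norm_divide)
  also have "\<dots> \<le> cmod (conv (G n) m - \<delta> n * G n m) / 1"
    using d by (intro divide_left_mono) auto
  also have "\<dots> \<le> cmod (conv (G n) m) + cmod (\<delta> n) * cmod (G n m)"
    using norm_triangle_ineq4[of "conv (G n) m" "\<delta> n * G n m"] by (simp add: norm_mult)
  also have "\<dots> \<le> 2 * \<epsilon>\<^sup>2 + 2 * \<epsilon>\<^sup>2 * (1/2)"
  proof (intro add_mono mult_mono)
    show "cmod (conv (G n) m) \<le> 2 * \<epsilon>\<^sup>2" by (rule corrector_bounds(5)[OF corrector_G])
    have "cmod (G n m) \<le> 2 * \<epsilon> * 1"
      using G_bound[of n m] geo_le_1[of "m - int n"] eps_nonneg
      by (meson mult_left_mono order_trans mult_nonneg_nonneg zero_le_numeral)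
    then show "cmod (G n m) \<le> 1/2" using eps by simp
  qed (use \<delta>_bound in auto)
  finally show ?thesis by (simp add: d_def)
qed

text \<open>
  The zeroth component of the eigenvalue equation reads
  \<open>- n G\<^sub>n(0) = u\<^sub>-\<^sub>n + conv G\<^sub>n 0 - \<delta>\<^sub>n G\<^sub>n(0)\<close>. The last term is cubic, and inserting the first-order
  approximation of \<open>G\<^sub>n\<close> into the convolution produces the quadratic term.
\<close>

lemma F_0_expansion:
  assumes "1 \<le> n"
  shows "cmod (of_nat n * cnj (F n 0) + (u (int n) + quadratic_term K u n)) \<le> 7 * \<epsilon> ^ 3"
proof -
  define M where "M = {1..K} - {int n}"
  define q where "q = (\<Sum>m\<in>M. u (- m) * (u (m - int n) / of_int (m - int n)))"
  have "conv (G n) 0 = (\<Sum>m\<in>{-K..K}. u (- m) * G n m)"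
    unfolding conv_def by (rule sum.reindex_bij_witness[where i = uminus and j = uminus]) auto
  also have "\<dots> = (\<Sum>m\<in>M. u (- m) * G n m)"
  proof (rule sum.mono_neutral_right)
    show "\<forall>m\<in>{-K..K} - M. u (- m) * G n m = 0"
    proof
      fix m assume "m \<in> {-K..K} - M"
      then have "m < 0 \<or> m = 0 \<or> m = int n" unfolding M_def by simp linarith
      then show "u (- m) * G n m = 0"
        using corrector_bounds(3)[OF corrector_G, of m n] G_diag[of n] u_0 by (elim disjE) simp_all
    qed
  qed (auto simp: M_def)
  finally have "conv (G n) 0 - q = (\<Sum>m\<in>M. u (- m) * (G n m - u (m - int n) / of_int (m - int n)))"
    by (simp add: q_def sum_subtractf right_diff_distrib)
  also have "cmod \<dots> \<le> (\<Sum>m\<in>M. cmod (u m) * (3 * \<epsilon>\<^sup>2))"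
  proof (rule sum_norm_le)
    fix m assume "m \<in> M"
    then have "cmod (G n m - u (m - int n) / of_int (m - int n)) \<le> 3 * \<epsilon>\<^sup>2"
      by (intro G_first_order) (auto simp: M_def)
    then show "cmod (u (- m) * (G n m - u (m - int n) / of_int (m - int n))) \<le> cmod (u m) * (3 * \<epsilon>\<^sup>2)"
      unfolding norm_mult u_minus complex_mod_cnj by (rule mult_left_mono) simp
  qed
  also have "\<dots> \<le> (\<Sum>m\<in>{-K..K}. cmod (u m) * (3 * \<epsilon>\<^sup>2))"
    by (rule sum_mono2) (auto simp: M_def)
  also have "\<dots> = (\<Sum>m\<in>{-K..K}. cmod (u m)) * (3 * \<epsilon>\<^sup>2)"
    by (rule sum_distrib_right[symmetric])
  also have "\<dots> \<le> \<epsilon> * (3 * \<epsilon>\<^sup>2)"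
    by (intro mult_right_mono sum_u_le) auto
  finally have q: "cmod (conv (G n) 0 - q) \<le> 3 * \<epsilon> ^ 3"
    by (simp add: power2_eq_square power3_eq_cube)
  have n: "(0::int) \<noteq> int n" using assms by simp
  have "conv (F n) 0 = u (- int n) + conv (G n) 0"
    unfolding F_def[abs_def] conv_add conv_mode by simp
  then have eq: "of_nat n * G n 0 + (u (- int n) + q) = \<delta> n * G n 0 - (conv (G n) 0 - q)"
    using G_eq[OF _ n] by (simp add: algebra_simps)
  have "cmod (of_nat n * G n 0 + (u (- int n) + q)) \<le> cmod (\<delta> n) * cmod (G n 0) + 3 * \<epsilon> ^ 3"
    unfolding eq using norm_triangle_ineq4[of "\<delta> n * G n 0" "conv (G n) 0 - q"] q by (simp add: norm_mult)
  also have "cmod (\<delta> n) * cmod (G n 0) \<le> (2 * \<epsilon>\<^sup>2) * (2 * \<epsilon>)"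
  proof (intro mult_mono \<delta>_bound)
    show "cmod (G n 0) \<le> 2 * \<epsilon>"
      using G_bound[of n 0] mult_left_mono[OF geo_le_1[of "0 - int n"], of "2 * \<epsilon>"] eps_nonneg by simp
  qed auto
  finally have "cmod (of_nat n * G n 0 + (u (- int n) + q)) \<le> 7 * \<epsilon> ^ 3"
    by (simp add: power2_eq_square power3_eq_cube)
  moreover have "of_nat n * cnj (F n 0) + (u (int n) + quadratic_term K u n) = cnj (of_nat n * G n 0 + (u (- int n) + q))"
  proof -
    have "cnj q = quadratic_term K u n"
      unfolding q_def quadratic_term_def M_def cnj_sum
    proof (intro sum.cong refl)
      fix m
      have "cnj (u (m - int n)) = u (int n - m)" using u_minus[of "m - int n"] by simp
      then show "cnj (u (- m) * (u (m - int n) / of_int (m - int n))) = u m * u (int n - m) / of_int (m - int n)"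
        by (simp add: u_minus)
    qed
    then show ?thesis using F_off[OF n] by (simp add: u_minus)
  qed
  ultimately show ?thesis by (simp only: complex_mod_cnj)
qed

text \<open>
  The Birkhoff coordinate is \<open>sqrt n\<close> times the conjugate of \<open>F\<^sub>n(0)\<close> times a factor \<open>w\<close>, which
  collects the phase, the norm of \<open>F\<^sub>n\<close> and \<open>\<kappa>\<^sub>n\<close>, and satisfies \<open>w = 1 + O(\<epsilon>\<^sup>2)\<close>.
\<close>

lemma Birkhoff_pos_expansion:
  assumes \<sigma>: "-1 \<le> \<sigma>" "\<sigma> \<le> 0" and n: "1 \<le> n"
  shows "cmod (Birkhoff_pos \<sigma> u n + (u (int n) + quadratic_term K u n) / sqrt n)
    \<le> (7 + 2 * sqrt n * (48 * n + 100)) * \<epsilon> ^ 3"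
proof -
  define X where "X = nsq (F n) * (real n * kappa \<sigma> u n)"
  have X: "\<bar>X - 1\<bar> \<le> 100 * \<epsilon>\<^sup>2" unfolding X_def by (rule kappa_near[OF assms])
  then have X2: "1/2 \<le> X" using eps_sq by (simp add: abs_le_iff)
  have sX: "1/2 \<le> sqrt X" using X2 by (intro real_le_rsqrt) (simp add: power2_eq_square)
  have nsq: "0 < nsq (F n)" using nsq_F(1)[of n] by simp
  have n0: "0 < sqrt n" using n by simp
  define w where "w = cnj (phase n) / complex_of_real (sqrt X)"
  have "sqrt X = sqrt (nsq (F n)) * (sqrt n * sqrt (kappa \<sigma> u n))"
    by (simp add: X_def real_sqrt_mult)
  then have "Birkhoff_pos \<sigma> u n = sqrt n * cnj (F n 0) * w"
    using n0 sX
    by (auto simp: Birkhoff_pos_def Lax_basis_eq[OF \<sigma>] w_def f_def z_def ip_cnj[of "mode 0"] ip_mode field_simps)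
  then have "Birkhoff_pos \<sigma> u n - sqrt n * cnj (F n 0) = sqrt n * cnj (F n 0) * (w - 1)"
    by (simp add: algebra_simps)
  then have "cmod (Birkhoff_pos \<sigma> u n - sqrt n * cnj (F n 0)) = sqrt n * cmod (F n 0) * cmod (w - 1)"
    by (simp add: norm_mult)
  also have "\<dots> \<le> sqrt n * (2 * \<epsilon>) * ((48 * n + 100) * \<epsilon>\<^sup>2)"
  proof (intro mult_mono)
    have "cmod (F n 0) \<le> 2 * \<epsilon> * geo (0 - int n)"
      using G_bound[of n 0] F_off[of 0 n] n by simp
    then show "cmod (F n 0) \<le> 2 * \<epsilon>"
      using mult_left_mono[OF geo_le_1[of "0 - int n"], of "2 * \<epsilon>"] eps_nonneg by simp
    have "w - 1 = cnj (phase n - 1) * complex_of_real (1 / sqrt X) + complex_of_real (1 / sqrt X - 1)"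
      by (simp add: w_def algebra_simps)
    then have "cmod (w - 1) \<le> cmod (phase n - 1) * \<bar>1 / sqrt X\<bar> + \<bar>1 / sqrt X - 1\<bar>"
      by (metis norm_triangle_ineq norm_mult norm_of_real complex_mod_cnj)
    also have "\<dots> \<le> (24 * \<epsilon>\<^sup>2 * real n) * 2 + 100 * \<epsilon>\<^sup>2"
    proof (intro add_mono mult_mono phase_near)
      show "\<bar>1 / sqrt X\<bar> \<le> 2" using sX frac_le[of 1 1 "1/2" "sqrt X"] by simp
      show "\<bar>1 / sqrt X - 1\<bar> \<le> 100 * \<epsilon>\<^sup>2" using inverse_sqrt_near_1[OF X2] X by linarith
    qed auto
    finally show "cmod (w - 1) \<le> (48 * n + 100) * \<epsilon>\<^sup>2" by (simp add: algebra_simps)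
  qed (use eps_nonneg in auto)
  also have "\<dots> = 2 * sqrt n * (48 * n + 100) * \<epsilon> ^ 3"
    by (simp add: power2_eq_square power3_eq_cube)
  finally have 1: "cmod (Birkhoff_pos \<sigma> u n - sqrt n * cnj (F n 0)) \<le> 2 * sqrt n * (48 * n + 100) * \<epsilon> ^ 3" .
  have "sqrt n * cnj (F n 0) + (u (int n) + quadratic_term K u n) / sqrt n
      = (of_nat n * cnj (F n 0) + (u (int n) + quadratic_term K u n)) / sqrt n"
  proof -
    have "complex_of_real (sqrt n) * complex_of_real (sqrt n) = of_nat n"
      by (simp flip: of_real_mult)
    then show ?thesis using n0 by (simp add: field_simps)
  qed
  then have "cmod (sqrt n * cnj (F n 0) + (u (int n) + quadratic_term K u n) / sqrt n)
      = cmod (of_nat n * cnj (F n 0) + (u (int n) + quadratic_term K u n)) / sqrt n"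
    by (simp add: norm_divide)
  also have "\<dots> \<le> (7 * \<epsilon> ^ 3) / 1"
    using n F_0_expansion[OF n] eps_nonneg by (intro frac_le) auto
  finally have 2: "cmod (sqrt n * cnj (F n 0) + (u (int n) + quadratic_term K u n) / sqrt n) \<le> 7 * \<epsilon> ^ 3" by simp
  have "Birkhoff_pos \<sigma> u n + (u (int n) + quadratic_term K u n) / sqrt n
     = (Birkhoff_pos \<sigma> u n - sqrt n * cnj (F n 0)) + (sqrt n * cnj (F n 0) + (u (int n) + quadratic_term K u n) / sqrt n)"
    by simp
  also have "cmod \<dots> \<le> 2 * sqrt n * (48 * n + 100) * \<epsilon> ^ 3 + 7 * \<epsilon> ^ 3"
    by (rule norm_triangle_le[OF add_mono[OF 1 2]])
  finally show ?thesis by (simp add: algebra_simps)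
qed

end

section \<open>Taylor coefficients of an analytic extension\<close>

text \<open>
  The real-valued trigonometric polynomials of mean zero and degree at most \<open>K\<close>.
\<close>

definition trig_poly :: "int \<Rightarrow> (int \<Rightarrow> complex) \<Rightarrow> bool" where
  "trig_poly K h \<longleftrightarrow> (\<forall>k. K < \<bar>k\<bar> \<longrightarrow> h k = 0) \<and> h 0 = 0 \<and> (\<forall>k. h (- k) = cnj (h k))"

lemma trig_poly_summable:
  assumes "trig_poly K h"
  shows "(\<lambda>k. w k * (cmod (h k))\<^sup>2) summable_on UNIV"
    and "(\<Sum>\<^sub>\<infinity>k. w k * (cmod (h k))\<^sup>2) = (\<Sum>k\<in>{-K..K}. w k * (cmod (h k))\<^sup>2)"
proof -
  have z: "w k * (cmod (h k))\<^sup>2 = 0" if "k \<in> UNIV - {-K..K}" for k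
    using assms that by (auto simp: trig_poly_def abs_le_iff not_le)
  then show "(\<lambda>k. w k * (cmod (h k))\<^sup>2) summable_on UNIV"
    by (subst summable_on_cong_neutral[where T = "{-K..K}" and g = "\<lambda>k. w k * (cmod (h k))\<^sup>2"]) auto
  show "(\<Sum>\<^sub>\<infinity>k. w k * (cmod (h k))\<^sup>2) = (\<Sum>k\<in>{-K..K}. w k * (cmod (h k))\<^sup>2)"
    by (subst infsum_cong_neutral[where T = "{-K..K}" and g = "\<lambda>k. w k * (cmod (h k))\<^sup>2"]) (use z in auto)
qed

lemma trig_poly_Hr0:
  assumes "trig_poly K h"
  shows "h \<in> Hr0 s" "h \<in> Hr0_log \<beta>"
  using assms trig_poly_summable(1)[OF assms]
  by (auto simp: Hr0_def Hc_def Hr0_log_def trig_poly_def)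

lemma trig_poly_scale: "trig_poly K h \<Longrightarrow> trig_poly K (\<lambda>k. complex_of_real t * h k)"
  by (simp add: trig_poly_def)

lemma quadratic_term_scale:
  "quadratic_term K (\<lambda>k. complex_of_real t * h k) n = complex_of_real (t\<^sup>2) * quadratic_term K h n"
  unfolding quadratic_term_def sum_distrib_left
  by (intro sum.cong) (auto simp: power2_eq_square)

text \<open>
  Along a ray \<open>t h\<close> the smallness parameter is a multiple of \<open>t\<close>. The constant may depend on \<open>h\<close> and
  \<open>n\<close>, since only a Taylor coefficient is to be identified.
\<close>

lemma Birkhoff_pos_second_order:
  assumes h: "trig_poly K h" and \<sigma>: "-1 \<le> \<sigma>" "\<sigma> \<le> 0" and n: "1 \<le> n"
  shows "\<exists>R>0. \<exists>C. \<forall>t. 0 < t \<and> t < R \<longrightarrow>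
    cmod (Birkhoff_pos \<sigma> (\<lambda>k. complex_of_real t * h k) n
      - (complex_of_real t * (- h (int n) / sqrt n) + complex_of_real (t\<^sup>2) * (- quadratic_term K h n / sqrt n)))
    \<le> C * t ^ 3"
proof -
  define W where "W = (\<Sum>k\<in>{-K..K}. cmod (h k) * 2 ^ nat \<bar>k\<bar>)"
  have W: "0 \<le> W" unfolding W_def by (intro sum_nonneg) auto
  define R where "R = 1 / (200 * (W + 1))"
  have "0 < R" using W by (simp add: R_def)
  moreover have "cmod (Birkhoff_pos \<sigma> (\<lambda>k. complex_of_real t * h k) n
      - (complex_of_real t * (- h (int n) / sqrt n) + complex_of_real (t\<^sup>2) * (- quadratic_term K h n / sqrt n)))
    \<le> ((7 + 2 * sqrt n * (48 * n + 100)) * W ^ 3) * t ^ 3" if t: "0 < t" "t < R" for t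
  proof -
    interpret small_potential "\<lambda>k. complex_of_real t * h k" K "t * W"
    proof
      have "t * W \<le> R * (W + 1)" using t W by (intro mult_mono) auto
      also have "\<dots> = 1/200" using W by (simp add: R_def)
      finally show "t * W \<le> 1/200" .
      show "(\<Sum>k\<in>{-K..K}. cmod (complex_of_real t * h k) * 2 ^ nat \<bar>k\<bar>) \<le> t * W"
        unfolding W_def sum_distrib_left using t by (intro sum_mono) (simp add: norm_mult)
    qed (use h in \<open>auto simp: trig_poly_def\<close>)
    define B where "B = Birkhoff_pos \<sigma> (\<lambda>k. complex_of_real t * h k) n"
    have "B - (complex_of_real t * (- h (int n) / sqrt n) + complex_of_real (t\<^sup>2) * (- quadratic_term K h n / sqrt n))
        = B + (complex_of_real t * h (int n) + complex_of_real (t\<^sup>2) * quadratic_term K h n) / sqrt n"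
      by (simp add: add_divide_distrib)
    moreover have "cmod (B + (complex_of_real t * h (int n) + complex_of_real (t\<^sup>2) * quadratic_term K h n) / sqrt n)
        \<le> (7 + 2 * sqrt n * (48 * n + 100)) * (t * W) ^ 3"
      using Birkhoff_pos_expansion[OF \<sigma> n] unfolding quadratic_term_scale B_def by simp
    moreover have "(7 + 2 * sqrt n * (48 * n + 100)) * (t * W) ^ 3
        = ((7 + 2 * sqrt n * (48 * n + 100)) * W ^ 3) * t ^ 3"
      by (simp add: power_mult_distrib)
    ultimately show ?thesis unfolding B_def by (simp only:)
  qed
  ultimately show ?thesis by blast
qed

lemma zero_if_norm_le_mult:
  fixes x :: "'a::real_normed_vector"
  assumes "0 < R" "\<And>t. 0 < t \<Longrightarrow> t < R \<Longrightarrow> norm x \<le> t * B"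
  shows "x = 0"
proof -
  have "((\<lambda>t. t * B) \<longlongrightarrow> 0 * B) (at_right 0)"
    by (intro tendsto_intros)
  moreover have "eventually (\<lambda>t. norm x \<le> t * B) (at_right 0)"
    using assms by (auto simp: eventually_at_right intro!: exI[of _ R])
  ultimately have "norm x \<le> 0 * B"
    by (rule tendsto_lowerbound) simp
  then show ?thesis by simp
qed

lemma quadratic_coefficient_zero:
  fixes a b c :: complex
  assumes R: "0 < R" and bound: "\<And>t. 0 < t \<Longrightarrow> t < R \<Longrightarrow>
      cmod (a + complex_of_real t * b + complex_of_real (t\<^sup>2) * c) \<le> E * t ^ 3"
  shows "c = 0"
proof -
  have a: "a = 0"
  proof (rule zero_if_norm_le_mult[OF R])
    fix t :: real assume t: "0 < t" "t < R"
    define v where "v = a + complex_of_real t * b + complex_of_real (t\<^sup>2) * c"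
    have "a = v - complex_of_real t * (b + complex_of_real t * c)"
      by (simp add: v_def power2_eq_square algebra_simps)
    then have "cmod a \<le> cmod v + cmod (complex_of_real t * (b + complex_of_real t * c))"
      using norm_triangle_ineq4 by metis
    then have "cmod a \<le> E * t ^ 3 + t * cmod (b + complex_of_real t * c)"
      using bound[OF t, folded v_def] t by (simp add: norm_mult)
    also have "cmod (b + complex_of_real t * c) \<le> cmod b + R * cmod c"
      using t by (intro order_trans[OF norm_triangle_ineq] add_mono) (auto simp: norm_mult intro!: mult_right_mono)
    also have "E * t ^ 3 \<le> t * (\<bar>E\<bar> * R\<^sup>2)"
    proof -
      have "E * t ^ 3 \<le> \<bar>E\<bar> * (t * R\<^sup>2)"
        using t by (intro mult_mono) (auto simp: power3_eq_cube power2_eq_square mult.assoc intro!: mult_mono)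
      then show ?thesis by (simp add: mult_ac)
    qed
    finally show "cmod a \<le> t * (\<bar>E\<bar> * R\<^sup>2 + (cmod b + R * cmod c))"
      using t by (simp add: distrib_left)
  qed
  have b: "b = 0"
  proof (rule zero_if_norm_le_mult[OF R])
    fix t :: real assume t: "0 < t" "t < R"
    have "t * cmod (b + complex_of_real t * c) = cmod (a + complex_of_real t * b + complex_of_real (t\<^sup>2) * c)"
    proof -
      have "a + complex_of_real t * b + complex_of_real (t\<^sup>2) * c = complex_of_real t * (b + complex_of_real t * c)"
        by (simp add: a power2_eq_square algebra_simps)
      then show ?thesis using t by (simp add: norm_mult)
    qed
    also have "\<dots> \<le> t * (E * t\<^sup>2)" using bound[OF t] by (simp add: power3_eq_cube power2_eq_square mult_ac)
    finally have "cmod (b + complex_of_real t * c) \<le> E * t\<^sup>2" using t by simp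
    then have "cmod b \<le> E * t\<^sup>2 + t * cmod c"
      using norm_triangle_ineq4[of "b + complex_of_real t * c" "complex_of_real t * c"] t by (simp add: norm_mult)
    also have "E * t\<^sup>2 \<le> t * (\<bar>E\<bar> * R)"
    proof -
      have "E * t\<^sup>2 \<le> \<bar>E\<bar> * (t * R)"
        using t by (intro mult_mono) (auto simp: power2_eq_square)
      then show ?thesis by (simp add: mult_ac)
    qed
    finally show "cmod b \<le> t * (\<bar>E\<bar> * R + cmod c)" by (simp add: distrib_left)
  qed
  show ?thesis
  proof (rule zero_if_norm_le_mult[OF R])
    fix t :: real assume t: "0 < t" "t < R"
    have "t\<^sup>2 * cmod c \<le> t\<^sup>2 * (t * E)"
      using bound[OF t] t by (simp add: a b norm_mult power3_eq_cube power2_eq_square mult_ac)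
    then show "cmod c \<le> t * E" using t by simp
  qed
qed

text \<open>
  The power series agrees with its quadratic Taylor polynomial up to \<open>O(t\<^sup>3)\<close>, and two
  quadratic polynomials that differ by \<open>O(t\<^sup>3)\<close> coincide.
\<close>

lemma second_coefficient_unique:
  fixes y :: "nat \<Rightarrow> complex" and \<phi> :: "real \<Rightarrow> complex"
  assumes R: "0 < R"
    and summ: "summable (\<lambda>k. cmod (y k) * R ^ k)"
    and sums: "\<And>t. 0 < t \<Longrightarrow> t < R \<Longrightarrow> (\<lambda>k. complex_of_real (t ^ k) * y k) sums \<phi> t"
    and bound: "\<And>t. 0 < t \<Longrightarrow> t < R \<Longrightarrow>
      cmod (\<phi> t - (complex_of_real t * b + complex_of_real (t\<^sup>2) * c)) \<le> C * t ^ 3"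
  shows "y 2 = c"
proof -
  define D where "D = (\<Sum>k. cmod (y (k + 3)) * R ^ k)"
  have summ3: "summable (\<lambda>k. cmod (y (k + 3)) * R ^ k)"
  proof -
    have "summable (\<lambda>k. (1 / R ^ 3) * (cmod (y (k + 3)) * R ^ (k + 3)))"
      using summ by (intro summable_mult) (subst summable_iff_shift)
    then show ?thesis using R by (simp add: power_add)
  qed
  have "y 2 - c = 0"
  proof (rule quadratic_coefficient_zero[OF R])
    fix t :: real assume t: "0 < t" "t < R"
    have "(\<lambda>k. complex_of_real (t ^ (k + 3)) * y (k + 3)) sums (\<phi> t - (\<Sum>k<3. complex_of_real (t ^ k) * y k))"
      using sums[OF t] by (subst sums_iff_shift) simp
    then have tail: "(\<lambda>k. complex_of_real (t ^ (k + 3)) * y (k + 3)) sums (\<phi> t - (y 0 + complex_of_real t * y 1 + complex_of_real (t\<^sup>2) * y 2))"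
      by (simp add: numeral_3_eq_3 numeral_2_eq_2)
    have le: "cmod (complex_of_real (t ^ (k + 3)) * y (k + 3)) \<le> t ^ 3 * (cmod (y (k + 3)) * R ^ k)" for k
    proof -
      have "t ^ k \<le> R ^ k" using t by (intro power_mono) auto
      then have "t ^ 3 * (t ^ k * cmod (y (k + 3))) \<le> t ^ 3 * (R ^ k * cmod (y (k + 3)))"
        using t by (intro mult_left_mono mult_right_mono) auto
      then show ?thesis using t by (simp add: norm_mult norm_power power_add mult_ac)
    qed
    have "cmod (\<Sum>k. complex_of_real (t ^ (k + 3)) * y (k + 3)) \<le> (\<Sum>k. t ^ 3 * (cmod (y (k + 3)) * R ^ k))"
      by (rule norm_suminf_le) (use le summ3 in \<open>auto intro: summable_mult\<close>)
    also have "\<dots> = t ^ 3 * D" unfolding D_def by (rule suminf_mult[OF summ3])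
    finally have "cmod (\<phi> t - (y 0 + complex_of_real t * y 1 + complex_of_real (t\<^sup>2) * y 2)) \<le> t ^ 3 * D"
      using tail by (simp only: sums_iff)
    moreover have "y 0 + complex_of_real t * (y 1 - b) + complex_of_real (t\<^sup>2) * (y 2 - c)
        = (\<phi> t - (complex_of_real t * b + complex_of_real (t\<^sup>2) * c))
          - (\<phi> t - (y 0 + complex_of_real t * y 1 + complex_of_real (t\<^sup>2) * y 2))"
      by (simp add: algebra_simps)
    ultimately show "cmod (y 0 + complex_of_real t * (y 1 - b) + complex_of_real (t\<^sup>2) * (y 2 - c)) \<le> (C + D) * t ^ 3"
      using bound[OF t] norm_triangle_ineq4 order_trans
      by (smt (verit) distrib_right mult.commute)
  qed
  then show ?thesis by simp
qed

text \<open>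
  Homogeneity of the diagonal, obtained by scaling one argument after the other.
\<close>

lemma multilinear_replicate_scaleR:
  assumes "multilinear_bounded k C A"
  shows "A (replicate k (t *\<^sub>R x)) = t ^ k *\<^sub>R A (replicate k x)"
proof -
  have "A (replicate j (t *\<^sub>R x) @ replicate (k - j) x) = t ^ j *\<^sub>R A (replicate k x)" if "j \<le> k" for j
    using that
  proof (induction j)
    case (Suc j)
    define xs where "xs = replicate j (t *\<^sub>R x) @ replicate (k - j) x"
    have split: "replicate (k - j) x = x # replicate (k - Suc j) x"
      using Suc.prems by (metis Suc_diff_Suc Suc_le_lessD replicate_Suc)
    have upd: "xs[j := v] = replicate j (t *\<^sub>R x) @ v # replicate (k - Suc j) x" for v
      unfolding xs_def split by (simp add: list_update_append)
    have "linear (\<lambda>v. A (xs[j := v]))"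
      using assms Suc.prems unfolding multilinear_bounded_def xs_def by simp
    then have "A (xs[j := t *\<^sub>R x]) = t *\<^sub>R A (xs[j := x])"
      by (rule linear_scale)
    moreover have "xs[j := t *\<^sub>R x] = replicate (Suc j) (t *\<^sub>R x) @ replicate (k - Suc j) x"
      unfolding upd by (simp add: replicate_append_same[symmetric])
    moreover have "xs[j := x] = xs"
      unfolding upd by (simp add: xs_def split)
    ultimately show ?case using Suc by (simp add: xs_def)
  qed simp
  from this[of k] show ?thesis by simp
qed

lemma norm_h_zero_log_sq:
  "(norm x)\<^sup>2 = (\<Sum>\<^sub>\<infinity>n. log_weight 0 n * (cmod (entry x n))\<^sup>2)"
  using inner_ge_zero[of x]
  by (simp add: norm_h_zero_log_def inner_h_zero_log.rep_eq ip_log_self)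

lemma norm_H_mhalf_log_sq:
  "(norm x)\<^sup>2 = (\<Sum>\<^sub>\<infinity>n. log_weight (- 1/2) n * (cmod (fourier_coeff x n))\<^sup>2)"
  using inner_ge_zero[of x]
  by (simp add: norm_H_mhalf_log_def inner_H_mhalf_log.rep_eq ip_log_self)

lemma sum_entry_le_norm:
  assumes "finite J"
  shows "(\<Sum>n\<in>J. log_weight 0 n * (cmod (entry x n))\<^sup>2) \<le> (norm x)\<^sup>2"
  unfolding norm_h_zero_log_sq
  using assms Hr0_logD(3)[OF entry[of x]] log_weight_mult_nonneg by (intro finite_sum_le_infsum) auto

lemma bounded_linear_entry: "bounded_linear (\<lambda>x. entry x n)"
proof (rule bounded_linear_intro[where K = "1 / sqrt (ln 2)"])
  show "entry (x + y) n = entry x n + entry y n" for x y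
    by (simp add: plus_h_zero_log.rep_eq)
  show "entry (r *\<^sub>R x) n = r *\<^sub>R entry x n" for r x
    by (simp add: scaleR_h_zero_log.rep_eq scaleR_conv_of_real)
  show "norm (entry x n) \<le> norm x * (1 / sqrt (ln 2))" for x
  proof -
    have "ln 2 \<le> log_weight 0 n"
      using jap_ge_1[of n] by (simp add: log_weight_def)
    then have "ln 2 * (cmod (entry x n))\<^sup>2 \<le> log_weight 0 n * (cmod (entry x n))\<^sup>2"
      by (rule mult_right_mono) auto
    also have "\<dots> \<le> (norm x)\<^sup>2"
      using sum_entry_le_norm[of "{n}" x] by simp
    finally have "sqrt (ln 2 * (cmod (entry x n))\<^sup>2) \<le> norm x"
      by (rule real_le_lsqrt[OF norm_ge_zero])
    then show ?thesis by (simp add: real_sqrt_mult field_simps)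
  qed
qed

text \<open>
  The second Taylor coefficient \<open>A [w, w]\<close> of \<open>\<Psi>\<close> at 0 is determined coordinatewise by the values of
  \<open>\<Phi>\<close> on the ray through \<open>w\<close>, and its boundedness is the estimate claimed. The finite set \<open>J\<close>
  selects the coordinates where the quadratic term will be evaluated.
\<close>

lemma analytic_extension_bounds_quadratic_term:
  fixes \<Psi> :: "H_mhalf_log \<Rightarrow> h_zero_log"
  assumes s: "s > - 1/2" and analytic: "real_analytic \<Psi>"
    and ext: "\<And>u. fourier_coeff u \<in> Hr0 s \<Longrightarrow> entry (\<Psi> u) = Birkhoff s (fourier_coeff u)"
  shows "\<exists>C\<ge>0. \<forall>K h J. trig_poly K h \<longrightarrow> finite J \<longrightarrow> J \<subseteq> {1..} \<longrightarrow>
    (\<Sum>n\<in>J. ln (real n + 1) / real n * (cmod (quadratic_term K h n))\<^sup>2)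
      \<le> C * (\<Sum>k\<in>{-K..K}. log_weight (- 1/2) k * (cmod (h k))\<^sup>2)\<^sup>2"
proof -
  obtain A C r where r: "r > 0" and C: "\<And>k. C k \<ge> 0"
    and A: "\<And>k. multilinear_bounded k (C k) A"
    and summ: "summable (\<lambda>k. C k * r ^ k)"
    and taylor: "\<And>h. norm h < r \<Longrightarrow> (\<lambda>k. A (replicate k h)) sums \<Psi> (0 + h)"
    using analytic unfolding real_analytic_def real_analytic_at_def by meson
  define \<sigma> where "\<sigma> = min s 0"
  have \<sigma>: "-1 \<le> \<sigma>" "\<sigma> \<le> 0" using s by (auto simp: \<sigma>_def)
  have A_bound: "norm (A (replicate k x)) \<le> C k * norm x ^ k" for k x
    using A[of k] unfolding multilinear_bounded_def
    by (metis length_replicate map_replicate prod_list_replicate)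
  have "(\<Sum>n\<in>J. ln (real n + 1) / real n * (cmod (quadratic_term K h n))\<^sup>2)
      \<le> (C 2)\<^sup>2 * (\<Sum>k\<in>{-K..K}. log_weight (- 1/2) k * (cmod (h k))\<^sup>2)\<^sup>2"
    if h: "trig_poly K h" and J: "finite J" "J \<subseteq> {1..}" for K h and J :: "nat set"
  proof -
    define w where "w = Abs_H_mhalf_log h"
    have w: "fourier_coeff w = h"
      unfolding w_def by (rule Abs_H_mhalf_log_inverse[OF trig_poly_Hr0(2)[OF h]])
    have coeff: "entry (A (replicate 2 w)) (int n) = - quadratic_term K h n / sqrt n" if n: "1 \<le> n" for n
    proof -
      obtain R\<^sub>0 C\<^sub>0 where R\<^sub>0: "R\<^sub>0 > 0" and asym: "\<And>t. 0 < t \<Longrightarrow> t < R\<^sub>0 \<Longrightarrow>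
        cmod (Birkhoff_pos \<sigma> (\<lambda>k. complex_of_real t * h k) n
          - (complex_of_real t * (- h (int n) / sqrt n) + complex_of_real (t\<^sup>2) * (- quadratic_term K h n / sqrt n)))
        \<le> C\<^sub>0 * t ^ 3"
        using Birkhoff_pos_second_order[OF h \<sigma> n] by blast
      \<comment> \<open>Small enough for the expansion of \<open>\<Phi>\<close> and for the Taylor series of \<open>\<Psi>\<close> on the ray.\<close>
      define R where "R = min R\<^sub>0 (r / (norm w + 1))"
      have w1: "0 < norm w + 1" by (simp add: add_nonneg_pos)
      have R: "0 < R" using R\<^sub>0 r w1 by (simp add: R_def)
      have Rw: "R * norm w \<le> r"
      proof -
        have "R * (norm w + 1) \<le> r / (norm w + 1) * (norm w + 1)"
          using w1 by (intro mult_right_mono) (auto simp: R_def)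
        also have "\<dots> = r" using w1 by simp
        finally show ?thesis using R by (simp add: distrib_left)
      qed
      interpret E: bounded_linear "\<lambda>x. entry x (int n)" by (rule bounded_linear_entry)
      obtain B where B: "\<And>x. cmod (entry x (int n)) \<le> norm x * B" "0 < B"
        using E.pos_bounded by blast
      define y where "y = (\<lambda>k. entry (A (replicate k w)) (int n))"
      have "y 2 = - quadratic_term K h n / sqrt n"
      proof (rule second_coefficient_unique[OF R])
        have bnd: "norm (cmod (y k) * R ^ k) \<le> B * (C k * r ^ k)" for k
        proof -
          have "cmod (y k) \<le> (C k * norm w ^ k) * B"
            unfolding y_def using B(1)[of "A (replicate k w)"] mult_right_mono[OF A_bound[of k w], of B] B(2) by linarith
          then have "cmod (y k) * R ^ k \<le> ((C k * norm w ^ k) * B) * R ^ k"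
            using R by (intro mult_right_mono) auto
          also have "\<dots> = B * (C k * (R * norm w) ^ k)" by (simp add: power_mult_distrib mult_ac)
          also have "\<dots> \<le> B * (C k * r ^ k)"
            using Rw R B(2) C[of k] by (intro mult_left_mono power_mono) auto
          finally show ?thesis using R by simp
        qed
        show "summable (\<lambda>k. cmod (y k) * R ^ k)"
          by (rule summable_comparison_test'[OF summable_mult[OF summ, of B], of 0]) (rule bnd)
        fix t :: real assume t: "0 < t" "t < R"
        have "t * norm w < r"
        proof -
          have "t * (norm w + 1) < R * (norm w + 1)" using t w1 by (intro mult_strict_right_mono)
          also have "\<dots> \<le> r / (norm w + 1) * (norm w + 1)"
            using w1 by (intro mult_right_mono) (auto simp: R_def)
          also have "\<dots> = r" using w1 by simp
          finally show ?thesis using t by (simp add: distrib_left)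
        qed
        then have "(\<lambda>k. A (replicate k (t *\<^sub>R w))) sums \<Psi> (t *\<^sub>R w)"
          using taylor[of "t *\<^sub>R w"] t by simp
        then have "(\<lambda>k. entry (A (replicate k (t *\<^sub>R w))) (int n)) sums entry (\<Psi> (t *\<^sub>R w)) (int n)"
          by (rule E.sums)
        moreover have "entry (A (replicate k (t *\<^sub>R w))) (int n) = complex_of_real (t ^ k) * y k" for k
          unfolding multilinear_replicate_scaleR[OF A] y_def
          by (simp add: scaleR_h_zero_log.rep_eq)
        ultimately show "(\<lambda>k. complex_of_real (t ^ k) * y k) sums entry (\<Psi> (t *\<^sub>R w)) (int n)" by simp
        have tw: "fourier_coeff (t *\<^sub>R w) = (\<lambda>k. complex_of_real t * h k)"
          by (simp add: scaleR_H_mhalf_log.rep_eq w)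
        have "entry (\<Psi> (t *\<^sub>R w)) = Birkhoff s (\<lambda>k. complex_of_real t * h k)"
          using ext[of "t *\<^sub>R w"] trig_poly_Hr0(1)[OF trig_poly_scale[OF h]] unfolding tw by blast
        then have "entry (\<Psi> (t *\<^sub>R w)) (int n) = Birkhoff_pos \<sigma> (\<lambda>k. complex_of_real t * h k) n"
          using n by (simp add: Birkhoff_def \<sigma>_def)
        then show "cmod (entry (\<Psi> (t *\<^sub>R w)) (int n)
            - (complex_of_real t * (- h (int n) / sqrt n) + complex_of_real (t\<^sup>2) * (- quadratic_term K h n / sqrt n))) \<le> C\<^sub>0 * t ^ 3"
          using asym[of t] t by (simp add: R_def)
      qed
      then show ?thesis by (simp add: y_def)
    qed
    have "(\<Sum>n\<in>J. ln (real n + 1) / real n * (cmod (quadratic_term K h n))\<^sup>2)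
        = (\<Sum>n\<in>J. log_weight 0 (int n) * (cmod (entry (A (replicate 2 w)) (int n)))\<^sup>2)"
    proof (intro sum.cong refl)
      fix n assume "n \<in> J"
      then have n: "1 \<le> n" using J by auto
      have "log_weight 0 (int n) = ln (real n + 1)"
        using n by (simp add: log_weight_def jap_def)
      moreover have "(cmod (entry (A (replicate 2 w)) (int n)))\<^sup>2 = (cmod (quadratic_term K h n))\<^sup>2 / real n"
        unfolding coeff[OF n] by (simp add: norm_divide power_divide)
      ultimately show "ln (real n + 1) / real n * (cmod (quadratic_term K h n))\<^sup>2
          = log_weight 0 (int n) * (cmod (entry (A (replicate 2 w)) (int n)))\<^sup>2" by simp
    qed
    also have "\<dots> = (\<Sum>n\<in>int ` J. log_weight 0 n * (cmod (entry (A (replicate 2 w)) n))\<^sup>2)"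
      by (simp add: sum.reindex)
    also have "\<dots> \<le> (norm (A (replicate 2 w)))\<^sup>2"
      by (rule sum_entry_le_norm) (use J in simp)
    also have "\<dots> \<le> (C 2 * norm w ^ 2)\<^sup>2"
      by (intro power_mono A_bound) auto
    also have "\<dots> = (C 2)\<^sup>2 * (\<Sum>k\<in>{-K..K}. log_weight (- 1/2) k * (cmod (h k))\<^sup>2)\<^sup>2"
      using norm_H_mhalf_log_sq[of w] trig_poly_summable(2)[OF h, of "log_weight (- 1/2)"]
      by (simp add: w power_mult_distrib)
    finally show ?thesis .
  qed
  then show ?thesis by (intro exI[of _ "(C 2)\<^sup>2"]) auto
qed

section \<open>The quadratic term is unbounded\<close>

definition log_sum :: "nat \<Rightarrow> real" where
  "log_sum M = (\<Sum>l=1..M. 1 / (real l * ln (real l + 1)))"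

text \<open>
  The function \<open>ln (ln x)\<close> is a primitive of \<open>1 / (x ln x)\<close>; the comparison of its increments uses
  \<open>ln y \<le> y - 1\<close> twice.
\<close>

lemma log_sum_ge: "ln (ln (real M + 2)) - ln (ln 2) \<le> log_sum M"
proof (induction M)
  case (Suc M)
  define a b where "a = ln (real M + 3)" and "b = ln (real M + 2)"
  have b: "0 < b" and a: "0 < a" by (simp_all add: a_def b_def)
  have "ln a - ln b = ln (a / b)" using a b by (simp add: ln_div)
  also have "\<dots> \<le> a / b - 1" using a b by (intro ln_le_minus_one) simp
  also have "\<dots> = (a - b) / b" using b by (simp add: field_simps)
  also have "\<dots> \<le> (1 / (real M + 1)) / b"
  proof (rule divide_right_mono)
    have "a - b = ln ((real M + 3) / (real M + 2))" by (simp add: a_def b_def ln_div)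
    also have "\<dots> \<le> (real M + 3) / (real M + 2) - 1" by (intro ln_le_minus_one) simp
    also have "\<dots> \<le> 1 / (real M + 1)" by (simp add: field_simps)
    finally show "a - b \<le> 1 / (real M + 1)" .
  qed (use b in simp)
  finally have "ln a - ln b \<le> 1 / (real (Suc M) * ln (real (Suc M) + 1))"
    by (simp add: b_def add_ac)
  then show ?case using Suc by (simp add: log_sum_def a_def b_def add_ac)
qed (simp add: log_sum_def)

lemma log_sum_unbounded: "\<exists>M\<ge>1. B < log_sum M"
proof -
  obtain M :: nat where M: "exp (exp (B + 1 + ln (ln 2))) \<le> real M"
    using real_arch_simple by blast
  have "exp (exp (B + 1 + ln (ln 2))) \<le> real M + 2" using M by simp
  then have "exp (B + 1 + ln (ln 2)) \<le> ln (real M + 2)"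
    using ln_mono[of "exp (exp (B + 1 + ln (ln 2)))" "real M + 2"] by simp
  then have "B + 1 + ln (ln 2) \<le> ln (ln (real M + 2))"
    using ln_mono[of "exp (B + 1 + ln (ln 2))" "ln (real M + 2)"] by simp
  then have "B < log_sum M" using log_sum_ge[of M] by simp
  moreover have "0 < real M" using M by (rule less_le_trans[OF exp_gt_zero])
  then have "1 \<le> M" by simp
  ultimately show ?thesis by blast
qed

text \<open>
  The test potential has low frequencies \<open>1..M\<close> with coefficients \<open>i / ln (l + 1)\<close> and a block of
  high frequencies in \<open>3M+1..6M\<close> with the constant coefficient \<open>\<eta>\<close>. For \<open>n\<close> in the middle third
  \<open>4M+1..5M\<close> of the block, all \<open>n \<plusminus> l\<close> stay inside the block.
\<close>

definition low :: "nat \<Rightarrow> int \<Rightarrow> real" where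
  "low M k = (if 1 \<le> k \<and> k \<le> int M then 1 / ln (real_of_int k + 1) else 0)"

definition high :: "nat \<Rightarrow> real \<Rightarrow> int \<Rightarrow> real" where
  "high M \<eta> k = (if 3 * int M < k \<and> k \<le> 6 * int M then \<eta> else 0)"

definition test_poly :: "nat \<Rightarrow> real \<Rightarrow> int \<Rightarrow> complex" where
  "test_poly M \<eta> k = Complex (high M \<eta> \<bar>k\<bar>) (of_int (sgn k) * low M \<bar>k\<bar>)"

lemma low_nonneg: "0 \<le> low M k"
  by (auto simp: low_def)

lemma high_nonneg: "0 \<le> \<eta> \<Longrightarrow> 0 \<le> high M \<eta> k"
  by (auto simp: high_def)

lemma trig_poly_test_poly: "trig_poly (6 * int M) (test_poly M \<eta>)"
  by (auto simp: trig_poly_def test_poly_def low_def high_def complex_eq_iff)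

lemma test_poly_norm:
  "(\<Sum>k\<in>{-(6 * int M)..6 * int M}. log_weight (- 1/2) k * (cmod (test_poly M \<eta> k))\<^sup>2)
    = 2 * log_sum M + 2 * \<eta>\<^sup>2 * (\<Sum>k=3*M+1..6*M. ln (real k + 1) / real k)"
proof -
  define g where "g = (\<lambda>k. log_weight (- 1/2) k * (cmod (test_poly M \<eta> k))\<^sup>2)"
  define a where "a = (\<lambda>k. log_weight (- 1/2) k * (low M k)\<^sup>2)"
  define b where "b = (\<lambda>k. log_weight (- 1/2) k * (high M \<eta> k)\<^sup>2)"
  have even: "g (- k) = g k" for k
    by (simp add: g_def log_weight_def jap_def test_poly_def cmod_power2 power_mult_distrib)
  have g_pos: "g k = a k + b k" if "1 \<le> k" for k
    using that by (simp add: g_def a_def b_def test_poly_def cmod_power2 distrib_left)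
  have weight: "log_weight (- 1/2) (int k) = ln (real k + 1) / real k" if "1 \<le> k" for k
  proof -
    have "jap (int k) = real k" using that by (simp add: jap_def)
    then show ?thesis using that by (simp add: log_weight_def powr_neg_one)
  qed
  have "(\<Sum>k\<in>{-(6 * int M)..6 * int M}. g k) = (\<Sum>k\<in>uminus ` {1..6 * int M} \<union> ({0} \<union> {1..6 * int M}). g k)"
  proof (rule sum.cong)
    show "{-(6 * int M)..6 * int M} = uminus ` {1..6 * int M} \<union> ({0} \<union> {1..6 * int M})"
      unfolding image_uminus_atLeastAtMost by (intro set_eqI) (simp, arith)
  qed simp
  also have "\<dots> = (\<Sum>k\<in>uminus ` {1..6 * int M}. g k) + (g 0 + (\<Sum>k\<in>{1..6 * int M}. g k))"
  proof -
    have "sum g (uminus ` {1..6 * int M} \<union> ({0} \<union> {1..6 * int M}))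
        = sum g (uminus ` {1..6 * int M}) + sum g ({0} \<union> {1..6 * int M})"
      by (rule sum.union_disjoint) auto
    also have "sum g ({0} \<union> {1..6 * int M}) = g 0 + sum g {1..6 * int M}"
      by (subst sum.union_disjoint) auto
    finally show ?thesis .
  qed
  also have "(\<Sum>k\<in>uminus ` {1..6 * int M}. g k) = (\<Sum>k\<in>{1..6 * int M}. g k)"
    by (subst sum.reindex) (auto simp: even)
  also have "g 0 = 0"
    by (simp add: g_def test_poly_def low_def high_def complex_eq_iff)
  also have "(\<Sum>k\<in>{1..6 * int M}. g k) = (\<Sum>k\<in>{1..6 * int M}. a k) + (\<Sum>k\<in>{1..6 * int M}. b k)"
    unfolding sum.distrib[symmetric] by (intro sum.cong refl) (simp add: g_pos)
  also have "(\<Sum>k\<in>{1..6 * int M}. a k) = (\<Sum>k\<in>int ` {1..M}. a k)"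
    by (rule sum.mono_neutral_right) (auto simp: image_int_atLeastAtMost a_def low_def)
  also have "\<dots> = log_sum M"
  proof -
    have "a (int l) = 1 / (real l * ln (real l + 1))" if "l \<in> {1..M}" for l
      using that unfolding a_def by (subst weight) (auto simp: low_def power2_eq_square)
    then show ?thesis by (simp add: log_sum_def sum.reindex)
  qed
  also have "(\<Sum>k\<in>{1..6 * int M}. b k) = (\<Sum>k\<in>int ` {3*M+1..6*M}. b k)"
    by (rule sum.mono_neutral_right) (auto simp: image_int_atLeastAtMost b_def high_def)
  also have "\<dots> = \<eta>\<^sup>2 * (\<Sum>k=3*M+1..6*M. ln (real k + 1) / real k)"
  proof -
    have "b (int k) = \<eta>\<^sup>2 * (ln (real k + 1) / real k)" if "k \<in> {3*M+1..6*M}" for k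
      using that unfolding b_def by (subst weight) (auto simp: high_def)
    then show ?thesis unfolding sum_distrib_left by (simp add: sum.reindex)
  qed
  finally show ?thesis by (simp add: g_def)
qed

text \<open>
  All products of a low and a high coefficient contribute to the imaginary part with the same
  sign: if \<open>n - m\<close> is the low frequency, reflecting \<open>m\<close> at \<open>n\<close> changes the sign of both the
  denominator and the imaginary low coefficient, and if \<open>m\<close> is low, then \<open>m < n\<close>. Products of two high coefficients are real and two low frequencies do not reach \<open>n\<close>.
  It thus suffices to keep the terms \<open>m = n \<plusminus> l\<close> with \<open>l \<le> M\<close>, each of which contributes
  \<open>\<eta> / (l ln (l + 1))\<close>.
\<close>

lemma quadratic_term_test_poly:
  assumes n: "4 * M < n" "n \<le> 5 * M" and \<eta>: "0 \<le> \<eta>"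
  shows "2 * \<eta> * log_sum M \<le> cmod (quadratic_term (6 * int M) (test_poly M \<eta>) n)"
proof -
  define h where "h = test_poly M \<eta>"
  define d where "d = (\<lambda>m. - Im (h m * h (int n - m) / of_int (m - int n)))"
  define X where "X = {1..6 * int M} - {int n}"
  have d_eq: "d m = high M \<eta> m * low M \<bar>m - int n\<bar> / \<bar>m - int n\<bar> + low M m * high M \<eta> (int n - m) / (int n - m)"
    if m: "m \<in> X" for m
  proof -
    have m1: "1 \<le> m" "m \<noteq> int n" using m by (auto simp: X_def)
    have "Im (h m * h (int n - m)) = high M \<eta> m * (of_int (sgn (int n - m)) * low M \<bar>int n - m\<bar>) + low M m * high M \<eta> \<bar>int n - m\<bar>"
      using m1 by (simp add: h_def test_poly_def)
    moreover have "low M m * high M \<eta> \<bar>int n - m\<bar> = low M m * high M \<eta> (int n - m)"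
      using n by (cases "m \<le> int M") (auto simp: low_def)
    ultimately have *: "Im (h m * h (int n - m)) = high M \<eta> m * (of_int (sgn (int n - m)) * low M \<bar>m - int n\<bar>) + low M m * high M \<eta> (int n - m)"
      by (simp add: abs_minus_commute)
    have "d m = - (Im (h m * h (int n - m)) / of_int (m - int n))"
      unfolding d_def by (metis Im_divide_of_real of_real_of_int_eq)
    also have "\<dots> = high M \<eta> m * low M \<bar>m - int n\<bar> / \<bar>m - int n\<bar> + low M m * high M \<eta> (int n - m) / (int n - m)"
    proof -
      define x where "x = real_of_int (m - int n)"
      have x: "real_of_int \<bar>m - int n\<bar> = \<bar>x\<bar>" "real_of_int (int n - m) = - x" "real_of_int (m - int n) = x"
        by (simp_all add: x_def)
      have "x < 0 \<and> sgn (int n - m) = 1 \<or> x > 0 \<and> sgn (int n - m) = - 1"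
        using m1(2) by (auto simp: x_def sgn_if)
      then show ?thesis
        unfolding * x by (elim disjE conjE) (simp_all add: add_divide_distrib diff_divide_distrib)
    qed
    finally show ?thesis .
  qed
  have d_nonneg: "0 \<le> d m" if "m \<in> X" for m
  proof -
    have "0 \<le> low M m * high M \<eta> (int n - m) / (int n - m)"
      using n low_nonneg[of M m] high_nonneg[OF \<eta>, of M "int n - m"]
      by (cases "m \<le> int M") (auto simp: low_def[of M m])
    then show ?thesis
      unfolding d_eq[OF that]
      using low_nonneg high_nonneg[OF \<eta>] by (intro add_nonneg_nonneg) (auto intro!: divide_nonneg_nonneg mult_nonneg_nonneg)
  qed
  have d_ge: "\<eta> / (real l * ln (real l + 1)) \<le> d m"
    if l: "l \<in> {1..M}" "m = int n + int l \<or> m = int n - int l" for m l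
  proof -
    have abs: "\<bar>m - int n\<bar> = int l" using l(2) by auto
    have "m \<in> X" using l n by (auto simp: X_def)
    moreover have "3 * int M < m" "m \<le> 6 * int M" using l n by auto
    ultimately have "d m = \<eta> * (1 / ln (real l + 1)) / real l"
      using l by (simp add: d_eq abs) (simp add: high_def low_def)
    then show ?thesis by (simp add: mult.commute)
  qed
  have "2 * \<eta> * log_sum M = (\<Sum>l=1..M. \<eta> / (real l * ln (real l + 1))) + (\<Sum>l=1..M. \<eta> / (real l * ln (real l + 1)))"
    by (simp add: log_sum_def sum_distrib_left)
  also have "\<dots> \<le> (\<Sum>l=1..M. d (int n + int l)) + (\<Sum>l=1..M. d (int n - int l))"
    by (intro add_mono sum_mono) (auto intro!: d_ge)
  also have "\<dots> = sum d ((\<lambda>l. int n + int l) ` {1..M}) + sum d ((\<lambda>l. int n - int l) ` {1..M})"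
    by (simp add: sum.reindex inj_on_def)
  also have "\<dots> = sum d ((\<lambda>l. int n + int l) ` {1..M} \<union> (\<lambda>l. int n - int l) ` {1..M})"
    by (rule sum.union_disjoint[symmetric]) auto
  also have "\<dots> \<le> sum d X"
    by (rule sum_mono2) (use n d_nonneg in \<open>auto simp: X_def\<close>)
  also have "\<dots> = - Im (quadratic_term (6 * int M) h n)"
    by (simp add: quadratic_term_def d_def X_def sum_negf)
  also have "\<dots> \<le> cmod (quadratic_term (6 * int M) h n)"
    using abs_Im_le_cmod[of "quadratic_term (6 * int M) h n"] by linarith
  finally show ?thesis by (simp add: h_def)
qed

text \<open>
  A weight \<open>ln (k + 1) / k\<close> in the block is at most 4 times any weight in its middle third, as
  \<open>6M + 1 \<le> (4M + 1)\<^sup>2\<close>.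
\<close>

lemma high_window_sums:
  assumes "1 \<le> M"
  shows "(\<Sum>k=3*M+1..6*M. ln (real k + 1) / real k) \<le> 12 * (\<Sum>n=4*M+1..5*M. ln (real n + 1) / real n)"
proof -
  define v where "v = ln (4 * real M + 1) / (5 * real M)"
  have M: "1 \<le> real M" using assms by simp
  have ln0: "0 \<le> ln (4 * real M + 1)" using M by simp
  have "(\<Sum>k=3*M+1..6*M. ln (real k + 1) / real k) \<le> (\<Sum>k=3*M+1..6*M. 4 * v)"
  proof (rule sum_mono)
    fix k assume k: "k \<in> {3*M+1..6*M}"
    have "ln (real k + 1) \<le> ln ((4 * real M + 1)\<^sup>2)"
    proof (rule ln_mono)
      have "real k + 1 \<le> 6 * real M + 1" using k by simp
      also have "\<dots> \<le> (4 * real M + 1)\<^sup>2" using M by (simp add: power2_eq_square algebra_simps)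
      finally show "real k + 1 \<le> (4 * real M + 1)\<^sup>2" .
    qed simp_all
    also have "\<dots> = 2 * ln (4 * real M + 1)" using M by (simp add: ln_realpow)
    finally have "ln (real k + 1) / real k \<le> (2 * ln (4 * real M + 1)) / (3 * real M)"
      using k M ln0 by (intro frac_le) auto
    also have "\<dots> \<le> 4 * v"
      using ln0 M by (simp add: v_def field_simps)
    finally show "ln (real k + 1) / real k \<le> 4 * v" .
  qed
  also have "\<dots> = 12 * (\<Sum>n=4*M+1..5*M. v)" by simp
  also have "(\<Sum>n=4*M+1..5*M. v) \<le> (\<Sum>n=4*M+1..5*M. ln (real n + 1) / real n)"
  proof (rule sum_mono)
    fix n assume n: "n \<in> {4*M+1..5*M}"
    have "ln (4 * real M + 1) \<le> ln (real n + 1)" using n M by (intro ln_mono) auto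
    then show "v \<le> ln (real n + 1) / real n"
      unfolding v_def using n M ln0 by (intro frac_le) auto
  qed
  finally show ?thesis by simp
qed

text \<open>
  With \<open>\<eta>\<close> chosen so that the high block has the same squared norm as the low part, that is \<open>2 S\<close> for
  \<open>S = log_sum M\<close>, the right-hand side is \<open>16 C S\<^sup>2\<close>, whereas the left-hand side is at
  least \<open>S\<^sup>3 / 3\<close>.
\<close>

lemma quadratic_term_unbounded:
  assumes "C \<ge> 0"
  shows "\<exists>K h J. trig_poly K h \<and> finite J \<and> J \<subseteq> {1..} \<and>
    (\<Sum>n\<in>J. ln (real n + 1) / real n * (cmod (quadratic_term K h n))\<^sup>2)
      > C * (\<Sum>k\<in>{-K..K}. log_weight (- 1/2) k * (cmod (h k))\<^sup>2)\<^sup>2"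
proof -
  obtain M where M: "M \<ge> 1" "48 * C < log_sum M" using log_sum_unbounded by blast
  define S where "S = log_sum M"
  define B where "B = (\<Sum>k=3*M+1..6*M. ln (real k + 1) / real k)"
  define B' where "B' = (\<Sum>n=4*M+1..5*M. ln (real n + 1) / real n)"
  have S: "0 < S" using M assms by (simp add: S_def)
  have B: "0 < B"
    unfolding B_def using M(1) by (intro sum_pos) auto
  define \<eta> where "\<eta> = sqrt (S / B)"
  have \<eta>: "0 \<le> \<eta>" "\<eta>\<^sup>2 * B = S"
    using S B by (simp_all add: \<eta>_def)
  define h where "h = test_poly M \<eta>"
  have "C * (\<Sum>k\<in>{-(6 * int M)..6 * int M}. log_weight (- 1/2) k * (cmod (h k))\<^sup>2)\<^sup>2 = C * (4 * S)\<^sup>2"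
  proof -
    have "2 * \<eta>\<^sup>2 * B = 2 * S" using \<eta>(2) by simp
    then show ?thesis unfolding h_def test_poly_norm B_def[symmetric] S_def[symmetric] by (simp only:) simp
  qed
  also have "\<dots> < S ^ 3 / 3"
  proof -
    have "C * 48 * S\<^sup>2 < S * S\<^sup>2"
      using M(2) S by (intro mult_strict_right_mono) (auto simp: S_def)
    then show ?thesis by (simp add: power2_eq_square power3_eq_cube)
  qed
  also have "\<dots> = (2 * \<eta> * S)\<^sup>2 * (B / 12)"
  proof -
    have "(2 * \<eta> * S)\<^sup>2 * (B / 12) = S\<^sup>2 * (\<eta>\<^sup>2 * B) / 3"
      by (simp add: power_mult_distrib)
    moreover have "S\<^sup>2 * (\<eta>\<^sup>2 * B) / 3 = S ^ 3 / 3"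
      unfolding \<eta>(2) by (simp add: power3_eq_cube power2_eq_square)
    ultimately show ?thesis by (simp only:)
  qed
  also have "\<dots> \<le> (2 * \<eta> * S)\<^sup>2 * B'"
    using high_window_sums[OF M(1)] by (intro mult_left_mono) (auto simp: B_def B'_def)
  also have "\<dots> = (\<Sum>n=4*M+1..5*M. ln (real n + 1) / real n * (2 * \<eta> * S)\<^sup>2)"
    unfolding B'_def sum_distrib_right[symmetric] by (rule mult.commute)
  also have "\<dots> \<le> (\<Sum>n=4*M+1..5*M. ln (real n + 1) / real n * (cmod (quadratic_term (6 * int M) h n))\<^sup>2)"
  proof (intro sum_mono mult_left_mono power_mono)
    fix n assume "n \<in> {4*M+1..5*M}"
    then show "2 * \<eta> * S \<le> cmod (quadratic_term (6 * int M) h n)"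
      unfolding h_def S_def by (intro quadratic_term_test_poly \<eta>) auto
  qed (use \<eta> S in auto)
  finally show ?thesis
    using trig_poly_test_poly[of M \<eta>] by (intro exI[of _ "6 * int M"] exI[of _ h] exI[of _ "{4*M+1..5*M}"]) (auto simp: h_def)
qed

text \<open>
  The bound implied by an analytic extension and the unboundedness of the quadratic term
  contradict each other.
\<close>

theorem proposition1p2:
  fixes s :: real
  assumes "s > - 1/2"
  shows "\<not> (\<exists>\<Psi> :: H_mhalf_log \<Rightarrow> h_zero_log.
           real_analytic \<Psi> \<and>
           (\<forall>u. fourier_coeff u \<in> Hr0 s \<longrightarrow> entry (\<Psi> u) = Birkhoff s (fourier_coeff u)))"
proof
  assume "\<exists>\<Psi> :: H_mhalf_log \<Rightarrow> h_zero_log.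
           real_analytic \<Psi> \<and>
           (\<forall>u. fourier_coeff u \<in> Hr0 s \<longrightarrow> entry (\<Psi> u) = Birkhoff s (fourier_coeff u))"
  then obtain \<Psi> :: "H_mhalf_log \<Rightarrow> h_zero_log" where "real_analytic \<Psi>"
    "\<And>u. fourier_coeff u \<in> Hr0 s \<Longrightarrow> entry (\<Psi> u) = Birkhoff s (fourier_coeff u)"
    by blast
  from analytic_extension_bounds_quadratic_term[OF assms this]
  obtain C where "C \<ge> 0" and C: "\<And>K h J. trig_poly K h \<Longrightarrow> finite J \<Longrightarrow> J \<subseteq> {1..} \<Longrightarrow>
    (\<Sum>n\<in>J. ln (real n + 1) / real n * (cmod (quadratic_term K h n))\<^sup>2)
      \<le> C * (\<Sum>k\<in>{-K..K}. log_weight (- 1/2) k * (cmod (h k))\<^sup>2)\<^sup>2"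
    by blast
  from quadratic_term_unbounded[OF \<open>C \<ge> 0\<close>] show False
    using C by (meson not_le)
qed

end
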